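(* (Lipschitz continuity of optimal trajectories on a general network.) Let $\mathcal N$ be a network, let the data $(\ell_i)_i$, $(\ell_{*j})_j$, $(g_i)_i$, $(g_{*j})_j$ satisfy the standing assumptions listed in the context, and assume in addition that $g_i\in C^1(I_i)$ for all $i\in\{1,\dots,N\}$. Then for every $(x,t)\in\mathcal N\times[0,T]$ and every $y\in\Gamma_t^{\rm opt}[x]$, $y'$ belongs to $L^\infty(t,T;\mathbb R^d)$. Moreover, there exists a positive constant $V$, depending (for a fixed network and fixed data) only upon $|x|$ and $T-t$ (and which may blow up as $t\to T$), such that $\|y'\|_\infty\le V$.
   Context: Network: $\mathcal N$ is a connected subset of $\mathbb R^d$ made of a finite set of vertices $\mathcal V=\{O_1,\dots,O_n\}$ and finitely many closed edges $J_1,\dots,J_N$, each edge $J_i$ being either the segment joining two distinct vertices $O_{j_1},O_{j_2}$ ($j_1<j_2$), of length $l_i\in(0,\infty)$, parametrized by $\pi_i:[0,l_i]\to J_i$, $\pi_i(s)=[(l_i-s)O_{j_1}+sO_{j_2}]/l_i$, or a half-line starting at a vertex $O_j$ with unit direction $e_i$ ($l_i=\infty$), parametrized by $\pi_i:[0,\infty)\to J_i$, $\pi_i(s)=O_j+se_i$. For $i\ne i'$, $J_i\cap J_{i'}$ is empty or a single vertex. Write $e_i=\pi_i'$ for the unit direction of $J_i$ and $I_i=[0,l_i]$ (or $[0,\infty)$ if $l_i=\infty$). Fix $T>0$ and $p>1$. Trajectories: for $x\in\mathcal N$, $t\in[0,T]$, $\Gamma_t[x]$ is the set of $y\in C([t,T];\mathcal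 N)\cap W^{1,p}(t,T;\mathbb R^d)$ with $y(t)=x$ (for a.e. $s$ with $y(s)\in J_i\setminus\mathcal V$, $y'(s)$ is a multiple of $e_i$). Data: $g_{*j}\in\mathbb R$, $g_i\in C_b(I_i)$ (bounded continuous), $\ell_{*j}\in C([0,T])$, $\ell_i\in C(I_i\times\mathbb R\times[0,T])$, $(y,a,s)\mapsto\ell_i(y,a,s)$, differentiable in $(y,a)$ with $\partial_y\ell_i,\partial_a\ell_i$ continuous in $(y,a,s)$. Standing assumptions (for all $i,j$): (H1) there is $C_0>0$ with $\ell_i(y,a,s)\ge C_0(|a|^p-1)$ and $\ell_{*j}(s)\ge-C_0$; (H2) for any $r>0$ there is a modulus of continuity $\omega_r$ with $|\ell_i(y,a,t_1)-\ell_i(y,a,t_2)|\le(1+|a|^p)\omega_r(|t_1-t_2|)$ for $y\in I_i\cap[0,r]$, $a\in\mathbb R$, $t_1,t_2\in[0,T]$; (H3) for any $r>0$ there is $\tilde c(r)\ge0$ with $|\partial_y\ell_i(y,a,s)|\le\tilde c(r)(|a|^p+1)$, $|\partial_a\ell_i(y,a,s)|\le\tilde c(r)(|a|^{p-1}+1)$ for $y\in I_i\cap[0,r]$, $a\in\mathbb R$, $s\in[0,T]$; (H4) $a\mapsto\ell_i(y,a,s)$ is strictly convex. Costs: $\ell_{O_j}(\tau)=\min\{\ell_{*j}(\tau),\min_{i:\,O_j\in J_i}\ell_i(\pi_i^{-1}(O_j),0,\tau)\}$; $L(y,\alpha,\tau)=\sum_{i=1}^N\ell_i(\pi_i^{-1}(y),\alpha\cdot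 e_i,\tau)\mathbf 1_{y\in J_i\setminus\mathcal V}+\sum_{j=1}^n\ell_{O_j}(\tau)\mathbf 1_{y=O_j}$; $g(y)=\sum_ig_i(\pi_i^{-1}(y))\mathbf 1_{y\in J_i\setminus\mathcal V}+\sum_j\min\{g_{*j},\min_{i:\,O_j\in J_i}g_i(\pi_i^{-1}(O_j))\}\mathbf 1_{y=O_j}$; $J_t(x;y)=\int_t^TL(y(\tau),y'(\tau),\tau)\,d\tau+g(y(T))$ for $y\in\Gamma_t[x]$. Optimal trajectories: $\Gamma_t^{\rm opt}[x]=\{y\in\Gamma_t[x]:J_t(x;y)=\inf_{\hat y\in\Gamma_t[x]}J_t(x;\hat y)\}$. *)

theory Defs
  imports "HOL-Analysis.Analysis" "HOL-Probability.Essential_Supremum"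
begin

section \<open>Networks\<close>

text \<open>\<open>Segment j1 j2\<close> joins the vertices with indices \<open>j1\<close> and \<open>j2\<close>;
  \<open>Halfline j e\<close> starts at the vertex with index \<open>j\<close> and has direction \<open>e\<close>.\<close>

datatype 'a edge = Segment nat nat | Halfline nat 'a

text \<open>Vertices are indexed by \<open>{1..num_vertices G}\<close>, edges by \<open>{1..num_edges G}\<close>.\<close>

record 'a network =
  num_vertices :: nat
  vertex :: "nat \<Rightarrow> 'a"
  num_edges :: nat
  edge :: "nat \<Rightarrow> 'a edge"

definition vertices :: "('a::euclidean_space) network \<Rightarrow> 'a set" where
  "vertices G = vertex G ` {1..num_vertices G}"

definition edge_length :: "('a::euclidean_space) network \<Rightarrow> nat \<Rightarrow> ereal" where
  "edge_length G i = (case edge G i of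
      Segment j1 j2 \<Rightarrow> ereal (dist (vertex G j1) (vertex G j2))
    | Halfline j e \<Rightarrow> \<infinity>)"

definition edge_domain :: "('a::euclidean_space) network \<Rightarrow> nat \<Rightarrow> real set" where
  "edge_domain G i = {s. 0 \<le> s \<and> ereal s \<le> edge_length G i}"

definition edge_param :: "('a::euclidean_space) network \<Rightarrow> nat \<Rightarrow> real \<Rightarrow> 'a" where
  "edge_param G i s = (case edge G i of
      Segment j1 j2 \<Rightarrow>
        (let l = dist (vertex G j1) (vertex G j2)
         in ((l - s) *\<^sub>R vertex G j1 + s *\<^sub>R vertex G j2) /\<^sub>R l)
    | Halfline j e \<Rightarrow> vertex G j + s *\<^sub>R e)"

text \<open>The (constant) derivative of the parametrization.\<close>

definition edge_dir :: "('a::euclidean_space) network \<Rightarrow> nat \<Rightarrow> 'a" where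
  "edge_dir G i = (case edge G i of
      Segment j1 j2 \<Rightarrow>
        (vertex G j2 - vertex G j1) /\<^sub>R dist (vertex G j1) (vertex G j2)
    | Halfline j e \<Rightarrow> e)"

definition edge_set :: "('a::euclidean_space) network \<Rightarrow> nat \<Rightarrow> 'a set" where
  "edge_set G i = edge_param G i ` edge_domain G i"

definition edge_coord :: "('a::euclidean_space) network \<Rightarrow> nat \<Rightarrow> 'a \<Rightarrow> real" where
  "edge_coord G i = the_inv_into (edge_domain G i) (edge_param G i)"

definition network_set :: "('a::euclidean_space) network \<Rightarrow> 'a set" where
  "network_set G = vertices G \<union> (\<Union>i\<in>{1..num_edges G}. edge_set G i)"

definition incident_edges :: "('a::euclidean_space) network \<Rightarrow> nat \<Rightarrow> nat set" where
  "incident_edges G j = {i \<in> {1..num_edges G}. vertex G j \<in> edge_set G i}"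

definition is_network :: "('a::euclidean_space) network \<Rightarrow> bool" where
  "is_network G \<longleftrightarrow>
     inj_on (vertex G) {1..num_vertices G} \<and>
     (\<forall>i\<in>{1..num_edges G}. case edge G i of
          Segment j1 j2 \<Rightarrow> 1 \<le> j1 \<and> j1 < j2 \<and> j2 \<le> num_vertices G
        | Halfline j e \<Rightarrow> j \<in> {1..num_vertices G} \<and> norm e = 1) \<and>
     (\<forall>i\<in>{1..num_edges G}. \<forall>i'\<in>{1..num_edges G}. i \<noteq> i' \<longrightarrow>
        edge_set G i \<inter> edge_set G i' = {} \<or>
        (\<exists>v\<in>vertices G. edge_set G i \<inter> edge_set G i' = {v})) \<and>
     connected (network_set G)"


section \<open>Function spaces on an interval\<close>

definition Lp_on :: "real \<Rightarrow> real \<Rightarrow> real \<Rightarrow> (real \<Rightarrow> 'a::euclidean_space) \<Rightarrow> bool" where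
  "Lp_on p a b f \<longleftrightarrow>
     f \<in> borel_measurable (lebesgue_on {a..b}) \<and>
     integrable (lebesgue_on {a..b}) (\<lambda>s. norm (f s) powr p)"

definition Linf_norm :: "real \<Rightarrow> real \<Rightarrow> (real \<Rightarrow> 'a::euclidean_space) \<Rightarrow> ereal" where
  "Linf_norm a b f = esssup (lebesgue_on {a..b}) (\<lambda>s. ereal (norm (f s)))"

definition Linf_on :: "real \<Rightarrow> real \<Rightarrow> (real \<Rightarrow> 'a::euclidean_space) \<Rightarrow> bool" where
  "Linf_on a b f \<longleftrightarrow>
     f \<in> borel_measurable (lebesgue_on {a..b}) \<and> Linf_norm a b f < \<infinity>"

text \<open>Test functions are the \<open>C\<^sup>1\<close> functions with compact support in the open interval.\<close>

definition has_weak_deriv ::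
    "real \<Rightarrow> real \<Rightarrow> (real \<Rightarrow> 'a::euclidean_space) \<Rightarrow> (real \<Rightarrow> 'a) \<Rightarrow> bool" where
  "has_weak_deriv a b y v \<longleftrightarrow>
     integrable (lebesgue_on {a..b}) v \<and>
     (\<forall>\<phi> \<phi>' :: real \<Rightarrow> real.
        (\<forall>s. (\<phi> has_real_derivative \<phi>' s) (at s)) \<and> continuous_on UNIV \<phi>' \<and>
        (\<exists>c d. a < c \<and> d < b \<and> (\<forall>s. s \<notin> {c..d} \<longrightarrow> \<phi> s = 0)) \<longrightarrow>
        (LINT s|lebesgue_on {a..b}. \<phi>' s *\<^sub>R y s) =
        - (LINT s|lebesgue_on {a..b}. \<phi> s *\<^sub>R v s))"

definition W1p_on :: "real \<Rightarrow> real \<Rightarrow> real \<Rightarrow> (real \<Rightarrow> 'a::euclidean_space) \<Rightarrow> bool" where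
  "W1p_on p a b y \<longleftrightarrow> Lp_on p a b y \<and> (\<exists>v. has_weak_deriv a b y v \<and> Lp_on p a b v)"

text \<open>Weak derivatives are unique up to null sets, so the choice of representative affects
  neither integrals nor essential suprema.\<close>

definition weak_deriv ::
    "real \<Rightarrow> real \<Rightarrow> (real \<Rightarrow> 'a::euclidean_space) \<Rightarrow> real \<Rightarrow> 'a" where
  "weak_deriv a b y = (SOME v. has_weak_deriv a b y v)"

text \<open>Derivatives are relative to \<open>S\<close>, i.e. one-sided at the end points of an interval;
  the library's \<open>C1_differentiable_on\<close> asks for two-sided ones.\<close>

definition C1_on :: "real set \<Rightarrow> (real \<Rightarrow> real) \<Rightarrow> bool" where
  "C1_on S f \<longleftrightarrow>
     (\<exists>f'. (\<forall>s\<in>S. (f has_real_derivative f' s) (at s within S)) \<and> continuous_on S f')"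

definition strictly_convex_fun :: "(real \<Rightarrow> real) \<Rightarrow> bool" where
  "strictly_convex_fun f \<longleftrightarrow>
     (\<forall>a b u. a \<noteq> b \<longrightarrow> 0 < u \<longrightarrow> u < 1 \<longrightarrow>
        f ((1 - u) * a + u * b) < (1 - u) * f a + u * f b)"

definition modulus_of_continuity :: "(real \<Rightarrow> real) \<Rightarrow> bool" where
  "modulus_of_continuity \<omega> \<longleftrightarrow>
     \<omega> 0 = 0 \<and> mono_on {0..} \<omega> \<and> (\<omega> \<longlongrightarrow> 0) (at_right 0)"


section \<open>Cost data\<close>

text \<open>\<open>vertex_cost j s\<close>, \<open>edge_cost i y a s\<close>, \<open>vertex_final j\<close> and \<open>edge_final i y\<close> are
  $\ell_{*j}(s)$, $\ell_i(y,a,s)$, $g_{*j}$ and $g_i(y)$.\<close>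

record cost_data =
  vertex_cost :: "nat \<Rightarrow> real \<Rightarrow> real"
  edge_cost :: "nat \<Rightarrow> real \<Rightarrow> real \<Rightarrow> real \<Rightarrow> real"
  vertex_final :: "nat \<Rightarrow> real"
  edge_final :: "nat \<Rightarrow> real \<Rightarrow> real"

definition edge_cost_dy ::
    "('a::euclidean_space) network \<Rightarrow> cost_data \<Rightarrow> nat \<Rightarrow> real \<Rightarrow> real \<Rightarrow> real \<Rightarrow> real" where
  "edge_cost_dy G D i y a s =
     vector_derivative (\<lambda>z. edge_cost D i z a s) (at y within edge_domain G i)"

definition edge_cost_da :: "cost_data \<Rightarrow> nat \<Rightarrow> real \<Rightarrow> real \<Rightarrow> real \<Rightarrow> real" where
  "edge_cost_da D i y a s = vector_derivative (\<lambda>b. edge_cost D i y b s) (at a)"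

definition cost_regularity ::
    "('a::euclidean_space) network \<Rightarrow> cost_data \<Rightarrow> real \<Rightarrow> bool" where
  "cost_regularity G D T \<longleftrightarrow>
     (\<forall>j\<in>{1..num_vertices G}. continuous_on {0..T} (vertex_cost D j)) \<and>
     (\<forall>i\<in>{1..num_edges G}.
        continuous_on (edge_domain G i) (edge_final D i) \<and>
        bounded (edge_final D i ` edge_domain G i) \<and>
        continuous_on (edge_domain G i \<times> UNIV \<times> {0..T})
          (\<lambda>(y, a, s). edge_cost D i y a s) \<and>
        (\<forall>s\<in>{0..T}.
          (\<lambda>(y, a). edge_cost D i y a s) differentiable_on (edge_domain G i \<times> UNIV)) \<and>
        continuous_on (edge_domain G i \<times> UNIV \<times> {0..T})
          (\<lambda>(y, a, s). edge_cost_dy G D i y a s) \<and>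
        continuous_on (edge_domain G i \<times> UNIV \<times> {0..T})
          (\<lambda>(y, a, s). edge_cost_da D i y a s))"

definition H1 :: "('a::euclidean_space) network \<Rightarrow> cost_data \<Rightarrow> real \<Rightarrow> real \<Rightarrow> bool" where
  "H1 G D p T \<longleftrightarrow>
     (\<exists>C0>0.
        (\<forall>i\<in>{1..num_edges G}. \<forall>y\<in>edge_domain G i. \<forall>a. \<forall>s\<in>{0..T}.
           edge_cost D i y a s \<ge> C0 * (\<bar>a\<bar> powr p - 1)) \<and>
        (\<forall>j\<in>{1..num_vertices G}. \<forall>s\<in>{0..T}. vertex_cost D j s \<ge> - C0))"

definition H2 :: "('a::euclidean_space) network \<Rightarrow> cost_data \<Rightarrow> real \<Rightarrow> real \<Rightarrow> bool" where
  "H2 G D p T \<longleftrightarrow>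
     (\<forall>r>0. \<exists>\<omega>. modulus_of_continuity \<omega> \<and>
        (\<forall>i\<in>{1..num_edges G}. \<forall>y\<in>edge_domain G i \<inter> {0..r}. \<forall>a.
           \<forall>t1\<in>{0..T}. \<forall>t2\<in>{0..T}.
             \<bar>edge_cost D i y a t1 - edge_cost D i y a t2\<bar>
               \<le> (1 + \<bar>a\<bar> powr p) * \<omega> \<bar>t1 - t2\<bar>))"

definition H3 :: "('a::euclidean_space) network \<Rightarrow> cost_data \<Rightarrow> real \<Rightarrow> real \<Rightarrow> bool" where
  "H3 G D p T \<longleftrightarrow>
     (\<forall>r>0. \<exists>c\<ge>0.
        \<forall>i\<in>{1..num_edges G}. \<forall>y\<in>edge_domain G i \<inter> {0..r}. \<forall>a. \<forall>s\<in>{0..T}.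
          \<bar>edge_cost_dy G D i y a s\<bar> \<le> c * (\<bar>a\<bar> powr p + 1) \<and>
          \<bar>edge_cost_da D i y a s\<bar> \<le> c * (\<bar>a\<bar> powr (p - 1) + 1))"

definition H4 :: "('a::euclidean_space) network \<Rightarrow> cost_data \<Rightarrow> real \<Rightarrow> bool" where
  "H4 G D T \<longleftrightarrow>
     (\<forall>i\<in>{1..num_edges G}. \<forall>y\<in>edge_domain G i. \<forall>s\<in>{0..T}.
        strictly_convex_fun (\<lambda>a. edge_cost D i y a s))"

definition standing_assumptions ::
    "('a::euclidean_space) network \<Rightarrow> cost_data \<Rightarrow> real \<Rightarrow> real \<Rightarrow> bool" where
  "standing_assumptions G D p T \<longleftrightarrow>
     cost_regularity G D T \<and> H1 G D p T \<and> H2 G D p T \<and> H3 G D p T \<and> H4 G D T"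


section \<open>Trajectories and optimal trajectories\<close>

text \<open>Trajectories are total functions whose values outside \<open>{t..T}\<close> are irrelevant.\<close>

definition trajectories ::
    "('a::euclidean_space) network \<Rightarrow> real \<Rightarrow> real \<Rightarrow> real \<Rightarrow> 'a \<Rightarrow> (real \<Rightarrow> 'a) set" where
  "trajectories G p T t x =
     {y. continuous_on {t..T} y \<and> y ` {t..T} \<subseteq> network_set G \<and> W1p_on p t T y \<and> y t = x}"

definition vertex_running_cost ::
    "('a::euclidean_space) network \<Rightarrow> cost_data \<Rightarrow> nat \<Rightarrow> real \<Rightarrow> real" where
  "vertex_running_cost G D j \<tau> =
     Min (insert (vertex_cost D j \<tau>)
       ((\<lambda>i. edge_cost D i (edge_coord G i (vertex G j)) 0 \<tau>) ` incident_edges G j))"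

definition running_cost ::
    "('a::euclidean_space) network \<Rightarrow> cost_data \<Rightarrow> 'a \<Rightarrow> 'a \<Rightarrow> real \<Rightarrow> real" where
  "running_cost G D y \<alpha> \<tau> =
     (\<Sum>i = 1..num_edges G.
        edge_cost D i (edge_coord G i y) (\<alpha> \<bullet> edge_dir G i) \<tau> *
        indicator (edge_set G i - vertices G) y) +
     (\<Sum>j = 1..num_vertices G. vertex_running_cost G D j \<tau> * indicator {vertex G j} y)"

definition vertex_final_cost ::
    "('a::euclidean_space) network \<Rightarrow> cost_data \<Rightarrow> nat \<Rightarrow> real" where
  "vertex_final_cost G D j =
     Min (insert (vertex_final D j)
       ((\<lambda>i. edge_final D i (edge_coord G i (vertex G j))) ` incident_edges G j))"

definition final_cost ::
    "('a::euclidean_space) network \<Rightarrow> cost_data \<Rightarrow> 'a \<Rightarrow> real" where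
  "final_cost G D y =
     (\<Sum>i = 1..num_edges G.
        edge_final D i (edge_coord G i y) * indicator (edge_set G i - vertices G) y) +
     (\<Sum>j = 1..num_vertices G. vertex_final_cost G D j * indicator {vertex G j} y)"

text \<open>For data satisfying the standing assumptions the running cost along a trajectory
  is integrable (by H3 it is \<open>O(1 + \<bar>a\<bar> powr p)\<close> locally in space), so the Bochner integral
  never takes its default value, and the set of costs in \<open>optimal_trajectories\<close> is
  nonempty and bounded below.\<close>

definition total_cost ::
    "('a::euclidean_space) network \<Rightarrow> cost_data \<Rightarrow> real \<Rightarrow> real \<Rightarrow> (real \<Rightarrow> 'a) \<Rightarrow> real" where
  "total_cost G D T t y =
     (LINT \<tau>|lebesgue_on {t..T}. running_cost G D (y \<tau>) (weak_deriv t T y \<tau>) \<tau>) +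
     final_cost G D (y T)"

definition optimal_trajectories ::
    "('a::euclidean_space) network \<Rightarrow> cost_data \<Rightarrow> real \<Rightarrow> real \<Rightarrow> real \<Rightarrow> 'a \<Rightarrow> (real \<Rightarrow> 'a) set"
  where
  "optimal_trajectories G D p T t x =
     {y \<in> trajectories G p T t x.
        total_cost G D T t y = (INF z\<in>trajectories G p T t x. total_cost G D T t z)}"

end

(*
  Every estimate comes from comparing an optimal trajectory y with an explicit competitor, without the
  Euler-Lagrange equation. Comparison with the constant trajectory bounds the L^p norm of y'. Consider
  a maximal time interval on which y avoids the vertices, so that y stays in one edge.

  (a) If |y'| <= M on a set of positive measure, then |y'| <= A almost everywhere on that interval:
  otherwise transfer a little speed from the set where |y'| > A to the slow set. By convexity and
  superlinear growth the gain exceeds the loss, which the energy controls through the y-derivative of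
  the Lagrangian.

  (b) A slow set exists: if |y'| > M almost everywhere, a cheaper competitor stays at the vertex where the
  interval starts; passages between distinct vertices, or an interval equal to [t,T], cost too much
  energy. The only remaining case is an initial stretch from an interior point to a vertex. After it, the
  speed is already bounded by the other cases, so one can approach the vertex slowly and catch up with
  bounded speed immediately afterwards.

  At almost every time spent in a vertex, y' vanishes.
*)
theory Submission
  imports Defs
begin

text \<open>The visits to the vertices may form any closed set, so there can be infinitely many
  vertex-free intervals, of arbitrarily small length. Every constant is therefore fixed before the
  trajectory and the interval: first a position bound \<open>r\<close> and an energy bound
  \<open>E0\<close>, then \<open>M1\<close>, \<open>A1\<close>, \<open>M2\<close>, \<open>A2\<close>
  in \<open>speed_bound\<close>. The second pair arises because the detour for an initial stretch
  runs at speeds of order \<open>A1\<close>, so its slowness threshold depends on the bound valid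
  afterwards. In (a) gain and loss are both proportional to the transferred amount, which cancels:
  neither the measure of the slow set nor the distance to the vertices enters the constant. In (b)
  the energy of a fast stretch is at least M^(p-1)/2 times (duration + displacement), while the
  competitors cost at most a multiple of the same quantities. Two thresholds contain 1/(T-t), and
  they are the source of the possible blow-up: a fast stretch must not fill [t,T], and the detour
  must be completed before T. The C^1 final costs serve a stretch that leaves a vertex and ends at T
  inside an edge, where ending at the vertex instead raises the final cost at most linearly in the
  displacement.\<close>

section \<open>Absolutely continuous curves\<close>

text \<open>The derivative is carried as a separate function because it is determined only up to
  null sets and a convenient representative is chosen later. Henstock-Kurzweil integrals make
  splitting intervals easy; absolute integrability allows the passage to Lebesgue integrals.\<close>

definition primitive_on :: "real \<Rightarrow> real \<Rightarrow> (real \<Rightarrow> 'a::euclidean_space) \<Rightarrow> (real \<Rightarrow> 'a) \<Rightarrow> bool" where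
  "primitive_on a b y v \<longleftrightarrow>
     v absolutely_integrable_on {a..b} \<and> (\<forall>s\<in>{a..b}. (v has_integral (y s - y a)) {a..s})"

lemma abs_integrable_subinterval:
  fixes v :: "real \<Rightarrow> 'a::euclidean_space"
  assumes "v absolutely_integrable_on {a..b}" "a \<le> c" "d \<le> b"
  shows "v absolutely_integrable_on {c..d}"
  using assms by (auto intro: set_integrable_subset)

lemma primitive_onI:
  assumes "v absolutely_integrable_on {a..b}"
    and "\<And>s. a \<le> s \<Longrightarrow> s \<le> b \<Longrightarrow> (v has_integral (y s - y a)) {a..s}"
  shows "primitive_on a b y v"
  using assms unfolding primitive_on_def by auto

lemma primitive_onD:
  assumes "primitive_on a b y v"
  shows "v absolutely_integrable_on {a..b}" "v integrable_on {a..b}"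
    "\<And>s. a \<le> s \<Longrightarrow> s \<le> b \<Longrightarrow> (v has_integral (y s - y a)) {a..s}"
  using assms unfolding primitive_on_def by (auto simp: absolutely_integrable_on_def)

lemma primitive_on_has_integral:
  assumes "primitive_on a b y v" "a \<le> c" "c \<le> d" "d \<le> b"
  shows "(v has_integral (y d - y c)) {c..d}"
proof -
  have "v integrable_on {c..d}"
    using abs_integrable_subinterval[OF primitive_onD(1)[OF assms(1)] assms(2,4)]
    by (auto simp: absolutely_integrable_on_def)
  then have *: "(v has_integral (integral {c..d} v)) {c..d}" by (rule integrable_integral)
  have "(v has_integral (y c - y a) + integral {c..d} v) {a..d}"
    by (rule has_integral_combine[OF assms(2,3) primitive_onD(3)[OF assms(1)] *]) (use assms in auto)
  moreover have "(v has_integral (y d - y a)) {a..d}"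
    by (rule primitive_onD(3)[OF assms(1)]) (use assms in auto)
  ultimately have "(y c - y a) + integral {c..d} v = y d - y a" by (rule has_integral_unique)
  then have "integral {c..d} v = y d - y c" by (simp add: algebra_simps)
  then show ?thesis using * by simp
qed

lemma primitive_on_continuous:
  assumes "primitive_on a b y v" shows "continuous_on {a..b} y"
proof -
  have "continuous_on {a..b} (\<lambda>s. y a + integral {a..s} v)"
    using primitive_onD(2)[OF assms] by (intro continuous_intros indefinite_integral_continuous_1)
  moreover have "y a + integral {a..s} v = y s" if "s \<in> {a..b}" for s
    using integral_unique[OF primitive_onD(3)[OF assms, of s]] that by simp
  ultimately show ?thesis by (rule continuous_on_eq)
qed

lemma primitive_on_subinterval:
  assumes "primitive_on a b y v" "a \<le> c" "c \<le> d" "d \<le> b"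
  shows "primitive_on c d y v"
proof (rule primitive_onI)
  show "v absolutely_integrable_on {c..d}"
    using abs_integrable_subinterval[OF primitive_onD(1)[OF assms(1)] assms(2,4)] .
qed (use assms primitive_on_has_integral in fastforce)

text \<open>Lebesgue differentiation for averages over boxes with lower corner x: on the line these
  are right difference quotients. The one-sided form suffices for uniqueness of \<open>v\<close>,
  for level sets and for tangency to the edges.\<close>

lemma primitive_on_right_deriv:
  assumes "primitive_on a b y v"
  obtains N where "negligible N"
    "\<And>s. a \<le> s \<Longrightarrow> s < b \<Longrightarrow> s \<notin> N \<Longrightarrow> ((\<lambda>h. (y (s + h) - y s) /\<^sub>R h) \<longlongrightarrow> v s) (at_right 0)"
proof -
  \<comment> \<open>Extension by zero, because the differentiation theorem asks for integrability on
    every box.\<close>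
  let ?f = "\<lambda>s. if s \<in> {a..b} then v s else 0"
  have int: "?f integrable_on UNIV"
    using primitive_onD(2)[OF assms] by (simp only: integrable_restrict_UNIV)
  have fi: "?f integrable_on cbox c d" for c d
    by (rule integrable_on_subcbox[OF int]) simp
  obtain N where N: "negligible N" and
     D: "\<And>x e. x \<notin> N \<Longrightarrow> 0 < e \<Longrightarrow> \<exists>d>0. \<forall>h. 0 < h \<and> h < d \<longrightarrow>
         norm(integral (cbox x (x + h *\<^sub>R One)) ?f /\<^sub>R h ^ DIM(real) - ?f x) < e"
    by (rule integrable_ccontinuous_explicit[of ?f, OF fi]) (erule that, assumption)
  show thesis
  proof (rule that[OF N])
    fix s assume s: "a \<le> s" "s < b" "s \<notin> N"
    have "\<exists>d>0. \<forall>h. 0 < h \<and> h < d \<longrightarrow> norm ((y (s + h) - y s) /\<^sub>R h - v s) < e" if "e > 0" for e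
    proof -
      obtain d where d: "d > 0" "\<And>h. 0 < h \<Longrightarrow> h < d \<Longrightarrow>
         norm(integral (cbox s (s + h *\<^sub>R One)) ?f /\<^sub>R h ^ DIM(real) - ?f s) < e"
        using D[OF s(3) \<open>e > 0\<close>] by blast
      have "norm ((y (s + h) - y s) /\<^sub>R h - v s) < e" if "0 < h" "h < min d (b - s)" for h
      proof -
        have "(v has_integral (y (s + h) - y s)) {s..s+h}"
          using primitive_on_has_integral[OF assms] s that by auto
        then have "(?f has_integral (y (s + h) - y s)) {s..s+h}"
          by (rule has_integral_eq[rotated]) (use s that in auto)
        then have "integral {s..s+h} ?f = y (s + h) - y s"
          by (rule integral_unique)
        then show ?thesis using d(2)[of h] that s by (simp add: scaleR_one)
      qed
      then show ?thesis using d(1) s by (intro exI[of _ "min d (b - s)"]) auto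
    qed
    then show "((\<lambda>h. (y (s + h) - y s) /\<^sub>R h) \<longlongrightarrow> v s) (at_right 0)"
      unfolding tendsto_iff eventually_at_right_field dist_norm by fastforce
  qed
qed

lemma primitive_on_unique_ae:
  assumes "primitive_on a b y v" "primitive_on a b y w"
  shows "negligible {s \<in> {a..b}. v s \<noteq> w s}"
proof -
  obtain N where N: "negligible N"
    "\<And>s. a \<le> s \<Longrightarrow> s < b \<Longrightarrow> s \<notin> N \<Longrightarrow> ((\<lambda>h. (y (s + h) - y s) /\<^sub>R h) \<longlongrightarrow> v s) (at_right 0)"
    using primitive_on_right_deriv[OF assms(1)] by metis
  obtain N' where N': "negligible N'"
    "\<And>s. a \<le> s \<Longrightarrow> s < b \<Longrightarrow> s \<notin> N' \<Longrightarrow> ((\<lambda>h. (y (s + h) - y s) /\<^sub>R h) \<longlongrightarrow> w s) (at_right 0)"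
    using primitive_on_right_deriv[OF assms(2)] by metis
  have "{s \<in> {a..b}. v s \<noteq> w s} \<subseteq> N \<union> N' \<union> {b}"
  proof
    fix s assume s: "s \<in> {s \<in> {a..b}. v s \<noteq> w s}"
    show "s \<in> N \<union> N' \<union> {b}"
    proof (rule ccontr)
      assume "s \<notin> N \<union> N' \<union> {b}"
      then have "v s = w s"
        using tendsto_unique[OF _ N(2) N'(2)] s by (auto simp: trivial_limit_at_right_real)
      then show False using s by simp
    qed
  qed
  then show ?thesis
    using N(1) N'(1) by (meson negligible_Un negligible_sing negligible_subset)
qed

text \<open>Each right-isolated point gets a rational in the gap to its right. Two such points
  cannot share it, since the larger one would lie in the gap of the smaller.\<close>

lemma countable_right_isolated:
  fixes Z :: "real set"
  shows "countable {s \<in> Z. \<exists>d>0. {s<..<s+d} \<inter> Z = {}}"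
proof -
  define I where "I = {s \<in> Z. \<exists>d>0. {s<..<s+d} \<inter> Z = {}}"
  have "\<forall>s\<in>I. \<exists>q::rat. s < of_rat q \<and> {s<..of_rat q} \<inter> Z = {}"
  proof
    fix s assume "s \<in> I"
    then obtain d where d: "d > 0" "{s<..<s+d} \<inter> Z = {}" unfolding I_def by blast
    obtain q where q: "s < of_rat q" "of_rat q < s + d" using of_rat_dense[of s "s + d"] d(1) by auto
    then have "{s<..of_rat q} \<subseteq> {s<..<s+d}" by auto
    with d have "{s<..of_rat q} \<inter> Z = {}" by blast
    with q show "\<exists>q::rat. s < of_rat q \<and> {s<..of_rat q} \<inter> Z = {}" by blast
  qed
  from bchoice[OF this] obtain q :: "real \<Rightarrow> rat"
    where q: "\<forall>s\<in>I. s < of_rat (q s) \<and> {s<..of_rat (q s)} \<inter> Z = {}" ..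
  have "\<not> s < s'" if a: "s \<in> I" "s' \<in> I" "q s = q s'" for s s'
  proof
    assume "s < s'"
    moreover have "s' < of_rat (q s')" "s' \<in> Z" using q a(2) unfolding I_def by blast+
    ultimately have "s' \<in> {s<..of_rat (q s)} \<inter> Z" using a(3) by simp
    then show False using q a(1) by blast
  qed
  then have "inj_on q I" by (metis inj_onI linorder_cases)
  then show ?thesis unfolding I_def[symmetric] by (rule countableI')
qed

text \<open>Off a null set the right difference quotients converge, and all but countably many points of the level
  set are limits of it from the right, where the limit can only be 0.\<close>

lemma primitive_on_zero_ae_level_set:
  assumes "primitive_on a b y v"
  shows "negligible {s \<in> {a..b}. y s = c \<and> v s \<noteq> 0}"
proof -
  let ?Z = "{s \<in> {a..b}. y s = c}"
  let ?I = "{s \<in> ?Z. \<exists>d>0. {s<..<s+d} \<inter> ?Z = {}}"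
  obtain N where N: "negligible N"
    "\<And>s. a \<le> s \<Longrightarrow> s < b \<Longrightarrow> s \<notin> N \<Longrightarrow> ((\<lambda>h. (y (s + h) - y s) /\<^sub>R h) \<longlongrightarrow> v s) (at_right 0)"
    using primitive_on_right_deriv[OF assms(1)] by metis
  have "{s \<in> {a..b}. y s = c \<and> v s \<noteq> 0} \<subseteq> N \<union> ?I \<union> {b}"
  proof
    fix s assume s: "s \<in> {s \<in> {a..b}. y s = c \<and> v s \<noteq> 0}"
    show "s \<in> N \<union> ?I \<union> {b}"
    proof (rule ccontr)
      assume n: "s \<notin> N \<union> ?I \<union> {b}"
      then have "((\<lambda>h. (y (s + h) - y s) /\<^sub>R h) \<longlongrightarrow> v s) (at_right 0)"
        using N(2) s by auto
      then have "eventually (\<lambda>h. dist ((y (s + h) - y s) /\<^sub>R h) (v s) < norm (v s)) (at_right 0)"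
        by (rule tendstoD) (use s in auto)
      then obtain d where d: "d > 0" 
        "\<And>h. 0 < h \<Longrightarrow> h < d \<Longrightarrow> dist ((y (s + h) - y s) /\<^sub>R h) (v s) < norm (v s)"
        unfolding eventually_at_right_field by auto
      obtain r where "s < r" "r < s + d" "y r = c"
        using n s d(1) by fastforce
      then show False using d(2)[of "r - s"] s by (simp add: dist_norm)
    qed
  qed
  moreover have "negligible ?I"
    using countable_right_isolated[of ?Z]
    by (simp add: negligible_iff_null_sets countable_imp_null_set_lborel null_sets_completionI)
  ultimately show ?thesis
    using N(1) by (meson negligible_Un negligible_sing negligible_subset)
qed

section \<open>Equivalence of primitives and continuous functions with a weak derivative\<close>

lemma integrable_lebesgue_on_mult_indicator:
  fixes v :: "real \<Rightarrow> 'a::euclidean_space"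
  assumes "integrable (lebesgue_on S) v" "A \<in> sets borel"
  shows "integrable (lebesgue_on S) (\<lambda>s. indicator A s *\<^sub>R v s)"
proof (rule Bochner_Integration.integrable_bound[OF assms(1)])
  have "(indicator A :: real \<Rightarrow> real) \<in> borel_measurable borel" using assms(2) by simp
  then have "(indicator A :: real \<Rightarrow> real) \<in> borel_measurable (lebesgue_on S)"
    by (simp add: measurable_completion measurable_restrict_space1)
  then show "(\<lambda>s. indicator A s *\<^sub>R v s) \<in> borel_measurable (lebesgue_on S)"
    using assms(1) by simp
  show "AE s in lebesgue_on S. norm (indicator A s *\<^sub>R v s) \<le> norm (v s)"
    by (intro AE_I2) (simp add: indicator_def)
qed

text \<open>Integration by parts through Fubini: \<open>y s - y a\<close> is the integral of
  \<open>v\<close> over r \<le> s, and after the exchange the inner integral of the test function's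
  derivative over [r,b] is minus its value at r. The constant \<open>y a\<close> contributes
  nothing, because that derivative has integral 0.\<close>

lemma primitive_on_imp_weak_deriv:
  assumes prim: "primitive_on a b y v" and ab: "a \<le> b"
  shows "has_weak_deriv a b y v"
proof -
  let ?M = "lebesgue_on {a..b}"
  have iv: "integrable ?M v"
    using absolutely_integrable_imp_integrable[OF primitive_onD(1)[OF prim]] by simp
  have vm: "v \<in> borel_measurable ?M" using iv by auto
  interpret M: finite_measure ?M
    by (rule finite_measureI) (simp add: emeasure_restrict_space emeasure_lborel_Icc_eq)
  interpret P: pair_sigma_finite ?M ?M ..
  have "(LINT s|?M. \<phi>' s *\<^sub>R y s) = - (LINT s|?M. \<phi> s *\<^sub>R v s)"
    if D: "\<forall>s. (\<phi> has_real_derivative \<phi>' s) (at s)" and cont: "continuous_on UNIV \<phi>'"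
      and supp: "a < c" "d < b" "\<forall>s. s \<notin> {c..d} \<longrightarrow> \<phi> s = 0"
    for \<phi> \<phi>' :: "real \<Rightarrow> real" and c d
  proof -
    have ends: "\<phi> a = 0" "\<phi> b = 0" using supp by auto
    have pm: "\<phi>' \<in> borel_measurable borel"
      using cont borel_measurable_continuous_onI by blast
    have pmM: "\<phi>' \<in> borel_measurable ?M"
      using pm by (simp add: measurable_completion measurable_restrict_space1)
    have ftc: "(\<phi>' has_integral (\<phi> u2 - \<phi> u1)) {u1..u2}" if "u1 \<le> u2" for u1 u2
      using that D
      by (intro fundamental_theorem_of_calculus)
         (auto simp: has_real_derivative_iff_has_vector_derivative[symmetric]
               intro: has_field_derivative_at_within)
    obtain B where B: "\<And>s. s \<in> {a..b} \<Longrightarrow> norm (\<phi>' s) \<le> B"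
    proof -
      have "compact (\<phi>' ` {a..b})"
        by (intro compact_continuous_image continuous_on_subset[OF cont]) auto
      then have "bounded (\<phi>' ` {a..b})" by (rule compact_imp_bounded)
      then obtain B where "\<forall>s\<in>{a..b}. norm (\<phi>' s) \<le> B" unfolding bounded_iff by auto
      then show thesis by (intro that[of B]) blast
    qed
    \<comment> \<open>The kernel on the square; its s-integral and its r-integral give the two
      sides. It is dominated by \<open>B * norm (v r)\<close>.\<close>
    define F where "F = (\<lambda>s r. \<phi>' s *\<^sub>R (indicator {..s} r *\<^sub>R v r))"
    have fm: "case_prod F \<in> borel_measurable (?M \<Otimes>\<^sub>M ?M)"
    proof -
      have b: "(\<lambda>x. x) \<in> measurable ?M borel"
        by (simp add: measurable_completion measurable_restrict_space1)
      have f1: "fst \<in> measurable (?M \<Otimes>\<^sub>M ?M) borel" "snd \<in> measurable (?M \<Otimes>\<^sub>M ?M) borel"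
        using measurable_compose[OF measurable_fst b] measurable_compose[OF measurable_snd b] by auto
      have i: "(\<lambda>p. if snd p \<le> fst p then 1 else 0::real) \<in> borel_measurable (?M \<Otimes>\<^sub>M ?M)"
        using f1 by measurable
      have "(\<lambda>p. \<phi>' (fst p) *\<^sub>R ((if snd p \<le> fst p then 1 else 0::real) *\<^sub>R v (snd p)))
          \<in> borel_measurable (?M \<Otimes>\<^sub>M ?M)"
        by (intro borel_measurable_scaleR i measurable_compose[OF measurable_fst pmM]
             measurable_compose[OF measurable_snd vm])
      then show ?thesis
        by (rule back_subst[of "\<lambda>f. f \<in> borel_measurable (?M \<Otimes>\<^sub>M ?M)"]) (auto simp: F_def fun_eq_iff)
    qed
    have gi: "integrable (?M \<Otimes>\<^sub>M ?M) (\<lambda>(s, r). B * norm (v r))"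
    proof (rule P.Fubini_integrable)
      show "(\<lambda>(s, r). B * norm (v r)) \<in> borel_measurable (?M \<Otimes>\<^sub>M ?M)"
        using measurable_compose[OF measurable_snd vm, of ?M] by (simp add: case_prod_beta)
    qed (use iv in auto)
    have Fi: "integrable (?M \<Otimes>\<^sub>M ?M) (case_prod F)"
    proof (rule Bochner_Integration.integrable_bound[OF gi fm], rule AE_I2)
      fix p assume "p \<in> space (?M \<Otimes>\<^sub>M ?M)"
      then have "fst p \<in> {a..b}" by (auto simp: space_pair_measure)
      then show "norm (case_prod F p) \<le> norm (case p of (s, r) \<Rightarrow> B * norm (v r))"
        using B[of "fst p"] by (auto simp: F_def case_prod_beta abs_mult indicator_def intro!: mult_right_mono)
    qed
    have inner1: "(LINT r|?M. F s r) = \<phi>' s *\<^sub>R (y s - y a)" if s: "s \<in> {a..b}" for s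
    proof -
      have ind: "integrable ?M (\<lambda>r. indicator {..s} r *\<^sub>R v r)"
        by (rule integrable_lebesgue_on_mult_indicator[OF iv]) simp
      have "((\<lambda>r. if r \<in> {a..s} then v r else 0) has_integral (y s - y a)) {a..b}"
        using primitive_onD(3)[OF prim, of s] s by (subst has_integral_restrict) auto
      then have "((\<lambda>r. indicator {..s} r *\<^sub>R v r) has_integral (y s - y a)) {a..b}"
        by (rule has_integral_eq[rotated]) (auto simp: indicator_def)
      then have "(LINT r|?M. indicator {..s} r *\<^sub>R v r) = y s - y a"
        using lebesgue_integral_eq_integral[OF ind] by (simp add: integral_unique)
      then show ?thesis unfolding F_def by (simp only: Bochner_Integration.integral_scaleR_right)
    qed
    have inner2: "(LINT s|?M. F s r) = - (\<phi> r *\<^sub>R v r)" if r: "r \<in> {a..b}" for r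
    proof -
      have pi: "integrable ?M \<phi>'"
        by (rule M.integrable_const_bound[OF _ pmM, of B]) (use B in auto)
      have ind: "integrable ?M (\<lambda>s. indicator {r..} s *\<^sub>R \<phi>' s)"
        by (rule integrable_lebesgue_on_mult_indicator[OF pi]) simp
      have "((\<lambda>s. if s \<in> {r..b} then \<phi>' s else 0) has_integral (\<phi> b - \<phi> r)) {a..b}"
        using ftc[of r b] r by (subst has_integral_restrict) auto
      then have "((\<lambda>s. indicator {r..} s *\<^sub>R \<phi>' s) has_integral (\<phi> b - \<phi> r)) {a..b}"
        by (rule has_integral_eq[rotated]) (auto simp: indicator_def)
      then have e: "(LINT s|?M. indicator {r..} s *\<^sub>R \<phi>' s) = - \<phi> r"
        using lebesgue_integral_eq_integral[OF ind] ends by (simp add: integral_unique)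
      have "(LINT s|?M. F s r) = (LINT s|?M. (indicator {r..} s *\<^sub>R \<phi>' s) *\<^sub>R v r)"
        by (rule Bochner_Integration.integral_cong) (auto simp: F_def indicator_def)
      also have "\<dots> = (- \<phi> r) *\<^sub>R v r" using e ind by simp
      finally show ?thesis by simp
    qed
    have "(LINT s|?M. \<phi>' s *\<^sub>R (y s - y a)) = (LINT s|?M. LINT r|?M. F s r)"
      by (rule Bochner_Integration.integral_cong) (auto simp: inner1)
    also have "\<dots> = (LINT r|?M. LINT s|?M. F s r)"
      using P.Fubini_integral[OF Fi] by simp
    also have "\<dots> = (LINT r|?M. - (\<phi> r *\<^sub>R v r))"
      by (rule Bochner_Integration.integral_cong) (auto simp: inner2)
    finally have 1: "(LINT s|?M. \<phi>' s *\<^sub>R (y s - y a)) = - (LINT s|?M. \<phi> s *\<^sub>R v s)" by simp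
    have pi: "integrable ?M \<phi>'"
      by (rule M.integrable_const_bound[OF _ pmM, of B]) (use B in auto)
    have "(LINT s|?M. \<phi>' s) = 0"
      using lebesgue_integral_eq_integral[OF pi] integral_unique[OF ftc[OF ab]] ends by simp
    then have z: "(LINT s|?M. \<phi>' s *\<^sub>R y a) = 0" using pi by simp
    have int2: "integrable ?M (\<lambda>s. \<phi>' s *\<^sub>R (y s - y a))"
    proof -
      have c: "continuous_on {a..b} (\<lambda>s. \<phi>' s *\<^sub>R (y s - y a))"
        by (intro continuous_intros primitive_on_continuous[OF prim] continuous_on_subset[OF cont]) auto
      show ?thesis using absolutely_integrable_imp_integrable[OF absolutely_integrable_continuous_real[OF c]] by simp
    qed
    have "(LINT s|?M. \<phi>' s *\<^sub>R y s) = (LINT s|?M. \<phi>' s *\<^sub>R (y s - y a) + \<phi>' s *\<^sub>R y a)"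
      by (simp add: algebra_simps)
    also have "\<dots> = (LINT s|?M. \<phi>' s *\<^sub>R (y s - y a)) + (LINT s|?M. \<phi>' s *\<^sub>R y a)"
      by (rule Bochner_Integration.integral_add[OF int2]) (use pi in auto)
    finally show ?thesis using 1 z by simp
  qed
  then show ?thesis using iv unfolding has_weak_deriv_def by blast
qed

subsection \<open>Mollifiers\<close>

text \<open>Test functions have to be only C^1, so truncated squares can take the place of smooth
  bump functions.\<close>

definition pos_sq :: "real \<Rightarrow> real" where "pos_sq x = (max 0 x)\<^sup>2"

lemma pos_sq_deriv: "(pos_sq has_real_derivative 2 * max 0 x) (at x)"
proof -
  consider "x < 0" | "x > 0" | "x = 0" by linarith
  then show ?thesis
  proof cases
    case 1
    have "((\<lambda>_. 0) has_real_derivative 2 * max 0 x) (at x)" using 1 by simp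
    then show ?thesis
      by (rule has_field_derivative_transform_within_open[of _ _ _ "{..<0}"]) (use 1 in \<open>auto simp: pos_sq_def\<close>)
  next
    case 2
    have "((\<lambda>x. x\<^sup>2) has_real_derivative 2 * max 0 x) (at x)" using 2 by (auto intro!: derivative_eq_intros)
    then show ?thesis
      by (rule has_field_derivative_transform_within_open[of _ _ _ "{0<..}"]) (use 2 in \<open>auto simp: pos_sq_def\<close>)
  next
    case 3
    have "((\<lambda>h. (pos_sq h - pos_sq 0) / h) \<longlongrightarrow> 0) (at 0)"
    proof (rule Lim_null_comparison[of _ "\<lambda>h. \<bar>h\<bar>"])
      have "norm ((pos_sq h - pos_sq 0) / h) \<le> \<bar>h\<bar>" for h
        by (cases "h > 0") (auto simp: pos_sq_def power2_eq_square max_def)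
      then show "\<forall>\<^sub>F h in at 0. norm ((pos_sq h - pos_sq 0) / h) \<le> \<bar>h\<bar>" by simp
      show "((\<lambda>h::real. \<bar>h\<bar>) \<longlongrightarrow> 0) (at 0)" by (intro tendsto_eq_intros) auto
    qed
    then show ?thesis using 3 by (simp add: DERIV_def)
  qed
qed

text \<open>A quadratic spline rising from 0 to 1 on [0,1]. Its second derivative is 4 on the first
  half and -4 on the second, which dictates the weights 2, -4, 2.\<close>

definition ramp :: "real \<Rightarrow> real" where
  "ramp x = 2 * pos_sq x - 4 * pos_sq (x - 1/2) + 2 * pos_sq (x - 1)"

text \<open>The triangle of height 2 over [0,1], hence of mass 1: a mollifier.\<close>

definition hat :: "real \<Rightarrow> real" where
  "hat x = 4 * max 0 x - 8 * max 0 (x - 1/2) + 4 * max 0 (x - 1)"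

lemma ramp_deriv: "(ramp has_real_derivative hat x) (at x)"
proof -
  have s: "((\<lambda>x. pos_sq (x - c)) has_real_derivative 2 * max 0 (x - c)) (at x)" for c
    using DERIV_chain2[OF pos_sq_deriv, of "\<lambda>x. x - c" 1 x UNIV] by (auto simp: DERIV_diff[OF DERIV_ident DERIV_const, simplified])
  show ?thesis unfolding ramp_def[abs_def] hat_def
    using s[of "1/2"] s[of 1] pos_sq_deriv[of x]
    by (auto intro!: derivative_eq_intros)
qed

lemma ramp_scaled_deriv: "((\<lambda>s. ramp (n * (s - c))) has_real_derivative n * hat (n * (s - c))) (at s)"
proof -
  have "((\<lambda>s. n * (s - c)) has_real_derivative n) (at s)" by (auto intro!: derivative_eq_intros)
  from DERIV_chain2[OF ramp_deriv this] show ?thesis by (simp add: mult.commute)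
qed

lemma ramp_le_0: "x \<le> 0 \<Longrightarrow> ramp x = 0"
  by (simp add: ramp_def pos_sq_def)

lemma ramp_ge_1: "1 \<le> x \<Longrightarrow> ramp x = 1"
  by (simp add: ramp_def pos_sq_def max_def power2_eq_square algebra_simps)

lemma hat_nonneg: "0 \<le> hat x"
  by (auto simp: hat_def max_def)

lemma hat_eq_0: "x \<le> 0 \<or> 1 \<le> x \<Longrightarrow> hat x = 0"
  by (auto simp: hat_def max_def)

lemma continuous_hat [continuous_intros]: "continuous_on S f \<Longrightarrow> continuous_on S (\<lambda>x. hat (f x))"
  unfolding hat_def by (intro continuous_intros)

lemma ramp_bounds: "0 \<le> ramp x" "ramp x \<le> 1"
proof -
  have mono: "ramp u \<le> ramp w" if "u \<le> w" for u w
    by (rule DERIV_nonneg_imp_nondecreasing[OF that]) (use ramp_deriv hat_nonneg in blast)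
  show "0 \<le> ramp x" using mono[of "min x 0" x] by (simp add: ramp_le_0)
  show "ramp x \<le> 1" using mono[of x "max x 1"] by (simp add: ramp_ge_1)
qed

text \<open>The rescaled kernel has mass 1 and lives on [c, c + 1/n], to the right of
  \<open>c\<close>; this is why \<open>c = a\<close> is allowed and \<open>c = b\<close> is
  not.\<close>

lemma hat_approximates_identity:
  fixes y :: "real \<Rightarrow> 'a::euclidean_space"
  assumes cont: "continuous_on {a..b} y" and c: "a \<le> c" "c < b"
  shows "(\<lambda>n. integral {a..b} (\<lambda>s. (real n * hat (real n * (s - c))) *\<^sub>R y s)) \<longlonglongrightarrow> y c"
proof (rule LIMSEQ_I)
  fix r :: real assume r: "0 < r"
  obtain \<delta> where \<delta>: "\<delta> > 0" "\<And>s. s \<in> {a..b} \<Longrightarrow> dist s c < \<delta> \<Longrightarrow> dist (y s) (y c) < r / 2"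
    using cont c r unfolding continuous_on_iff by (metis atLeastAtMost_iff half_gt_zero less_imp_le)
  \<comment> \<open>From \<open>n0\<close> on, the support fits into [a,b] and into the region where
    \<open>y\<close> is close to \<open>y c\<close>.\<close>
  obtain n0 :: nat where n0: "1 / min \<delta> (b - c) < real n0" using reals_Archimedean2 by blast
  have "norm (integral {a..b} (\<lambda>s. (real n * hat (real n * (s - c))) *\<^sub>R y s) - y c) < r" if n: "n \<ge> n0" for n
  proof -
    let ?K = "\<lambda>s. real n * hat (real n * (s - c))"
    have m: "min \<delta> (b - c) > 0" using \<delta> c by auto
    have "1 / min \<delta> (b - c) < real n" using n0 n by (meson less_le_trans of_nat_le_iff)
    then have nb: "1 < real n * min \<delta> (b - c)" using m by (simp add: pos_divide_less_eq)
    have npos: "real n > 0" using nb m by (metis less_le not_one_less_zero of_nat_0_le_iff mult_zero_left)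
    have nb1: "1 < real n * \<delta>" "1 < real n * (b - c)"
      using nb npos by (meson less_le_trans min.cobounded1 min.cobounded2 mult_left_mono less_imp_le)+
    have "(?K has_integral (ramp (real n * (b - c)) - ramp (real n * (a - c)))) {a..b}"
      by (rule fundamental_theorem_of_calculus)
         (use c ramp_scaled_deriv in \<open>auto simp: has_real_derivative_iff_has_vector_derivative[symmetric]
               intro: has_field_derivative_at_within\<close>)
    moreover have "ramp (real n * (b - c)) = 1" using nb1 by (intro ramp_ge_1) auto
    moreover have "ramp (real n * (a - c)) = 0" using c npos by (intro ramp_le_0) (auto simp: mult_le_0_iff)
    ultimately have K1: "(?K has_integral 1) {a..b}" by simp
    have ci: "(\<lambda>s. ?K s *\<^sub>R y s) integrable_on {a..b}"
      by (intro integrable_continuous_interval continuous_intros cont)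
    have "((\<lambda>s. ?K s *\<^sub>R y c) has_integral y c) {a..b}"
      using has_integral_scaleR_left[OF K1, of "y c"] by simp
    from has_integral_diff[OF integrable_integral[OF ci] this]
    have eq: "((\<lambda>s. ?K s *\<^sub>R (y s - y c)) has_integral (integral {a..b} (\<lambda>s. ?K s *\<^sub>R y s) - y c)) {a..b}"
      by (simp add: scaleR_diff_right)
    have "norm (integral {a..b} (\<lambda>s. ?K s *\<^sub>R (y s - y c))) \<le> integral {a..b} (\<lambda>s. ?K s * (r/2))"
    proof (rule integral_norm_bound_integral)
      show "(\<lambda>s. ?K s *\<^sub>R (y s - y c)) integrable_on {a..b}" using eq by blast
      show "(\<lambda>s. ?K s * (r/2)) integrable_on {a..b}"
        using has_integral_mult_left[OF K1, of "r/2"] by blast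
      fix s assume s: "s \<in> {a..b}"
      show "norm (?K s *\<^sub>R (y s - y c)) \<le> ?K s * (r/2)"
      proof (cases "s \<le> c \<or> 1 \<le> real n * (s - c)")
        case True
        then have "hat (real n * (s - c)) = 0" using npos by (intro hat_eq_0) (auto simp: mult_le_0_iff)
        then show ?thesis by simp
      next
        case False
        then have "real n * (s - c) < real n * \<delta>" using nb1 by linarith
        then have "dist s c < \<delta>" using npos False by (simp add: dist_real_def)
        then have "norm (y s - y c) \<le> r / 2" using \<delta>(2)[OF s] by (simp add: dist_norm)
        then show ?thesis using hat_nonneg[of "real n * (s - c)"]
          by (simp add: mult_left_mono abs_mult mult.assoc)
      qed
    qed
    also have "\<dots> = r / 2" using integral_unique[OF has_integral_mult_left[OF K1, of "r/2"]] by simp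
    finally show ?thesis using integral_unique[OF eq] r by simp
  qed
  then show "\<exists>no. \<forall>n\<ge>no. norm (integral {a..b} (\<lambda>s. (real n * hat (real n * (s - c))) *\<^sub>R y s) - y c) < r"
    by blast
qed

text \<open>Testing with a C^1 approximation of the indicator of (s1,s2] gives the increment of
  \<open>y\<close> in the limit: one side converges by mollification, the other by dominated
  convergence with bound \<open>norm (v s)\<close>. Continuity of \<open>y\<close> singles out the
  right representative and carries the identity to the end points.\<close>

lemma weak_deriv_imp_primitive_on:
  fixes y :: "real \<Rightarrow> 'a::euclidean_space"
  assumes weak: "has_weak_deriv a b y v" and cont: "continuous_on {a..b} y"
  shows "primitive_on a b y v"
proof -
  let ?M = "lebesgue_on {a..b}"
  have iv: "integrable ?M v" using weak unfolding has_weak_deriv_def by blast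
  have aiv: "v absolutely_integrable_on {a..b}"
    using iv by (simp add: integrable_restrict_space set_integrable_def)
  have vint: "v integrable_on {a..b}" using aiv by (simp add: absolutely_integrable_on_def)
  have key: "y s2 - y s1 = integral {s1..s2} v" if s: "a < s1" "s1 < s2" "s2 < b" for s1 s2
  proof -
    \<comment> \<open>Both ramps act to the right of their base point, so the support is contained
      in [s1, s2 + 1/n]; it lies inside the open interval once 1/n is below b - s2.\<close>
    define p where "p = (\<lambda>n s. ramp (real n * (s - s1)) - ramp (real n * (s - s2)))"
    define p' where "p' = (\<lambda>n s. real n * hat (real n * (s - s1)) - real n * hat (real n * (s - s2)))"
    obtain n0 :: nat where n0: "1 / (b - s2) < real n0" using reals_Archimedean2 by blast
    have ev: "(LINT s|?M. p' n s *\<^sub>R y s) = - (LINT s|?M. p n s *\<^sub>R v s)" if n: "n \<ge> n0" for n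
    proof -
      have "1 / (b - s2) < real n" using n0 n by (meson less_le_trans of_nat_le_iff)
      then have nb: "1 < real n * (b - s2)" using s by (simp add: pos_divide_less_eq)
      then have npos: "real n > 0" using s by (metis less_le not_one_less_zero of_nat_0_le_iff mult_zero_left)
      have d: "s2 + 1 / real n < b" using nb npos by (simp add: field_simps)
      have "\<forall>s. (p n has_real_derivative p' n s) (at s)"
        unfolding p_def p'_def by (intro allI DERIV_diff ramp_scaled_deriv)
      moreover have "continuous_on UNIV (p' n)" unfolding p'_def by (intro continuous_intros)
      moreover have "p n u = 0" if "u \<notin> {s1..s2 + 1 / real n}" for u
      proof (cases "u < s1")
        case True
        then show ?thesis using s npos by (simp add: p_def ramp_le_0 mult_le_0_iff)
      next
        case False
        then have "u > s2 + 1 / real n" using that by auto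
        then have "1 \<le> real n * (u - s2)" using npos by (simp add: field_simps)
        moreover have "real n * (u - s2) \<le> real n * (u - s1)" using s npos by simp
        ultimately show ?thesis by (simp add: p_def ramp_ge_1)
      qed
      ultimately show ?thesis
        using weak s(1) d unfolding has_weak_deriv_def by blast
    qed
    have lhs: "(\<lambda>n. LINT s|?M. p' n s *\<^sub>R y s) \<longlonglongrightarrow> y s1 - y s2"
    proof -
      have c: "continuous_on {a..b} (\<lambda>s. (real n * hat (real n * (s - c))) *\<^sub>R y s)" for n c
        by (intro continuous_intros cont)
      have "(LINT s|?M. p' n s *\<^sub>R y s) = integral {a..b} (\<lambda>s. (real n * hat (real n * (s - s1))) *\<^sub>R y s)
           - integral {a..b} (\<lambda>s. (real n * hat (real n * (s - s2))) *\<^sub>R y s)" for n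
      proof -
        have "continuous_on {a..b} (\<lambda>s. p' n s *\<^sub>R y s)" unfolding p'_def by (intro continuous_intros cont)
        then have "integrable ?M (\<lambda>s. p' n s *\<^sub>R y s)"
          using absolutely_integrable_imp_integrable[OF absolutely_integrable_continuous_real] by simp
        then have "(LINT s|?M. p' n s *\<^sub>R y s) = integral {a..b} (\<lambda>s. p' n s *\<^sub>R y s)"
          by (rule lebesgue_integral_eq_integral) simp
        also have "\<dots> = integral {a..b} (\<lambda>s. (real n * hat (real n * (s - s1))) *\<^sub>R y s
              - (real n * hat (real n * (s - s2))) *\<^sub>R y s)"
          by (simp add: p'_def scaleR_diff_left)
        also have "\<dots> = integral {a..b} (\<lambda>s. (real n * hat (real n * (s - s1))) *\<^sub>R y s)
           - integral {a..b} (\<lambda>s. (real n * hat (real n * (s - s2))) *\<^sub>R y s)"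
          by (intro Henstock_Kurzweil_Integration.integral_diff integrable_continuous_interval c)
        finally show ?thesis .
      qed
      then show ?thesis
        using tendsto_diff[OF hat_approximates_identity[OF cont, of s1] hat_approximates_identity[OF cont, of s2]] s
        by simp
    qed
    have rhs: "(\<lambda>n. LINT s|?M. p n s *\<^sub>R v s) \<longlonglongrightarrow> (LINT s|?M. indicator {s1<..s2} s *\<^sub>R v s)"
    proof (rule integral_dominated_convergence[where w = "\<lambda>s. norm (v s)"])
      show "integrable ?M (\<lambda>s. norm (v s))" using iv by simp
      show "(\<lambda>s. indicator {s1<..s2} s *\<^sub>R v s) \<in> borel_measurable ?M"
        by (intro borel_measurable_integrable integrable_lebesgue_on_mult_indicator[OF iv]) simp
      fix n
      have "continuous_on UNIV (p n)"
        unfolding p_def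
        by (intro continuous_at_imp_continuous_on ballI DERIV_isCont[OF DERIV_diff[OF ramp_scaled_deriv ramp_scaled_deriv]])
      then have "p n \<in> borel_measurable ?M"
        by (simp add: borel_measurable_continuous_onI measurable_completion measurable_restrict_space1)
      then show "(\<lambda>s. p n s *\<^sub>R v s) \<in> borel_measurable ?M" using iv by simp
      have "norm (p n s) \<le> 1" for s
        using ramp_bounds[of "real n * (s - s1)"] ramp_bounds[of "real n * (s - s2)"] by (auto simp: p_def)
      then show "AE s in ?M. norm (p n s *\<^sub>R v s) \<le> norm (v s)"
        by (intro AE_I2) (simp add: mult_left_le_one_le)
    next
      have R: "(\<lambda>n. ramp (real n * x)) \<longlonglongrightarrow> (if x > 0 then 1 else 0)" for x
      proof (cases "x > 0")
        case True
        then obtain n0 :: nat where n0: "1 / x < real n0" using reals_Archimedean2 by blast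
        have "ramp (real n * x) = 1" if "n \<ge> n0" for n
        proof -
          have "1 / x < real n" using n0 that by (meson less_le_trans of_nat_le_iff)
          then show ?thesis using True by (intro ramp_ge_1) (simp add: field_simps)
        qed
        then show ?thesis using True by (auto intro!: tendsto_eventually eventually_sequentiallyI[of n0])
      next
        case False
        then have "ramp (real n * x) = 0" for n by (intro ramp_le_0) (simp add: mult_le_0_iff)
        then show ?thesis using False by simp
      qed
      have "(\<lambda>n. p n u *\<^sub>R v u) \<longlonglongrightarrow> indicator {s1<..s2} u *\<^sub>R v u" for u
      proof -
        have "(\<lambda>n. p n u) \<longlonglongrightarrow> (if u - s1 > 0 then 1 else 0) - (if u - s2 > 0 then 1 else 0)"
          unfolding p_def by (intro tendsto_diff R)
        also have "(if u - s1 > 0 then 1 else 0) - (if u - s2 > 0 then 1 else 0) = (indicator {s1<..s2} u :: real)"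
          using s by (auto simp: indicator_def)
        finally show ?thesis by (intro tendsto_scaleR tendsto_const)
      qed
      then show "AE u in ?M. (\<lambda>n. p n u *\<^sub>R v u) \<longlonglongrightarrow> indicator {s1<..s2} u *\<^sub>R v u" by simp
    qed
    have "(\<lambda>n. LINT s|?M. p' n s *\<^sub>R y s) \<longlonglongrightarrow> - (LINT s|?M. indicator {s1<..s2} s *\<^sub>R v s)"
      using tendsto_minus[OF rhs] by (rule Lim_transform_eventually) (rule eventually_sequentiallyI[of n0], use ev in simp)
    then have e: "y s1 - y s2 = - (LINT s|?M. indicator {s1<..s2} s *\<^sub>R v s)"
      using lhs LIMSEQ_unique by blast
    have ind: "integrable ?M (\<lambda>s. indicator {s1<..s2} s *\<^sub>R v s)"
      by (rule integrable_lebesgue_on_mult_indicator[OF iv]) simp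
    have "(v has_integral integral {s1..s2} v) {s1..s2}"
      using abs_integrable_subinterval[OF aiv, of s1 s2] s
      by (auto simp: absolutely_integrable_on_def)
    then have "(v has_integral integral {s1..s2} v) {s1<..s2}"
      by (subst (asm) has_integral_spike_set_eq[of _ "{s1<..s2}"])
         (auto intro: negligible_subset[OF negligible_sing[of s1]])
    then have "((\<lambda>r. if r \<in> {s1<..s2} then v r else 0) has_integral integral {s1..s2} v) {a..b}"
      using s by (subst has_integral_restrict) auto
    then have "((\<lambda>r. indicator {s1<..s2} r *\<^sub>R v r) has_integral integral {s1..s2} v) {a..b}"
      by (rule has_integral_eq[rotated]) (auto simp: indicator_def)
    then have "(LINT s|?M. indicator {s1<..s2} s *\<^sub>R v s) = integral {s1..s2} v"
      using lebesgue_integral_eq_integral[OF ind] by (simp add: integral_unique)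
    then show ?thesis using e by (simp add: algebra_simps)
  qed
  have "(v has_integral (y s - y a)) {a..s}" if s: "a \<le> s" "s \<le> b" for s
  proof (cases "a = s")
    case False
    then have ab: "a < b" using s by simp
    \<comment> \<open>The identity on inner subintervals says that \<open>D\<close> is constant on
      the open interval, and by continuity on the closed one.\<close>
    define D where "D = (\<lambda>s. y s - integral {a..s} v)"
    have sub: "v integrable_on {c..d}" if "a \<le> c" "d \<le> b" for c d
      using abs_integrable_subinterval[OF aiv that] by (simp add: absolutely_integrable_on_def)
    have D: "D s1 = D s2" if "a < s1" "s1 < s2" "s2 < b" for s1 s2
    proof -
      have "integral {a..s1} v + integral {s1..s2} v = integral {a..s2} v"
        by (rule Henstock_Kurzweil_Integration.integral_combine) (use that sub in auto)
      then show ?thesis using key[OF that] by (simp add: D_def algebra_simps)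
    qed
    obtain m where m: "a < m" "m < b" using ab dense by blast
    have Dc: "D u = D m" if "u \<in> {a<..<b}" for u
    proof (cases u m rule: linorder_cases)
      case less
      show ?thesis by (rule D) (use less m that in auto)
    next
      case greater
      show ?thesis by (rule D[symmetric]) (use greater m that in auto)
    qed simp
    have "continuous_on {a..b} D"
      unfolding D_def by (intro continuous_intros cont indefinite_integral_continuous_1 vint)
    then have "D u = D m" if "u \<in> {a..b}" for u
      using continuous_constant_on_closure[of "{a<..<b}" D "D m" u] Dc that ab by (simp add: closure_greaterThanLessThan)
    from this[of s] this[of a] have "D s = D a" using s by simp
    then have "integral {a..s} v = y s - y a" by (simp add: D_def algebra_simps)
    then show ?thesis using integrable_integral[OF sub[of a s]] s by simp
  qed auto
  then show ?thesis using aiv by (intro primitive_onI) auto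
qed

section \<open>Edges as isometric images of closed intervals\<close>

section \<open>Geometry of networks\<close>

text \<open>With the starting vertex named, segments and half-lines have the same affine
  parametrization, and almost all later arguments are free of the case distinction.\<close>

definition edge_base :: "('a::euclidean_space) network \<Rightarrow> nat \<Rightarrow> 'a" where
  "edge_base G i = (case edge G i of Segment j1 j2 \<Rightarrow> vertex G j1 | Halfline j e \<Rightarrow> vertex G j)"

locale valid_network =
  fixes G :: "('a::euclidean_space) network"
  assumes is_network: "is_network G"
begin

abbreviation "E \<equiv> {1..num_edges G}"
abbreviation "Vt \<equiv> vertices G"
abbreviation "J \<equiv> edge_set G"
abbreviation "I \<equiv> edge_domain G"
abbreviation "e \<equiv> edge_dir G"
abbreviation "bs \<equiv> edge_base G"

lemma finite_vertices: "finite Vt"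
  unfolding vertices_def by simp

lemma segment_indices:
  assumes "i \<in> E" "edge G i = Segment j1 j2"
  shows "j1 \<in> {1..num_vertices G}" "j2 \<in> {1..num_vertices G}" "vertex G j1 \<noteq> vertex G j2"
proof -
  have *: "1 \<le> j1 \<and> j1 < j2 \<and> j2 \<le> num_vertices G"
    using is_network assms unfolding is_network_def by fastforce
  then show "j1 \<in> {1..num_vertices G}" "j2 \<in> {1..num_vertices G}" by auto
  moreover have "inj_on (vertex G) {1..num_vertices G}"
    using is_network unfolding is_network_def by blast
  ultimately show "vertex G j1 \<noteq> vertex G j2" using * by (auto dest: inj_onD)
qed

lemma halfline_index:
  assumes "i \<in> E" "edge G i = Halfline j d"
  shows "j \<in> {1..num_vertices G}" "norm d = 1"
  using is_network assms unfolding is_network_def by fastforce+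

lemma edge_cases:
  assumes i: "i \<in> E"
  obtains (bounded) l where "0 < l" "I i = {0..l}" "bs i \<in> Vt" "bs i + l *\<^sub>R e i \<in> Vt"
  | (unbounded) "I i = {0..}" "bs i \<in> Vt"
proof (cases "edge G i")
  case (Segment j1 j2)
  note s = segment_indices[OF i Segment]
  show thesis
  proof (rule bounded)
    show "0 < dist (vertex G j1) (vertex G j2)" using s(3) by simp
    show "I i = {0..dist (vertex G j1) (vertex G j2)}"
      by (auto simp: edge_domain_def edge_length_def Segment)
    show "bs i \<in> Vt" using s(1) by (auto simp: edge_base_def Segment vertices_def)
    show "bs i + dist (vertex G j1) (vertex G j2) *\<^sub>R e i \<in> Vt"
      using s by (auto simp: edge_base_def edge_dir_def Segment vertices_def)
  qed
next
  case (Halfline j d)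
  show thesis
  proof (rule unbounded)
    show "I i = {0..}" by (auto simp: edge_domain_def edge_length_def Halfline)
    show "bs i \<in> Vt" using halfline_index[OF i Halfline] by (auto simp: edge_base_def Halfline vertices_def)
  qed
qed

lemma edge_param_eq:
  assumes i: "i \<in> E"
  shows "edge_param G i s = bs i + s *\<^sub>R e i"
proof (cases "edge G i")
  case (Segment j1 j2)
  define l where "l = dist (vertex G j1) (vertex G j2)"
  have l: "l \<noteq> 0" using segment_indices[OF i Segment] by (simp add: l_def)
  have "((l - s) *\<^sub>R vertex G j1 + s *\<^sub>R vertex G j2) /\<^sub>R l
      = (l *\<^sub>R vertex G j1 + s *\<^sub>R (vertex G j2 - vertex G j1)) /\<^sub>R l"
    by (simp add: algebra_simps)
  also have "\<dots> = vertex G j1 + s *\<^sub>R ((vertex G j2 - vertex G j1) /\<^sub>R l)"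
    using l by (simp add: scaleR_add_right)
  finally show ?thesis
    by (simp add: edge_param_def edge_base_def edge_dir_def Segment Let_def l_def)
qed (simp add: edge_param_def edge_base_def edge_dir_def)

lemma norm_dir:
  assumes i: "i \<in> E"
  shows "norm (e i) = 1"
proof (cases "edge G i")
  case (Segment j1 j2)
  then show ?thesis using segment_indices[OF i Segment] by (simp add: edge_dir_def dist_norm norm_minus_commute)
next
  case (Halfline j d)
  then show ?thesis using halfline_index[OF i Halfline] by (simp add: edge_dir_def)
qed

lemma dir_inner: "i \<in> E \<Longrightarrow> e i \<bullet> e i = 1"
  using norm_dir by (simp add: dot_square_norm)

definition pt :: "nat \<Rightarrow> real \<Rightarrow> 'a" where "pt i b = bs i + b *\<^sub>R e i"
text \<open>Orthogonal projection instead of an inverse of the parametrization: it agrees with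
  \<open>edge_coord\<close> on the edge but is defined and continuous on the whole space.\<close>

definition co :: "nat \<Rightarrow> 'a \<Rightarrow> real" where "co i y = (y - bs i) \<bullet> e i"

lemma co_pt [simp]: "i \<in> E \<Longrightarrow> co i (pt i b) = b"
  by (simp add: co_def pt_def dir_inner)

lemma dist_pt: "i \<in> E \<Longrightarrow> dist (pt i b) (pt i b') = \<bar>b - b'\<bar>"
  using norm_dir by (simp add: pt_def dist_norm flip: scaleR_diff_left)

lemma edge_set_eq: "i \<in> E \<Longrightarrow> J i = pt i ` I i"
  unfolding edge_set_def pt_def by (simp add: edge_param_eq)

lemma edge_setD: "i \<in> E \<Longrightarrow> y \<in> J i \<Longrightarrow> co i y \<in> I i \<and> y = pt i (co i y)"
  by (auto simp: edge_set_eq)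

lemma pt_in_edge: "i \<in> E \<Longrightarrow> b \<in> I i \<Longrightarrow> pt i b \<in> J i"
  by (auto simp: edge_set_eq)

lemma pt_co: "i \<in> E \<Longrightarrow> y \<in> J i \<Longrightarrow> pt i (co i y) = y"
  using edge_setD[of i y] by (intro sym[of y]) blast

lemma dist_co:
  assumes "i \<in> E" "y \<in> J i" "z \<in> J i"
  shows "dist y z = \<bar>co i z - co i y\<bar>"
  using dist_pt[OF assms(1), of "co i y" "co i z"] pt_co assms by (simp add: abs_minus_commute)

lemma edge_coord_eq:
  assumes "i \<in> E" "y \<in> J i"
  shows "edge_coord G i y = co i y"
proof -
  have eq: "edge_param G i = pt i" using assms by (simp add: fun_eq_iff edge_param_eq pt_def)
  have inj: "inj_on (pt i) (I i)" using assms(1) by (metis inj_onI co_pt)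
  show ?thesis using edge_setD[OF assms] the_inv_into_f_f[OF inj, of "co i y"]
    unfolding edge_coord_def eq by simp
qed

lemma continuous_co [continuous_intros]: "continuous_on S f \<Longrightarrow> continuous_on S (\<lambda>x. co i (f x))"
  unfolding co_def by (intro continuous_intros)

lemma domain_closed: "i \<in> E \<Longrightarrow> closed (I i)"
  by (erule edge_cases) auto

lemma domain_convex: "i \<in> E \<Longrightarrow> convex (I i)"
  by (erule edge_cases) auto

lemma domain_nonneg: "b \<in> I i \<Longrightarrow> 0 \<le> b"
  by (simp add: edge_domain_def)

text \<open>Membership in the edge is expressed by two closed conditions: the projected coordinate
  lies in the closed domain, and the point coincides with its projection.\<close>

lemma edge_closed:
  assumes i: "i \<in> E" shows "closed (J i)"
proof -
  have "J i = (\<lambda>y. co i y) -` I i \<inter> {y. y = pt i (co i y)}"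
    using edge_setD[OF i] pt_in_edge[OF i] by (auto, metis)
  moreover have "closed ((\<lambda>y. co i y) -` I i)"
    by (intro closed_vimage domain_closed[OF i]) (intro continuous_intros)
  moreover have "closed {y. y = pt i (co i y)}"
    unfolding pt_def by (intro closed_Collect_eq continuous_intros)
  ultimately show ?thesis by (metis closed_Int)
qed

text \<open>A coordinate can leave the domain only past an end point, which is a vertex. Hence
  shifts smaller than the distance to the vertices stay in the edge.\<close>

lemma domain_exit:
  assumes i: "i \<in> E" and b: "b \<in> I i" "b' \<notin> I i"
  shows "\<exists>v\<in>Vt. dist (pt i b) v \<le> \<bar>b' - b\<bar>"
  using i
proof (cases rule: edge_cases)
  case (bounded l)
  have v: "pt i 0 \<in> Vt" "pt i l \<in> Vt" using bounded by (auto simp: pt_def)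
  have "\<bar>b - 0\<bar> \<le> \<bar>b' - b\<bar> \<or> \<bar>b - l\<bar> \<le> \<bar>b' - b\<bar>" using b bounded by auto
  then show ?thesis using v dist_pt[OF i] by metis
next
  case unbounded
  have v: "pt i 0 \<in> Vt" using unbounded by (auto simp: pt_def)
  have "\<bar>b - 0\<bar> \<le> \<bar>b' - b\<bar>" using b unbounded by auto
  then show ?thesis using v dist_pt[OF i] by metis
qed

lemma edge_unique:
  assumes "i \<in> E" "k \<in> E" "y \<in> J i" "y \<in> J k" "y \<notin> Vt"
  shows "i = k"
proof (rule ccontr)
  assume "i \<noteq> k"
  then have "J i \<inter> J k = {} \<or> (\<exists>v\<in>Vt. J i \<inter> J k = {v})"
    using is_network assms(1,2) unfolding is_network_def by blast
  then show False
  proof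
    assume "\<exists>v\<in>Vt. J i \<inter> J k = {v}"
    then obtain v where v: "v \<in> Vt" "J i \<inter> J k = {v}" ..
    then have "y \<in> {v}" using assms(3,4) by blast
    then show False using v(1) assms(5) by simp
  qed (use assms(3,4) in blast)
qed

lemma indicator_other_edge:
  assumes "i \<in> E" "k \<in> E - {i}" "y \<in> J i" "y \<notin> Vt"
  shows "indicator (J k - Vt) y = (0::real)"
  using edge_unique[of i k y] assms by (auto simp: indicator_def simp del: atLeastAtMost_iff)

lemma indicator_other_vertex:
  assumes "k \<in> {1..num_vertices G}" "y \<notin> Vt"
  shows "indicator {vertex G k} y = (0::real)"
  using assms by (auto simp: indicator_def vertices_def)

lemma network_edge:
  assumes "y \<in> network_set G" "y \<notin> Vt"
  obtains i where "i \<in> E" "y \<in> J i"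
  using assms unfolding network_set_def by blast

lemma edge_subset_network: "i \<in> E \<Longrightarrow> J i \<subseteq> network_set G"
  unfolding network_set_def by blast

lemma vertices_subset_network: "Vt \<subseteq> network_set G"
  unfolding network_set_def by blast

text \<open>Away from the vertices, one edge and the union of the others are disjoint. Both are
  closed because there are finitely many edges, so connectedness leaves only one of them.\<close>

lemma path_in_edge:
  assumes cont: "continuous_on S y" and S: "connected S" "S \<noteq> {}"
    and net: "y ` S \<subseteq> network_set G" and nv: "\<And>s. s \<in> S \<Longrightarrow> y s \<notin> Vt"
  obtains i where "i \<in> E" "y ` S \<subseteq> J i"
proof -
  obtain s0 where s0: "s0 \<in> S" using S(2) by blast
  then obtain i where i: "i \<in> E" "y s0 \<in> J i" using network_edge net nv by (metis image_subset_iff)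
  define R where "R = (\<Union>k\<in>E - {i}. J k)"
  have cR: "closed R" unfolding R_def by (intro closed_UN ballI edge_closed finite_Diff) auto
  define A where "A = S \<inter> y -` J i"
  define B where "B = S \<inter> y -` R"
  have cl: "closedin (top_of_set S) A" "closedin (top_of_set S) B"
    unfolding A_def B_def using continuous_closedin_preimage[OF cont] edge_closed[OF i(1)] cR by blast+
  have cov: "S \<subseteq> A \<union> B"
  proof
    fix s assume s: "s \<in> S"
    then obtain k where "k \<in> E" "y s \<in> J k" using network_edge net nv by (metis image_subset_iff)
    then show "s \<in> A \<union> B" using s by (auto simp: R_def A_def B_def)
  qed
  have disj: "A \<inter> B = {}"
  proof (rule ccontr)
    assume "A \<inter> B \<noteq> {}"
    then obtain s k where s: "s \<in> S" "y s \<in> J i" "k \<in> E - {i}" "y s \<in> J k"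
      unfolding A_def B_def R_def by blast
    then show False using edge_unique[OF i(1), of k "y s"] nv by blast
  qed
  have "A = {} \<or> B = {}"
    using S(1) cl cov disj unfolding connected_closedin by metis
  then have "B = {}" using s0 i unfolding A_def by blast
  then have "y ` S \<subseteq> J i" using cov unfolding A_def by blast
  then show thesis using that i(1) by blast
qed

lemma vertex_separation:
  obtains \<rho> where "0 < \<rho>" "\<And>u v. u \<in> Vt \<Longrightarrow> v \<in> Vt \<Longrightarrow> u \<noteq> v \<Longrightarrow> \<rho> \<le> dist u v"
proof -
  \<comment> \<open>The extra element 1 keeps the minimum meaningful when there are fewer than two
    vertices.\<close>
  let ?D = "insert 1 ((\<lambda>(u, v). dist u v) ` {(u, v). u \<in> Vt \<and> v \<in> Vt \<and> u \<noteq> v})"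
  have "finite {(u, v). u \<in> Vt \<and> v \<in> Vt \<and> u \<noteq> v}"
    by (rule finite_subset[of _ "Vt \<times> Vt"]) (use finite_vertices in auto)
  then have fin: "finite ?D" by simp
  show thesis
  proof (rule that[of "Min ?D"])
    show "0 < Min ?D" using fin by (subst Min_gr_iff) auto
    show "Min ?D \<le> dist u v" if "u \<in> Vt" "v \<in> Vt" "u \<noteq> v" for u v
      using fin that by (intro Min_le) auto
  qed
qed

section \<open>Values of the costs inside edges and at vertices\<close>

lemma running_cost_edge:
  assumes i: "i \<in> E" and y: "y \<in> J i" "y \<notin> Vt"
  shows "running_cost G D y \<alpha> \<tau> = edge_cost D i (co i y) (\<alpha> \<bullet> e i) \<tau>"
proof -
  have "(\<Sum>k = 1..num_edges G. edge_cost D k (edge_coord G k y) (\<alpha> \<bullet> e k) \<tau> * indicator (J k - Vt) y)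
     = (\<Sum>k\<in>{i}. edge_cost D k (edge_coord G k y) (\<alpha> \<bullet> e k) \<tau> * indicator (J k - Vt) y)"
    by (rule sum.mono_neutral_right) (use i indicator_other_edge[OF i _ y] in \<open>auto simp del: atLeastAtMost_iff\<close>)
  moreover have "(\<Sum>j = 1..num_vertices G. vertex_running_cost G D j \<tau> * indicator {vertex G j} y) = 0"
    by (rule sum.neutral) (use indicator_other_vertex[OF _ y(2)] in simp)
  ultimately show ?thesis unfolding running_cost_def using y edge_coord_eq[OF i y(1)] by simp
qed

lemma sum_at_vertex:
  assumes j: "j \<in> {1..num_vertices G}"
  shows "(\<Sum>k = 1..num_vertices G. f k * indicator {vertex G k} (vertex G j)) = (f j :: real)"
proof -
  have inj: "inj_on (vertex G) {1..num_vertices G}"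
    using is_network unfolding is_network_def by blast
  have "(\<Sum>k = 1..num_vertices G. f k * indicator {vertex G k} (vertex G j))
     = (\<Sum>k\<in>{j}. f k * indicator {vertex G k} (vertex G j))"
  proof (rule sum.mono_neutral_right)
    show "\<forall>k\<in>{1..num_vertices G} - {j}. f k * indicator {vertex G k} (vertex G j) = 0"
      using inj_onD[OF inj] j by (metis DiffD1 DiffD2 indicator_simps(2) mult_zero_right singletonD singletonI)
  qed (use j in auto)
  then show ?thesis by simp
qed

lemma running_cost_vertex:
  assumes j: "j \<in> {1..num_vertices G}"
  shows "running_cost G D (vertex G j) \<alpha> \<tau> = vertex_running_cost G D j \<tau>"
proof -
  have "vertex G j \<in> Vt" using j by (auto simp: vertices_def)
  then have "(\<Sum>k = 1..num_edges G. edge_cost D k (edge_coord G k (vertex G j)) (\<alpha> \<bullet> e k) \<tau> * indicator (J k - Vt) (vertex G j)) = 0"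
    by (intro sum.neutral) simp
  then show ?thesis unfolding running_cost_def sum_at_vertex[OF j] by simp
qed

lemma final_cost_edge:
  assumes i: "i \<in> E" and y: "y \<in> J i" "y \<notin> Vt"
  shows "final_cost G D y = edge_final D i (co i y)"
proof -
  have "(\<Sum>k = 1..num_edges G. edge_final D k (edge_coord G k y) * indicator (J k - Vt) y)
     = (\<Sum>k\<in>{i}. edge_final D k (edge_coord G k y) * indicator (J k - Vt) y)"
    by (rule sum.mono_neutral_right) (use i indicator_other_edge[OF i _ y] in \<open>auto simp del: atLeastAtMost_iff\<close>)
  moreover have "(\<Sum>j = 1..num_vertices G. vertex_final_cost G D j * indicator {vertex G j} y) = 0"
    by (rule sum.neutral) (use indicator_other_vertex[OF _ y(2)] in simp)
  ultimately show ?thesis unfolding final_cost_def using y edge_coord_eq[OF i y(1)] by simp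
qed

lemma final_cost_vertex:
  assumes j: "j \<in> {1..num_vertices G}"
  shows "final_cost G D (vertex G j) = vertex_final_cost G D j"
proof -
  have "vertex G j \<in> Vt" using j by (auto simp: vertices_def)
  then have "(\<Sum>k = 1..num_edges G. edge_final D k (edge_coord G k (vertex G j)) * indicator (J k - Vt) (vertex G j)) = 0"
    by (intro sum.neutral) simp
  then show ?thesis unfolding final_cost_def sum_at_vertex[OF j] by simp
qed

text \<open>The minimum in the definition lets the final cost jump only downwards on arrival at a
  vertex. This is the direction required when a competitor stops at a vertex.\<close>

lemma final_cost_vertex_le:
  assumes "i \<in> E" "v \<in> Vt" "v \<in> J i"
  shows "final_cost G D v \<le> edge_final D i (co i v)"
proof -
  obtain j where j: "j \<in> {1..num_vertices G}" "v = vertex G j" using assms(2) unfolding vertices_def by blast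
  have "i \<in> incident_edges G j" using assms j unfolding incident_edges_def by simp
  moreover have "finite (incident_edges G j)" unfolding incident_edges_def by simp
  ultimately have "vertex_final_cost G D j \<le> edge_final D i (edge_coord G i v)"
    unfolding vertex_final_cost_def j(2) by (intro Min_le) auto
  then show ?thesis using final_cost_vertex[OF j(1)] j(2) edge_coord_eq[OF assms(1,3)] by simp
qed

end

section \<open>Uniform consequences of the standing assumptions\<close>

section \<open>Bounds on the data\<close>

locale control_problem = valid_network G
  for G :: "('a::euclidean_space) network" +
  fixes D :: cost_data and p T :: real
  assumes T_pos: "0 < T" and p_gt_1: "1 < p"
    and standing: "standing_assumptions G D p T"
    and final_C1: "\<forall>i\<in>{1..num_edges G}. C1_on (edge_domain G i) (edge_final D i)"
begin

abbreviation "L \<equiv> running_cost G D"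
abbreviation "g \<equiv> final_cost G D"
abbreviation "lc \<equiv> edge_cost D"

lemma regularity:
  assumes "i \<in> E"
  shows "continuous_on (I i) (edge_final D i)" "bounded (edge_final D i ` I i)"
    "continuous_on (I i \<times> UNIV \<times> {0..T}) (\<lambda>(y, a, s). lc i y a s)"
    "\<And>s. s \<in> {0..T} \<Longrightarrow> (\<lambda>(y, a). lc i y a s) differentiable_on (I i \<times> UNIV)"
  using standing assms unfolding standing_assumptions_def cost_regularity_def by blast+

lemma vertex_cost_continuous:
  assumes "j \<in> {1..num_vertices G}"
  shows "continuous_on {0..T} (vertex_cost D j)"
  using standing assms unfolding standing_assumptions_def cost_regularity_def by blast

definition C0 :: real where
  "C0 = (SOME C0. C0 > 0 \<and>
        (\<forall>i\<in>E. \<forall>y\<in>I i. \<forall>a. \<forall>s\<in>{0..T}. lc i y a s \<ge> C0 * (\<bar>a\<bar> powr p - 1)) \<and>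
        (\<forall>j\<in>{1..num_vertices G}. \<forall>s\<in>{0..T}. vertex_cost D j s \<ge> - C0))"

lemma C0:
  shows C0_pos: "0 < C0"
    and edge_cost_ge: "\<And>i y a s. i \<in> E \<Longrightarrow> y \<in> I i \<Longrightarrow> s \<in> {0..T} \<Longrightarrow> lc i y a s \<ge> C0 * (\<bar>a\<bar> powr p - 1)"
    and vertex_cost_ge: "\<And>j s. j \<in> {1..num_vertices G} \<Longrightarrow> s \<in> {0..T} \<Longrightarrow> vertex_cost D j s \<ge> - C0"
proof -
  have "\<exists>C0. C0 > 0 \<and>
        (\<forall>i\<in>E. \<forall>y\<in>I i. \<forall>a. \<forall>s\<in>{0..T}. lc i y a s \<ge> C0 * (\<bar>a\<bar> powr p - 1)) \<and>
        (\<forall>j\<in>{1..num_vertices G}. \<forall>s\<in>{0..T}. vertex_cost D j s \<ge> - C0)"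
    using standing unfolding standing_assumptions_def H1_def by blast
  from someI_ex[OF this, folded C0_def]
  show "0 < C0"
    and "\<And>i y a s. i \<in> E \<Longrightarrow> y \<in> I i \<Longrightarrow> s \<in> {0..T} \<Longrightarrow> lc i y a s \<ge> C0 * (\<bar>a\<bar> powr p - 1)"
    and "\<And>j s. j \<in> {1..num_vertices G} \<Longrightarrow> s \<in> {0..T} \<Longrightarrow> vertex_cost D j s \<ge> - C0"
    by blast+
qed

lemma edge_cost_ge_C0:
  assumes "i \<in> E" "y \<in> I i" "s \<in> {0..T}"
  shows "lc i y a s \<ge> - C0"
proof -
  have "- C0 \<le> C0 * (\<bar>a\<bar> powr p - 1)" using C0_pos by (simp add: algebra_simps)
  then show ?thesis using edge_cost_ge[OF assms, of a] by linarith
qed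

lemma finite_incident: "finite (incident_edges G j)"
  unfolding incident_edges_def by simp

lemma incident_edge_coord:
  assumes "i \<in> incident_edges G j"
  shows "i \<in> E" "edge_coord G i (vertex G j) \<in> I i"
  using assms edge_coord_eq edge_setD unfolding incident_edges_def by auto

lemma vertex_running_cost_ge:
  assumes j: "j \<in> {1..num_vertices G}" and s: "s \<in> {0..T}"
  shows "- C0 \<le> vertex_running_cost G D j s"
  unfolding vertex_running_cost_def
  using finite_incident[of j] vertex_cost_ge[OF j s] incident_edge_coord edge_cost_ge_C0 s
  by (subst Min_ge_iff) auto

lemma running_cost_ge:
  assumes y: "y \<in> network_set G" and s: "s \<in> {0..T}"
  shows "- C0 \<le> L y \<alpha> s"
proof (cases "y \<in> Vt")
  case True
  then obtain j where "j \<in> {1..num_vertices G}" "y = vertex G j" unfolding vertices_def by blast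
  then show ?thesis using running_cost_vertex vertex_running_cost_ge s by metis
next
  case False
  then obtain i where i: "i \<in> E" "y \<in> J i" using network_edge y by blast
  show ?thesis using running_cost_edge[OF i False] edge_cost_ge_C0[OF i(1)] edge_setD[OF i] s by simp
qed

text \<open>Makes constants uniform over finitely many edges or vertices. The weight
  \<open>h\<close> covers plain bounds (weight 1) and Lipschitz bounds (weight a distance).\<close>

lemma common_bound:
  assumes "finite A" "\<And>i. i \<in> A \<Longrightarrow> \<exists>C. \<forall>x\<in>S i. f i x \<le> (C::real) * h i x" "\<And>i x. i \<in> A \<Longrightarrow> x \<in> S i \<Longrightarrow> 0 \<le> h i x"
  obtains C where "0 \<le> C" "\<And>i x. i \<in> A \<Longrightarrow> x \<in> S i \<Longrightarrow> f i x \<le> C * h i x"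
proof -
  have "\<exists>C\<ge>0. \<forall>i\<in>A. \<forall>x\<in>S i. f i x \<le> C * h i x"
    using assms
  proof (induction A rule: finite_induct)
    case (insert i A)
    then obtain C where C: "C \<ge> 0" "\<forall>i\<in>A. \<forall>x\<in>S i. f i x \<le> C * h i x" by (metis insertCI)
    obtain C' where C': "\<forall>x\<in>S i. f i x \<le> C' * h i x" using insert.prems(1) by blast
    have "f k x \<le> max C C' * h k x" if "k \<in> insert i A" "x \<in> S k" for k x
    proof -
      have "0 \<le> h k x" using insert.prems(2) that by blast
      then have "C * h k x \<le> max C C' * h k x" "C' * h k x \<le> max C C' * h k x"
        by (auto intro: mult_right_mono)
      then show ?thesis using C C' that by force
    qed
    then show ?case using C(1) by (intro exI[of _ "max C C'"]) auto
  qed auto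
  then show thesis using that by blast
qed

lemma edge_cost_bounded:
  obtains C where "0 \<le> C"
    "\<And>i b a s. i \<in> E \<Longrightarrow> b \<in> I i \<Longrightarrow> b \<le> r \<Longrightarrow> \<bar>a\<bar> \<le> m \<Longrightarrow> s \<in> {0..T} \<Longrightarrow> \<bar>lc i b a s\<bar> \<le> C"
proof -
  define S where "S i = (I i \<inter> {0..r}) \<times> {-m..m} \<times> {0..T}" for i
  have "\<exists>C. \<forall>x\<in>S i. (case x of (b, a, s) \<Rightarrow> \<bar>lc i b a s\<bar>) \<le> C * 1" if i: "i \<in> E" for i
  proof -
    have "compact (S i)" unfolding S_def
      by (intro compact_Times closed_Int_compact domain_closed i compact_Icc)
    moreover have "continuous_on (S i) (\<lambda>(b, a, s). lc i b a s)"
      by (rule continuous_on_subset[OF regularity(3)[OF i]]) (auto simp: S_def)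
    ultimately have "bounded ((\<lambda>(b, a, s). lc i b a s) ` S i)"
      by (intro compact_imp_bounded compact_continuous_image)
    then show ?thesis unfolding bounded_iff by (auto simp: split_beta)
  qed
  then obtain C where C: "0 \<le> C" "\<And>i x. i \<in> E \<Longrightarrow> x \<in> S i \<Longrightarrow> (case x of (b, a, s) \<Rightarrow> \<bar>lc i b a s\<bar>) \<le> C * 1"
    by (rule common_bound[OF finite_atLeastAtMost]) auto
  show thesis
  proof (rule that[OF C(1)])
    fix i b a s assume "i \<in> E" "b \<in> I i" "b \<le> r" "\<bar>a\<bar> \<le> m" "s \<in> {0..T}"
    moreover have "-m \<le> a" "a \<le> m" using \<open>\<bar>a\<bar> \<le> m\<close> by linarith+
    ultimately show "\<bar>lc i b a s\<bar> \<le> C" using C(2)[of i "(b, a, s)"] domain_nonneg by (auto simp: S_def)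
  qed
qed

text \<open>\<open>edge_cost_da\<close> is a \<open>vector_derivative\<close>, which carries
  information only where a derivative exists; existence is inherited from joint differentiability by
  restriction to a line.\<close>

lemma edge_cost_deriv_a:
  assumes i: "i \<in> E" and b: "b \<in> I i" and s: "s \<in> {0..T}"
  shows "((\<lambda>a. lc i b a s) has_real_derivative edge_cost_da D i b a s) (at a)"
proof -
  have "(\<lambda>(y, a). lc i y a s) differentiable (at (b, a) within I i \<times> UNIV)"
    using regularity(4)[OF i s] b unfolding differentiable_on_def by blast
  then obtain f' where f': "((\<lambda>(y, a). lc i y a s) has_derivative f') (at (b, a) within I i \<times> UNIV)"
    unfolding differentiable_def by blast
  have "((\<lambda>(y, a). lc i y a s) has_derivative f') (at (b, a) within (\<lambda>a. (b, a)) ` UNIV)"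
    by (rule has_derivative_subset[OF f']) (use b in auto)
  moreover have "((\<lambda>a. (b, a)) has_derivative (\<lambda>h. (0, h))) (at a within UNIV)"
    by (intro derivative_intros)
  ultimately have "((\<lambda>a. (\<lambda>(y, a). lc i y a s) (b, a)) has_derivative (\<lambda>h. f' (0, h))) (at a within UNIV)"
    by (rule has_derivative_in_compose[rotated])
  then have "(\<lambda>a. lc i b a s) differentiable (at a)" unfolding differentiable_def by auto
  then have "((\<lambda>a. lc i b a s) has_vector_derivative edge_cost_da D i b a s) (at a)"
    unfolding edge_cost_da_def by (simp add: vector_derivative_works)
  then show ?thesis by (simp add: has_real_derivative_iff_has_vector_derivative)
qed

lemma edge_cost_deriv_y:
  assumes i: "i \<in> E" and b: "b \<in> I i" and s: "s \<in> {0..T}"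
  shows "((\<lambda>y. lc i y a s) has_real_derivative edge_cost_dy G D i b a s) (at b within I i)"
proof -
  have "(\<lambda>(y, a). lc i y a s) differentiable (at (b, a) within I i \<times> UNIV)"
    using regularity(4)[OF i s] b unfolding differentiable_on_def by blast
  then obtain f' where f': "((\<lambda>(y, a). lc i y a s) has_derivative f') (at (b, a) within I i \<times> UNIV)"
    unfolding differentiable_def by blast
  have "((\<lambda>(y, a). lc i y a s) has_derivative f') (at (b, a) within (\<lambda>y. (y, a)) ` I i)"
    by (rule has_derivative_subset[OF f']) auto
  moreover have "((\<lambda>y. (y, a)) has_derivative (\<lambda>h. (h, 0))) (at b within I i)"
    by (intro derivative_intros)
  ultimately have "((\<lambda>y. (\<lambda>(y, a). lc i y a s) (y, a)) has_derivative (\<lambda>h. f' (h, 0))) (at b within I i)"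
    by (rule has_derivative_in_compose[rotated])
  then have "(\<lambda>y. lc i y a s) differentiable (at b within I i)" unfolding differentiable_def by auto
  then have "((\<lambda>y. lc i y a s) has_vector_derivative edge_cost_dy G D i b a s) (at b within I i)"
    unfolding edge_cost_dy_def by (simp add: vector_derivative_works)
  then show ?thesis by (simp add: has_real_derivative_iff_has_vector_derivative)
qed

lemma derivative_bounds:
  obtains c where "0 \<le> c"
    "\<And>i b a s. i \<in> E \<Longrightarrow> b \<in> I i \<Longrightarrow> b \<le> r \<Longrightarrow> s \<in> {0..T} \<Longrightarrow> \<bar>edge_cost_dy G D i b a s\<bar> \<le> c * (\<bar>a\<bar> powr p + 1)"
    "\<And>i b a s. i \<in> E \<Longrightarrow> b \<in> I i \<Longrightarrow> b \<le> r \<Longrightarrow> s \<in> {0..T} \<Longrightarrow> \<bar>edge_cost_da D i b a s\<bar> \<le> c * (\<bar>a\<bar> powr (p - 1) + 1)"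
proof -
  have "H3 G D p T" using standing unfolding standing_assumptions_def by blast
  \<comment> \<open>H3 asks for a positive radius, whereas \<open>r\<close> is an arbitrary real
    here.\<close>
  moreover have "max r 1 > 0" by simp
  ultimately obtain c where c: "0 \<le> c" "\<forall>i\<in>E. \<forall>y\<in>I i \<inter> {0..max r 1}. \<forall>a. \<forall>s\<in>{0..T}.
          \<bar>edge_cost_dy G D i y a s\<bar> \<le> c * (\<bar>a\<bar> powr p + 1) \<and>
          \<bar>edge_cost_da D i y a s\<bar> \<le> c * (\<bar>a\<bar> powr (p - 1) + 1)"
    unfolding H3_def by blast
  have "\<bar>edge_cost_dy G D i b a s\<bar> \<le> c * (\<bar>a\<bar> powr p + 1) \<and>
      \<bar>edge_cost_da D i b a s\<bar> \<le> c * (\<bar>a\<bar> powr (p - 1) + 1)"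
    if "i \<in> E" "b \<in> I i" "b \<le> r" "s \<in> {0..T}" for i b a s
  proof -
    have b: "b \<in> I i \<inter> {0..max r 1}" using that domain_nonneg by auto
    show ?thesis by (rule c(2)[rule_format, OF that(1) b that(4)])
  qed
  then show thesis by (intro that[OF c(1)]) blast+
qed

lemma powr_mult_self: "0 \<le> x \<Longrightarrow> x * x powr (p - 1) = x powr p"
  by (cases "x = 0") (simp_all add: powr_mult_base)

lemma le_powr_plus_1: "0 \<le> x \<Longrightarrow> x \<le> x powr p + 1"
proof (cases "x \<le> 1")
  case False
  then have "x powr 1 \<le> x powr p" using p_gt_1 by (intro powr_mono) auto
  then show ?thesis using False by simp
next
  case True
  then show ?thesis using powr_ge_zero[of x p] by linarith
qed

text \<open>Mean value inequality in the velocity, starting from 0: the derivative bound times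
  \<open>\<bar>a\<bar>\<close> is of order \<open>\<bar>a\<bar> powr p\<close>, and the linear term
  is absorbed because p > 1.\<close>

lemma edge_cost_growth:
  obtains C where "0 \<le> C"
    "\<And>i b a s. i \<in> E \<Longrightarrow> b \<in> I i \<Longrightarrow> b \<le> r \<Longrightarrow> s \<in> {0..T} \<Longrightarrow> \<bar>lc i b a s\<bar> \<le> C * (\<bar>a\<bar> powr p + 1)"
proof -
  obtain U where U: "0 \<le> U"
    "\<And>i b a s. i \<in> E \<Longrightarrow> b \<in> I i \<Longrightarrow> b \<le> r \<Longrightarrow> \<bar>a\<bar> \<le> 0 \<Longrightarrow> s \<in> {0..T} \<Longrightarrow> \<bar>lc i b a s\<bar> \<le> U"
    by (rule edge_cost_bounded[of r 0]) (rule that, assumption+)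
  obtain c where c: "0 \<le> c"
    "\<And>i b a s. i \<in> E \<Longrightarrow> b \<in> I i \<Longrightarrow> b \<le> r \<Longrightarrow> s \<in> {0..T} \<Longrightarrow> \<bar>edge_cost_da D i b a s\<bar> \<le> c * (\<bar>a\<bar> powr (p - 1) + 1)"
    by (rule derivative_bounds[of r]) (rule that, assumption+)
  show thesis
  proof (rule that[of "U + 2 * c"])
    show "0 \<le> U + 2 * c" using U c by simp
    fix i b a s assume *: "i \<in> E" "b \<in> I i" "b \<le> r" "s \<in> {0..T}"
    have "norm (lc i b a s - lc i b 0 s) \<le> (c * (\<bar>a\<bar> powr (p - 1) + 1)) * norm (a - 0)"
    proof (rule field_differentiable_bound[of "{-\<bar>a\<bar>..\<bar>a\<bar>}"])
      show "((\<lambda>a. lc i b a s) has_field_derivative edge_cost_da D i b z s) (at z within {-\<bar>a\<bar>..\<bar>a\<bar>})" for z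
        by (rule has_field_derivative_at_within[OF edge_cost_deriv_a[OF *(1,2,4)]])
      fix z assume z: "z \<in> {-\<bar>a\<bar>..\<bar>a\<bar>}"
      have "\<bar>z\<bar> powr (p - 1) \<le> \<bar>a\<bar> powr (p - 1)" using z p_gt_1 by (intro powr_mono2) auto
      then show "norm (edge_cost_da D i b z s) \<le> c * (\<bar>a\<bar> powr (p - 1) + 1)"
        using c(2)[OF *, of z] c(1) by (smt (verit) mult_left_mono real_norm_def)
    qed auto
    also have "\<dots> = c * (\<bar>a\<bar> powr p + \<bar>a\<bar>)"
      using powr_mult_self[of "\<bar>a\<bar>"] by (simp add: algebra_simps)
    also have "\<dots> \<le> c * (\<bar>a\<bar> powr p + (\<bar>a\<bar> powr p + 1))"
      using le_powr_plus_1[of "\<bar>a\<bar>"] c(1) by (intro mult_left_mono add_left_mono) auto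
    finally have 1: "\<bar>lc i b a s - lc i b 0 s\<bar> \<le> c * (2 * \<bar>a\<bar> powr p + 1)" by simp
    have "\<bar>lc i b a s\<bar> \<le> U + c * (2 * \<bar>a\<bar> powr p + 1)"
      using 1 U(2)[OF *(1-3) _ *(4), of 0] by linarith
    also have "\<dots> \<le> U * (\<bar>a\<bar> powr p + 1) + c * (2 * \<bar>a\<bar> powr p + 2)"
      using U(1) c(1) by (intro add_mono mult_left_mono) (auto simp: mult_le_cancel_left1)
    finally show "\<bar>lc i b a s\<bar> \<le> (U + 2 * c) * (\<bar>a\<bar> powr p + 1)" by (simp add: algebra_simps)
  qed
qed

lemma edge_cost_lipschitz_y:
  obtains C where "0 \<le> C"
    "\<And>i b b' a s. i \<in> E \<Longrightarrow> b \<in> I i \<Longrightarrow> b \<le> r \<Longrightarrow> b' \<in> I i \<Longrightarrow> b' \<le> r \<Longrightarrow> s \<in> {0..T} \<Longrightarrow>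
       \<bar>lc i b a s - lc i b' a s\<bar> \<le> C * (\<bar>a\<bar> powr p + 1) * \<bar>b - b'\<bar>"
proof -
  obtain c where c: "0 \<le> c"
    "\<And>i b a s. i \<in> E \<Longrightarrow> b \<in> I i \<Longrightarrow> b \<le> r \<Longrightarrow> s \<in> {0..T} \<Longrightarrow> \<bar>edge_cost_dy G D i b a s\<bar> \<le> c * (\<bar>a\<bar> powr p + 1)"
    by (rule derivative_bounds[of r]) (rule that, assumption+)
  show thesis
  proof (rule that[OF c(1)])
    fix i b b' a s assume *: "i \<in> E" "b \<in> I i" "b \<le> r" "b' \<in> I i" "b' \<le> r" "s \<in> {0..T}"
    have "norm (lc i b a s - lc i b' a s) \<le> (c * (\<bar>a\<bar> powr p + 1)) * norm (b - b')"
    proof (rule field_differentiable_bound[of "I i \<inter> {..r}"])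
      show "convex (I i \<inter> {..r})" by (intro convex_Int domain_convex *) simp
      show "((\<lambda>b. lc i b a s) has_field_derivative edge_cost_dy G D i z a s) (at z within I i \<inter> {..r})"
        if "z \<in> I i \<inter> {..r}" for z
        by (rule has_field_derivative_subset[OF edge_cost_deriv_y[OF *(1) _ *(6)]]) (use that in auto)
    qed (use * c in auto)
    then show "\<bar>lc i b a s - lc i b' a s\<bar> \<le> c * (\<bar>a\<bar> powr p + 1) * \<bar>b - b'\<bar>" by simp
  qed
qed

lemma edge_cost_convex:
  assumes "i \<in> E" "b \<in> I i" "s \<in> {0..T}" "0 \<le> u" "u \<le> 1"
  shows "lc i b ((1 - u) * a1 + u * a2) s \<le> (1 - u) * lc i b a1 s + u * lc i b a2 s"
proof -
  have sc: "strictly_convex_fun (\<lambda>a. lc i b a s)"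
    using standing assms unfolding standing_assumptions_def H4_def by blast
  show ?thesis
  proof (cases "a1 = a2 \<or> u = 0 \<or> u = 1")
    case True
    then show ?thesis by (auto simp: algebra_simps)
  next
    case False
    then show ?thesis using sc assms unfolding strictly_convex_fun_def by (intro less_imp_le) auto
  qed
qed

lemma final_cost_bounded:
  obtains B where "0 \<le> B" "\<And>y. y \<in> network_set G \<Longrightarrow> \<bar>g y\<bar> \<le> B"
proof -
  let ?S = "g ` Vt \<union> (\<Union>i\<in>E. edge_final D i ` I i)"
  have "bounded ?S"
    by (intro bounded_Un[THEN iffD2] conjI bounded_UN finite_imp_bounded finite_imageI finite_vertices)
       (use regularity(2) in auto)
  then obtain B where B: "\<forall>z\<in>?S. norm z \<le> B" unfolding bounded_iff by blast
  have S: "g y \<in> ?S" if y: "y \<in> network_set G" for y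
  proof (cases "y \<in> Vt")
    case False
    then obtain i where i: "i \<in> E" "y \<in> J i" using network_edge y by blast
    then show ?thesis using final_cost_edge[OF i False] edge_setD[OF i] by blast
  qed blast
  show thesis
  proof (rule that[of "max B 0"])
    fix y assume "y \<in> network_set G"
    from bspec[OF B S[OF this]] show "\<bar>g y\<bar> \<le> max B 0" by simp
  qed simp
qed

text \<open>One-sided on purpose, since the vertex value may be much lower than nearby values. The
  C^1 assumption on the final costs enters here, through a bound on the derivatives over bounded
  parts of the edges.\<close>

lemma final_cost_lipschitz_at_vertex:
  obtains Lg where "0 \<le> Lg"
    "\<And>i v y. i \<in> E \<Longrightarrow> v \<in> Vt \<Longrightarrow> v \<in> J i \<Longrightarrow> co i v \<le> r \<Longrightarrow> y \<notin> Vt \<Longrightarrow> y \<in> J i \<Longrightarrow> co i y \<le> r \<Longrightarrow>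
       g v - g y \<le> Lg * dist v y"
proof -
  define S where "S i = (I i \<inter> {0..r}) \<times> (I i \<inter> {0..r})" for i
  have "\<exists>C. \<forall>x\<in>S i. (case x of (b, b') \<Rightarrow> edge_final D i b - edge_final D i b') \<le> C * (case x of (b, b') \<Rightarrow> \<bar>b - b'\<bar>)"
    if i: "i \<in> E" for i
  proof -
    obtain f' where f': "\<And>s. s \<in> I i \<Longrightarrow> (edge_final D i has_real_derivative f' s) (at s within I i)"
      "continuous_on (I i) f'"
      using final_C1 i unfolding C1_on_def by blast
    have "compact (I i \<inter> {0..r})" by (intro closed_Int_compact domain_closed i compact_Icc)
    then have "bounded (f' ` (I i \<inter> {0..r}))"
      by (intro compact_imp_bounded compact_continuous_image continuous_on_subset[OF f'(2)]) auto
    then obtain B where B: "\<forall>z\<in>I i \<inter> {0..r}. norm (f' z) \<le> B" unfolding bounded_iff by blast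
    have "norm (edge_final D i b - edge_final D i b') \<le> B * norm (b - b')" if "(b, b') \<in> S i" for b b'
    proof (rule field_differentiable_bound[of "I i \<inter> {0..r}"])
      show "convex (I i \<inter> {0..r})" by (intro convex_Int domain_convex i) simp
      show "(edge_final D i has_field_derivative f' z) (at z within I i \<inter> {0..r})" if "z \<in> I i \<inter> {0..r}" for z
        by (rule has_field_derivative_subset[OF f'(1)]) (use that in auto)
    qed (use B that in \<open>auto simp: S_def\<close>)
    then show ?thesis by (intro exI[of _ B]) force
  qed
  then obtain C where C: "0 \<le> C" "\<And>i x. i \<in> E \<Longrightarrow> x \<in> S i \<Longrightarrow>
      (case x of (b, b') \<Rightarrow> edge_final D i b - edge_final D i b') \<le> C * (case x of (b, b') \<Rightarrow> \<bar>b - b'\<bar>)"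
    by (rule common_bound[OF finite_atLeastAtMost]) auto
  show thesis
  proof (rule that[OF C(1)])
    fix i v y
    assume *: "i \<in> E" "v \<in> Vt" "v \<in> J i" "co i v \<le> r" "y \<notin> Vt" "y \<in> J i" "co i y \<le> r"
    have v: "co i v \<in> I i" "v = pt i (co i v)" using edge_setD[OF *(1,3)] by auto
    have y: "co i y \<in> I i" "y = pt i (co i y)" using edge_setD[OF *(1,6)] by auto
    have "edge_final D i (co i v) - edge_final D i (co i y) \<le> C * \<bar>co i v - co i y\<bar>"
      using C(2)[OF *(1), of "(co i v, co i y)"] v(1) y(1) * domain_nonneg by (auto simp: S_def)
    moreover have "dist v y = \<bar>co i v - co i y\<bar>" using dist_pt[OF *(1)] v(2) y(2) by metis
    ultimately show "g v - g y \<le> C * dist v y"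
      using final_cost_vertex_le[OF *(1-3), of D] final_cost_edge[OF *(1,6,5), of D] by simp
  qed
qed

text \<open>Position and velocity are restricted only inside edges; at a vertex the cost ignores the
  velocity and is at most \<open>vertex_cost\<close>.\<close>

lemma running_cost_bounded:
  obtains C where "0 \<le> C"
    "\<And>y \<alpha> s. y \<in> network_set G \<Longrightarrow> s \<in> {0..T} \<Longrightarrow>
       (\<forall>i\<in>E. y \<in> J i \<longrightarrow> y \<notin> Vt \<longrightarrow> co i y \<le> r \<and> \<bar>\<alpha> \<bullet> e i\<bar> \<le> m) \<Longrightarrow> L y \<alpha> s \<le> C"
proof -
  obtain U where U: "0 \<le> U"
    "\<And>i b a s. i \<in> E \<Longrightarrow> b \<in> I i \<Longrightarrow> b \<le> r \<Longrightarrow> \<bar>a\<bar> \<le> m \<Longrightarrow> s \<in> {0..T} \<Longrightarrow> \<bar>lc i b a s\<bar> \<le> U"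
    by (rule edge_cost_bounded[of r m]) (rule that, assumption+)
  have "\<exists>C. \<forall>s\<in>{0..T}. vertex_cost D j s \<le> C * 1" if j: "j \<in> {1..num_vertices G}" for j
  proof -
    have "bounded (vertex_cost D j ` {0..T})"
      by (intro compact_imp_bounded compact_continuous_image vertex_cost_continuous j) auto
    then obtain C where "\<forall>z\<in>vertex_cost D j ` {0..T}. norm z \<le> C" unfolding bounded_iff by blast
    then have "\<forall>s\<in>{0..T}. vertex_cost D j s \<le> C * 1" by auto
    then show ?thesis ..
  qed
  then obtain C where C: "0 \<le> C" "\<And>j s. j \<in> {1..num_vertices G} \<Longrightarrow> s \<in> {0..T} \<Longrightarrow> vertex_cost D j s \<le> C * 1"
    by (rule common_bound[OF finite_atLeastAtMost]) auto
  show thesis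
  proof (rule that[of "U + C"])
    show "0 \<le> U + C" using U C by simp
    fix y \<alpha> s assume y: "y \<in> network_set G" and s: "s \<in> {0..T}"
      and b: "\<forall>i\<in>E. y \<in> J i \<longrightarrow> y \<notin> Vt \<longrightarrow> co i y \<le> r \<and> \<bar>\<alpha> \<bullet> e i\<bar> \<le> m"
    show "L y \<alpha> s \<le> U + C"
    proof (cases "y \<in> Vt")
      case True
      then obtain j where j: "j \<in> {1..num_vertices G}" "y = vertex G j" unfolding vertices_def by blast
      have "vertex_running_cost G D j s \<le> vertex_cost D j s"
        unfolding vertex_running_cost_def using finite_incident[of j] by (intro Min_le) auto
      then show ?thesis using C(2)[OF j(1) s] U(1) running_cost_vertex[OF j(1)] j(2) by simp
    next
      case False
      then obtain i where i: "i \<in> E" "y \<in> J i" using network_edge y by blast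
      show ?thesis using running_cost_edge[OF i False] U(2)[of i "co i y" "\<alpha> \<bullet> e i" s] i(1) s
          edge_setD[OF i] b[rule_format, OF i False] C(1) by simp
    qed
  qed
qed

lemma Min_insert_image_continuous:
  fixes f :: "'b::topological_space \<Rightarrow> real"
  assumes "finite A" "continuous_on S f" "\<And>i. i \<in> A \<Longrightarrow> continuous_on S (h i)"
  shows "continuous_on S (\<lambda>s. Min (insert (f s) ((\<lambda>i. h i s) ` A)))"
  using assms
proof (induction A rule: finite_induct)
  case (insert i A)
  have "Min (insert (f s) ((\<lambda>i. h i s) ` insert i A)) = min (h i s) (Min (insert (f s) ((\<lambda>i. h i s) ` A)))" for s
    using insert.hyps by (simp add: insert_commute[of "f s"] del: Min_insert) (subst Min_insert, auto)
  then show ?case using insert by (auto intro!: continuous_on_min)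
qed simp

lemma vertex_running_cost_continuous:
  assumes j: "j \<in> {1..num_vertices G}"
  shows "continuous_on {0..T} (vertex_running_cost G D j)"
  unfolding vertex_running_cost_def[abs_def]
proof (rule Min_insert_image_continuous[OF finite_incident vertex_cost_continuous[OF j]])
  fix i assume i: "i \<in> incident_edges G j"
  have "continuous_on {0..T} ((\<lambda>(y, a, s). lc i y a s) \<circ> (\<lambda>s. (edge_coord G i (vertex G j), 0, s)))"
    by (intro continuous_on_compose continuous_intros continuous_on_subset[OF regularity(3)])
       (use incident_edge_coord[OF i] in auto)
  then show "continuous_on {0..T} (\<lambda>s. lc i (edge_coord G i (vertex G j)) 0 s)" by (simp add: o_def)
qed

end

section \<open>Curves with a chosen derivative, splicing, and the dynamic programming
  principle\<close>

section \<open>Admissible curves and optimality\<close>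

lemma primitive_on_spike:
  assumes "primitive_on a b y v" "negligible N" "\<And>s. s \<in> {a..b} - N \<Longrightarrow> w s = v s"
  shows "primitive_on a b y w"
proof (rule primitive_onI)
  show "w absolutely_integrable_on {a..b}"
    by (rule absolutely_integrable_spike[OF primitive_onD(1)[OF assms(1)] assms(2,3)])
  show "(w has_integral (y s - y a)) {a..s}" if "a \<le> s" "s \<le> b" for s
    by (rule has_integral_spike[OF assms(2) _ primitive_onD(3)[OF assms(1) that]])
       (use assms(3) that in auto)
qed

lemma primitive_on_measurable:
  assumes "primitive_on a b y v"
  shows "v \<in> borel_measurable (lebesgue_on {a..b})" "y \<in> borel_measurable (lebesgue_on {a..b})"
  using absolutely_integrable_imp_borel_measurable[OF primitive_onD(1)[OF assms]]
    continuous_imp_measurable_on_sets_lebesgue[OF primitive_on_continuous[OF assms]] by auto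

lemma primitive_on_concat:
  assumes 1: "primitive_on a c y1 v1" and 2: "primitive_on c b y2 v2" and eq: "y1 c = y2 c"
    and ac: "a \<le> c" "c \<le> b"
  shows "primitive_on a b (\<lambda>s. if s \<le> c then y1 s else y2 s) (\<lambda>s. if s \<le> c then v1 s else v2 s)"
    (is "primitive_on a b ?y ?v")
proof (rule primitive_onI)
  have l: "?v absolutely_integrable_on {a..c}"
    by (rule absolutely_integrable_spike[OF primitive_onD(1)[OF 1], of "{}"]) auto
  have r: "?v absolutely_integrable_on {c..b}"
    by (rule absolutely_integrable_spike[OF primitive_onD(1)[OF 2], of "{c}"]) auto
  show "?v absolutely_integrable_on {a..b}"
    by (rule absolutely_integrable_on_combine[OF l r ac])
  fix s assume s: "a \<le> s" "s \<le> b"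
  show "(?v has_integral (?y s - ?y a)) {a..s}"
  proof (cases "s \<le> c")
    case True
    show ?thesis
      by (rule has_integral_eq[of _ v1]) (use primitive_onD(3)[OF 1 s(1) True] True s in auto)
  next
    case False
    have "(?v has_integral (y1 c - y1 a)) {a..c}"
      by (rule has_integral_eq[of _ v1]) (use primitive_onD(3)[OF 1 ac(1)] in auto)
    moreover have "(?v has_integral (y2 s - y2 c)) {c..s}"
      by (rule has_integral_spike[of "{c}" _ _ v2]) (use primitive_onD(3)[OF 2, of s] False s in auto)
    ultimately have "(?v has_integral ((y1 c - y1 a) + (y2 s - y2 c))) {a..s}"
      by (rule has_integral_combine[rotated 2]) (use ac False in auto)
    then show ?thesis using False eq ac by simp
  qed
qed

lemma AE_lebesgue_on_interval:
  assumes "negligible {s \<in> {a..b::real}. \<not> P s}"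
  shows "AE s in lebesgue_on {a..b}. P s"
proof -
  have "AE s in lebesgue. s \<in> {a..b} \<longrightarrow> P s"
    using assms by (intro AE_I'[of "{s \<in> {a..b}. \<not> P s}"]) (auto simp: negligible_iff_null_sets)
  then show ?thesis by (subst AE_restrict_space_iff) auto
qed

context control_problem
begin

text \<open>The working form of a trajectory: an explicit derivative instead of
  \<open>weak_deriv\<close>, and no prescribed initial point, so that restriction and concatenation
  stay within the notion.\<close>

definition traj :: "real \<Rightarrow> real \<Rightarrow> (real \<Rightarrow> 'a) \<Rightarrow> (real \<Rightarrow> 'a) \<Rightarrow> bool" where
  "traj a b q w \<longleftrightarrow> primitive_on a b q w \<and> (\<lambda>s. norm (w s) powr p) integrable_on {a..b} \<and>
     q ` {a..b} \<subseteq> network_set G"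

definition cost :: "real \<Rightarrow> real \<Rightarrow> (real \<Rightarrow> 'a) \<Rightarrow> (real \<Rightarrow> 'a) \<Rightarrow> real" where
  "cost a b q w = integral {a..b} (\<lambda>s. L (q s) (w s) s)"

lemma trajD:
  assumes "traj a b q w"
  shows "primitive_on a b q w" "(\<lambda>s. norm (w s) powr p) integrable_on {a..b}"
    "\<And>s. a \<le> s \<Longrightarrow> s \<le> b \<Longrightarrow> q s \<in> network_set G" "continuous_on {a..b} q"
  using assms primitive_on_continuous unfolding traj_def by auto

lemma traj_subinterval:
  assumes "traj a b q w" "a \<le> c" "c \<le> d" "d \<le> b"
  shows "traj c d q w"
proof -
  have "(\<lambda>s. norm (w s) powr p) integrable_on {c..d}"
    by (rule integrable_on_subinterval[OF trajD(2)[OF assms(1)]]) (use assms in auto)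
  then show ?thesis
    using primitive_on_subinterval[OF trajD(1)[OF assms(1)] assms(2-4)] trajD(3)[OF assms(1)] assms(2-4)
    unfolding traj_def by auto
qed

lemma traj_spike:
  assumes "traj a b q v" "negligible N" "\<And>s. s \<in> {a..b} - N \<Longrightarrow> w s = v s"
  shows "traj a b q w" "cost a b q w = cost a b q v"
proof -
  have "(\<lambda>s. norm (w s) powr p) integrable_on {a..b}"
    by (rule integrable_spike[OF trajD(2)[OF assms(1)] assms(2)]) (use assms(3) in auto)
  then show "traj a b q w"
    using primitive_on_spike[OF trajD(1)[OF assms(1)] assms(2,3)] trajD(3)[OF assms(1)]
    unfolding traj_def by auto
  show "cost a b q w = cost a b q v"
    unfolding cost_def by (rule integral_spike[OF assms(2)]) (use assms(3) in auto)
qed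

lemma traj_running_cost_measurable:
  assumes tr: "traj a b q w" and ab: "0 \<le> a" "b \<le> T"
  shows "(\<lambda>s. L (q s) (w s) s) \<in> borel_measurable (lebesgue_on {a..b})"
proof -
  let ?M = "lebesgue_on {a..b}"
  have wm: "w \<in> borel_measurable ?M" and qm: "q \<in> borel_measurable ?M"
    using primitive_on_measurable[OF trajD(1)[OF tr]] by auto
  have id: "(\<lambda>s. s) \<in> borel_measurable ?M"
    by (simp add: measurable_completion measurable_restrict_space1)
  have e: "(\<lambda>s. lc k (edge_coord G k (q s)) (w s \<bullet> e k) s * indicator (J k - Vt) (q s)) \<in> borel_measurable ?M"
    if k: "k \<in> E" for k
  proof -
    define S where "S = I k \<times> (UNIV :: real set) \<times> {0..T}"
    \<comment> \<open>Extending the edge cost by zero makes it Borel on the whole space; the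
      indicator of the edge removes the points where this changes anything.\<close>
    define F where "F = (\<lambda>x. indicator S x *\<^sub>R (case x of (y, a, s) \<Rightarrow> lc k y a s))"
    have "closed S" unfolding S_def by (intro closed_Times domain_closed k) auto
    then have "F \<in> borel_measurable borel" unfolding F_def
      using regularity(3)[OF k] by (intro borel_measurable_continuous_on_indicator) (auto simp: S_def)
    moreover have "(\<lambda>s. (co k (q s), w s \<bullet> e k, s)) \<in> borel_measurable ?M"
      unfolding co_def by (intro borel_measurable_Pair borel_measurable_inner borel_measurable_diff wm qm id) auto
    ultimately have "(\<lambda>s. F (co k (q s), w s \<bullet> e k, s)) \<in> borel_measurable ?M"
      by (rule measurable_compose[rotated])
    moreover have "J k - Vt \<in> sets borel"
      using edge_closed[OF k] finite_imp_closed[OF finite_vertices] by auto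
    then have "(\<lambda>s. indicator (J k - Vt) (q s) :: real) \<in> borel_measurable ?M"
      using qm by (intro measurable_compose[OF qm]) auto
    ultimately have m: "(\<lambda>s. F (co k (q s), w s \<bullet> e k, s) * indicator (J k - Vt) (q s)) \<in> borel_measurable ?M"
      by (rule borel_measurable_times)
    show ?thesis
    proof (rule measurable_cong[THEN iffD1, OF _ m])
      fix s assume "s \<in> space ?M"
      then have s: "s \<in> {0..T}" using ab by auto
      show "F (co k (q s), w s \<bullet> e k, s) * indicator (J k - Vt) (q s)
         = lc k (edge_coord G k (q s)) (w s \<bullet> e k) s * indicator (J k - Vt) (q s)"
        using edge_setD[OF k, of "q s"] edge_coord_eq[OF k, of "q s"] s
        by (auto simp: F_def S_def indicator_def)
    qed
  qed
  have v: "(\<lambda>s. vertex_running_cost G D j s * indicator {vertex G j} (q s)) \<in> borel_measurable ?M"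
    if j: "j \<in> {1..num_vertices G}" for j
  proof (rule borel_measurable_times)
    show "vertex_running_cost G D j \<in> borel_measurable ?M"
      by (rule continuous_imp_measurable_on_sets_lebesgue[OF continuous_on_subset[OF vertex_running_cost_continuous[OF j]]])
         (use ab in auto)
    show "(\<lambda>s. indicator {vertex G j} (q s) :: real) \<in> borel_measurable ?M"
      using qm by (intro measurable_compose[OF qm]) auto
  qed
  show ?thesis unfolding running_cost_def
    by (intro borel_measurable_add borel_measurable_sum e v)
qed

lemma coord_bound:
  obtains B where "0 \<le> B" "\<And>i y. i \<in> E \<Longrightarrow> co i y \<le> norm y + B"
proof -
  have "bounded (bs ` E)" by (intro finite_imp_bounded finite_imageI) simp
  then obtain B where B: "\<forall>z\<in>bs ` E. norm z \<le> B" unfolding bounded_iff by blast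
  show thesis
  proof (rule that[of "max B 0"])
    fix i y assume i: "i \<in> E"
    have "co i y \<le> norm (y - bs i) * norm (e i)" unfolding co_def by (rule norm_cauchy_schwarz)
    also have "\<dots> \<le> norm y + norm (bs i)" using norm_dir[OF i] norm_triangle_ineq4 by simp
    finally show "co i y \<le> norm y + max B 0" using bspec[OF B imageI[OF i, of bs]] by simp
  qed simp
qed

lemma running_cost_growth:
  obtains C where "0 \<le> C"
    "\<And>y \<alpha> s. y \<in> network_set G \<Longrightarrow> s \<in> {0..T} \<Longrightarrow>
       (\<forall>i\<in>E. y \<in> J i \<longrightarrow> co i y \<le> r) \<Longrightarrow> \<bar>L y \<alpha> s\<bar> \<le> C * (norm \<alpha> powr p + 1)"
proof -
  obtain C1 where C1: "0 \<le> C1"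
    "\<And>i b a s. i \<in> E \<Longrightarrow> b \<in> I i \<Longrightarrow> b \<le> r \<Longrightarrow> s \<in> {0..T} \<Longrightarrow> \<bar>lc i b a s\<bar> \<le> C1 * (\<bar>a\<bar> powr p + 1)"
    by (rule edge_cost_growth[of r]) (rule that, assumption+)
  obtain C2 where C2: "0 \<le> C2" "\<And>y \<alpha> s. y \<in> network_set G \<Longrightarrow> s \<in> {0..T} \<Longrightarrow>
       (\<forall>i\<in>E. y \<in> J i \<longrightarrow> y \<notin> Vt \<longrightarrow> co i y \<le> r \<and> \<bar>\<alpha> \<bullet> e i\<bar> \<le> 0) \<Longrightarrow> L y \<alpha> s \<le> C2"
    by (rule running_cost_bounded[of r 0]) (rule that, assumption+)
  show thesis
  proof (rule that[of "C1 + C2 + C0"])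
    show "0 \<le> C1 + C2 + C0" using C1 C2 C0_pos by simp
    fix y \<alpha> :: 'a and s assume y: "y \<in> network_set G" and s: "s \<in> {0..T}"
      and b: "\<forall>i\<in>E. y \<in> J i \<longrightarrow> co i y \<le> r"
    have n: "1 \<le> norm \<alpha> powr p + 1" by simp
    have nn: "x \<le> x * (norm \<alpha> powr p + 1)" if "0 \<le> x" for x
      using that n mult_left_mono[OF n that] by simp
    have "\<bar>L y \<alpha> s\<bar> \<le> C1 * (norm \<alpha> powr p + 1) + C2 + C0"
    proof (cases "y \<in> Vt")
      case True
      then have "L y \<alpha> s \<le> C2" using C2(2)[OF y s] by blast
      moreover have "0 \<le> C1 * (norm \<alpha> powr p + 1)" using C1 by simp
      ultimately show ?thesis using running_cost_ge[OF y s, of \<alpha>] C0_pos C2(1) by linarith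
    next
      case False
      then obtain i where i: "i \<in> E" "y \<in> J i" using network_edge y by blast
      have "\<bar>L y \<alpha> s\<bar> \<le> C1 * (\<bar>\<alpha> \<bullet> e i\<bar> powr p + 1)"
        using running_cost_edge[OF i False] C1(2)[OF i(1) _ b[rule_format, OF i] s] edge_setD[OF i] by simp
      also have "\<bar>\<alpha> \<bullet> e i\<bar> powr p \<le> norm \<alpha> powr p"
        using Cauchy_Schwarz_ineq2[of \<alpha> "e i"] norm_dir[OF i(1)] p_gt_1 by (intro powr_mono2) auto
      finally have "\<bar>L y \<alpha> s\<bar> \<le> C1 * (norm \<alpha> powr p + 1)" using C1(1) by (simp add: mult_left_mono)
      then show ?thesis using C0_pos C2(1) by linarith
    qed
    also have "\<dots> \<le> (C1 + C2 + C0) * (norm \<alpha> powr p + 1)"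
      using nn[OF C2(1)] nn[OF less_imp_le[OF C0_pos]] unfolding distrib_right[of _ _ "norm \<alpha> powr p + 1"]
      by linarith
    finally show "\<bar>L y \<alpha> s\<bar> \<le> (C1 + C2 + C0) * (norm \<alpha> powr p + 1)" .
  qed
qed

text \<open>The image of the curve is compact, so its coordinates are bounded and the local growth
  bound supplies the dominating function.\<close>

lemma traj_cost_integrable:
  assumes tr: "traj a b q w" and ab: "0 \<le> a" "b \<le> T"
  shows "(\<lambda>s. L (q s) (w s) s) absolutely_integrable_on {a..b}"
proof -
  obtain B where B: "\<And>i y. i \<in> E \<Longrightarrow> co i y \<le> norm y + B"
    by (rule coord_bound) (rule that, assumption+)
  have "bounded (q ` {a..b})"
    by (intro compact_imp_bounded compact_continuous_image trajD(4)[OF tr]) auto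
  then obtain R where R: "\<forall>z\<in>q ` {a..b}. norm z \<le> R" unfolding bounded_iff by blast
  obtain C where C: "\<And>y \<alpha> s. y \<in> network_set G \<Longrightarrow> s \<in> {0..T} \<Longrightarrow>
       (\<forall>i\<in>E. y \<in> J i \<longrightarrow> co i y \<le> R + B) \<Longrightarrow> \<bar>L y \<alpha> s\<bar> \<le> C * (norm \<alpha> powr p + 1)"
    by (rule running_cost_growth[of "R + B"]) (rule that, assumption+)
  show ?thesis
  proof (rule measurable_bounded_by_integrable_imp_absolutely_integrable[OF traj_running_cost_measurable[OF assms]])
    show "(\<lambda>s. C * (norm (w s) powr p + 1)) integrable_on {a..b}"
      by (intro integrable_on_mult_right integrable_add trajD(2)[OF tr] integrable_const_ivl)
    fix s assume s: "s \<in> {a..b}"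
    have n: "norm (q s) \<le> R" using R s by blast
    have "\<bar>L (q s) (w s) s\<bar> \<le> C * (norm (w s) powr p + 1)"
    proof (rule C)
      show "q s \<in> network_set G" using trajD(3)[OF tr] s by simp
      show "s \<in> {0..T}" using s ab by auto
      show "\<forall>i\<in>E. q s \<in> J i \<longrightarrow> co i (q s) \<le> R + B"
        using B[of _ "q s"] n by (meson add_right_mono order_trans)
    qed
    then show "norm (L (q s) (w s) s) \<le> C * (norm (w s) powr p + 1)" by simp
  qed simp
qed

lemma traj_cost_integrable_on:
  "traj a b q w \<Longrightarrow> 0 \<le> a \<Longrightarrow> b \<le> T \<Longrightarrow> (\<lambda>s. L (q s) (w s) s) integrable_on {a..b}"
  using traj_cost_integrable absolutely_integrable_on_def by blast

lemma cost_combine: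
  assumes "traj a b q w" "0 \<le> a" "b \<le> T" "a \<le> c" "c \<le> b"
  shows "cost a b q w = cost a c q w + cost c b q w"
  unfolding cost_def
  by (rule Henstock_Kurzweil_Integration.integral_combine[symmetric, OF assms(4,5) traj_cost_integrable_on[OF assms(1-3)]])

lemma traj_concat:
  assumes 1: "traj a c q1 w1" and 2: "traj c b q2 w2" and eq: "q1 c = q2 c"
    and ac: "a \<le> c" "c \<le> b" and T: "0 \<le> a" "b \<le> T"
  shows "traj a b (\<lambda>s. if s \<le> c then q1 s else q2 s) (\<lambda>s. if s \<le> c then w1 s else w2 s)"
    and "cost a b (\<lambda>s. if s \<le> c then q1 s else q2 s) (\<lambda>s. if s \<le> c then w1 s else w2 s)
         = cost a c q1 w1 + cost c b q2 w2"
proof -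
  let ?q = "\<lambda>s. if s \<le> c then q1 s else q2 s" and ?w = "\<lambda>s. if s \<le> c then w1 s else w2 s"
  have l: "(\<lambda>s. norm (?w s) powr p) integrable_on {a..c}"
    by (rule integrable_spike[OF trajD(2)[OF 1], of "{}"]) auto
  have r: "(\<lambda>s. norm (?w s) powr p) integrable_on {c..b}"
    by (rule integrable_spike[OF trajD(2)[OF 2], of "{c}"]) auto
  have "(\<lambda>s. norm (?w s) powr p) integrable_on {a..b}"
    by (rule Henstock_Kurzweil_Integration.integrable_combine[OF ac l r])
  moreover have "?q ` {a..b} \<subseteq> network_set G"
    using trajD(3)[OF 1] trajD(3)[OF 2] ac by auto
  ultimately show tr: "traj a b ?q ?w"
    using primitive_on_concat[OF trajD(1)[OF 1] trajD(1)[OF 2] eq ac] unfolding traj_def by blast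
  have "cost a c ?q ?w = cost a c q1 w1" unfolding cost_def by (rule integral_cong) auto
  moreover have "cost c b ?q ?w = cost c b q2 w2"
    unfolding cost_def by (rule integral_spike[of "{c}"]) auto
  ultimately show "cost a b ?q ?w = cost a c q1 w1 + cost c b q2 w2"
    using cost_combine[OF tr T ac] by simp
qed

lemma edge_path_traj:
  assumes i: "i \<in> E" and \<beta>: "\<beta>0 \<in> I i" "\<beta>1 \<in> I i" and ab: "a < b"
  shows "traj a b (\<lambda>s. pt i (\<beta>0 + (s - a) / (b - a) * (\<beta>1 - \<beta>0))) (\<lambda>_. ((\<beta>1 - \<beta>0) / (b - a)) *\<^sub>R e i)"
    (is "traj a b ?q ?w")
    and "\<And>s. a \<le> s \<Longrightarrow> s \<le> b \<Longrightarrow> \<beta>0 + (s - a) / (b - a) * (\<beta>1 - \<beta>0) \<in> I i \<and>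
      \<beta>0 + (s - a) / (b - a) * (\<beta>1 - \<beta>0) \<le> max \<beta>0 \<beta>1"
proof -
  show in_I: "\<beta>0 + (s - a) / (b - a) * (\<beta>1 - \<beta>0) \<in> I i \<and>
      \<beta>0 + (s - a) / (b - a) * (\<beta>1 - \<beta>0) \<le> max \<beta>0 \<beta>1"
    if s: "a \<le> s" "s \<le> b" for s
  proof -
    define u where "u = (s - a) / (b - a)"
    have u: "0 \<le> u" "u \<le> 1" using s ab by (auto simp: u_def)
    have "(1 - u) *\<^sub>R \<beta>0 + u *\<^sub>R \<beta>1 \<in> I i" using domain_convex[OF i] \<beta> u by (intro convexD) auto
    moreover have "\<beta>0 + u * (\<beta>1 - \<beta>0) = (1 - u) *\<^sub>R \<beta>0 + u *\<^sub>R \<beta>1" by (simp add: algebra_simps)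
    moreover have "(1 - u) * \<beta>0 + u * \<beta>1 \<le> (1 - u) * max \<beta>0 \<beta>1 + u * max \<beta>0 \<beta>1"
      using u by (intro add_mono mult_left_mono) auto
    ultimately show ?thesis unfolding u_def[symmetric] by (simp add: algebra_simps)
  qed
  have "primitive_on a b ?q ?w"
  proof (rule primitive_onI)
    show "?w absolutely_integrable_on {a..b}" by (intro absolutely_integrable_on_const) simp
    fix s assume s: "a \<le> s" "s \<le> b"
    have "(?w has_integral ((s - a) *\<^sub>R ?w s)) {a..s}" using has_integral_const_real[of "?w s" a s] s by simp
    moreover have "(s - a) *\<^sub>R ?w s = ?q s - ?q a" by (simp add: pt_def algebra_simps)
    ultimately show "(?w has_integral (?q s - ?q a)) {a..s}" by simp
  qed
  moreover have "?q ` {a..b} \<subseteq> network_set G"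
    using in_I pt_in_edge[OF i] edge_subset_network[OF i] by fastforce
  ultimately show "traj a b ?q ?w" unfolding traj_def by (simp add: integrable_const_ivl)
qed

lemma const_traj:
  assumes "z \<in> network_set G"
  shows "traj a b (\<lambda>_. z) (\<lambda>_. 0)"
  using assms unfolding traj_def primitive_on_def by (auto simp: integrable_const_ivl)

lemma cost_le:
  assumes tr: "traj a b q w" and T: "0 \<le> a" "b \<le> T" and ab: "a \<le> b"
    and le: "\<And>s. a \<le> s \<Longrightarrow> s \<le> b \<Longrightarrow> L (q s) (w s) s \<le> C"
  shows "cost a b q w \<le> C * (b - a)"
proof -
  have "cost a b q w \<le> integral {a..b} (\<lambda>_. C)"
    unfolding cost_def
    by (rule integral_le[OF traj_cost_integrable_on[OF tr T] integrable_const_ivl]) (use le in auto)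
  then show ?thesis using ab by (simp add: mult.commute)
qed

lemma cost_ge:
  assumes tr: "traj a b q w" and T: "0 \<le> a" "b \<le> T" and ab: "a \<le> b"
  shows "- C0 * (b - a) \<le> cost a b q w"
proof -
  have "integral {a..b} (\<lambda>_. - C0) \<le> cost a b q w"
    unfolding cost_def
  proof (rule integral_le[OF integrable_const_ivl traj_cost_integrable_on[OF tr T]])
    fix s assume "s \<in> {a..b}"
    then show "- C0 \<le> L (q s) (w s) s" using trajD(3)[OF tr] T by (intro running_cost_ge) auto
  qed
  then show ?thesis using ab by (simp add: mult.commute)
qed

text \<open>The return to the original definitions. The representative chosen by \<open>SOME\<close>
  is also a derivative in the sense of \<open>primitive_on\<close>, hence differs from
  \<open>w\<close> on a null set and gives the same cost; integrability identifies the Bochner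
  integral with the Henstock-Kurzweil one.\<close>

lemma traj_weak_deriv:
  assumes tr: "traj t T q w" and t: "0 \<le> t" "t \<le> T"
  shows "negligible {s \<in> {t..T}. w s \<noteq> weak_deriv t T q s}" "traj t T q (weak_deriv t T q)"
    "q \<in> trajectories G p T t (q t)" "total_cost G D T t q = cost t T q w + g (q T)"
proof -
  have wd: "has_weak_deriv t T q w"
    by (rule primitive_on_imp_weak_deriv[OF trajD(1)[OF tr] t(2)])
  then have "has_weak_deriv t T q (weak_deriv t T q)"
    unfolding weak_deriv_def by (rule someI[of "has_weak_deriv t T q"])
  then have "primitive_on t T q (weak_deriv t T q)"
    by (rule weak_deriv_imp_primitive_on[OF _ trajD(4)[OF tr]])
  then show neg: "negligible {s \<in> {t..T}. w s \<noteq> weak_deriv t T q s}"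
    by (rule primitive_on_unique_ae[OF trajD(1)[OF tr]])
  have eq: "weak_deriv t T q s = w s" if "s \<in> {t..T} - {s \<in> {t..T}. w s \<noteq> weak_deriv t T q s}" for s
    using that by auto
  show tr': "traj t T q (weak_deriv t T q)" by (rule traj_spike[OF tr neg eq])
  have c: "cost t T q (weak_deriv t T q) = cost t T q w" by (rule traj_spike[OF tr neg eq])
  have "integrable (lebesgue_on {t..T}) (\<lambda>s. L (q s) (weak_deriv t T q s) s)"
    by (rule absolutely_integrable_imp_integrable[OF traj_cost_integrable[OF tr' t(1)]]) auto
  then show "total_cost G D T t q = cost t T q w + g (q T)"
    using c unfolding total_cost_def cost_def by (simp add: lebesgue_integral_eq_integral)
  have lp: "Lp_on p t T w"
    unfolding Lp_on_def
  proof
    show "w \<in> borel_measurable (lebesgue_on {t..T})" by (rule primitive_on_measurable[OF trajD(1)[OF tr]])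
    show "integrable (lebesgue_on {t..T}) (\<lambda>s. norm (w s) powr p)"
      using trajD(2)[OF tr]
      by (intro absolutely_integrable_imp_integrable nonnegative_absolutely_integrable_1) auto
  qed
  have cq: "continuous_on {t..T} (\<lambda>s. norm (q s) powr p)"
    by (rule continuous_on_powr') (use p_gt_1 trajD(4)[OF tr] in \<open>auto intro!: continuous_intros\<close>)
  have "Lp_on p t T q"
    unfolding Lp_on_def
  proof
    show "q \<in> borel_measurable (lebesgue_on {t..T})" by (rule primitive_on_measurable[OF trajD(1)[OF tr]])
    show "integrable (lebesgue_on {t..T}) (\<lambda>s. norm (q s) powr p)"
      by (rule absolutely_integrable_imp_integrable[OF absolutely_integrable_continuous_real[OF cq]]) simp
  qed
  then have "W1p_on p t T q" unfolding W1p_on_def using wd lp by blast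
  then show "q \<in> trajectories G p T t (q t)"
    unfolding trajectories_def using trajD[OF tr] by auto
qed

lemma trajectory_imp_traj:
  assumes q: "q \<in> trajectories G p T t x"
  shows "\<exists>w. traj t T q w" "q t = x"
proof -
  obtain w where w: "has_weak_deriv t T q w" "Lp_on p t T w" and q': "continuous_on {t..T} q"
      "q ` {t..T} \<subseteq> network_set G" "q t = x"
    using q unfolding trajectories_def W1p_on_def by blast
  have "primitive_on t T q w" by (rule weak_deriv_imp_primitive_on[OF w(1) q'(1)])
  moreover have "(\<lambda>s. norm (w s) powr p) integrable_on {t..T}"
    using w(2) integrable_on_lebesgue_on[of "{t..T}" "\<lambda>s. norm (w s) powr p"]
    unfolding Lp_on_def by simp
  ultimately show "\<exists>w. traj t T q w" "q t = x" unfolding traj_def using q' by blast+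
qed

text \<open>Required at every time, not only almost everywhere, so that speed and edge velocity
  agree pointwise. A change of the derivative on a null set achieves this.\<close>

definition tangential :: "real \<Rightarrow> real \<Rightarrow> (real \<Rightarrow> 'a) \<Rightarrow> (real \<Rightarrow> 'a) \<Rightarrow> bool" where
  "tangential a b q w \<longleftrightarrow> (\<forall>s\<in>{a..b}. (q s \<in> Vt \<longrightarrow> w s = 0) \<and>
     (\<forall>i\<in>E. q s \<in> J i \<longrightarrow> q s \<notin> Vt \<longrightarrow> w s = (w s \<bullet> e i) *\<^sub>R e i))"

text \<open>The vertices and the other edges form a closed set that misses
  \<open>q s\<close>.\<close>

lemma stays_in_edge:
  fixes a b s :: real
  assumes cont: "continuous_on {a..b} q" and net: "q ` {a..b} \<subseteq> network_set G"
    and s: "a \<le> s" "s < b" and i: "i \<in> E" "q s \<in> J i" "q s \<notin> Vt"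
  shows "eventually (\<lambda>h. q (s + h) \<in> J i) (at_right 0)"
proof -
  define R where "R = Vt \<union> (\<Union>k\<in>E - {i}. J k)"
  have "closed R" unfolding R_def
    by (intro closed_Un finite_imp_closed finite_vertices closed_UN ballI edge_closed finite_Diff) auto
  have "q s \<notin> R"
  proof
    assume "q s \<in> R"
    then obtain k where "k \<in> E - {i}" "q s \<in> J k" using i(3) unfolding R_def by blast
    then show False using edge_unique[OF i(1), of k "q s"] i by blast
  qed
  then have "open (- R)" "q s \<in> - R" using \<open>closed R\<close> by auto
  moreover have "(q \<longlongrightarrow> q s) (at s within {a..b})"
    using cont s unfolding continuous_on_def by simp
  ultimately have "eventually (\<lambda>u. q u \<in> - R) (at s within {a..b})"
    by (rule topological_tendstoD[rotated])
  then obtain d where d: "d > 0" "\<And>u. u \<in> {a..b} \<Longrightarrow> u \<noteq> s \<Longrightarrow> dist u s < d \<Longrightarrow> q u \<in> - R"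
    unfolding eventually_at by blast
  have "q (s + h) \<in> J i" if h: "0 < h" "h < min d (b - s)" for h
  proof -
    have u: "s + h \<in> {a..b}" "s + h \<noteq> s" "dist (s + h) s < d" using h s by (auto simp: dist_real_def)
    then have "q (s + h) \<notin> R" using d(2) by blast
    moreover have "q (s + h) \<in> network_set G" using net u by blast
    ultimately show ?thesis unfolding R_def network_set_def by blast
  qed
  then show ?thesis unfolding eventually_at_right_field using d(1) s
    by (intro exI[of _ "min d (b - s)"]) auto
qed

text \<open>At vertices the derivative vanishes almost everywhere by the level-set lemma, applied to
  each of the finitely many vertices. Elsewhere the curve stays briefly in one edge, so its right
  difference quotients, and their limit, are multiples of that edge's direction.\<close>

lemma tangential_representative:
  assumes tr: "traj a b q v"
  obtains v' where "traj a b q v'" "tangential a b q v'" "negligible {s \<in> {a..b}. v' s \<noteq> v s}"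
proof -
  \<comment> \<open>The projection of \<open>v\<close> onto the edge direction; the edge is unique
    off the vertices, so the choice is harmless.\<close>
  define v' where "v' s = (if q s \<in> Vt then 0
     else let i = (SOME i. i \<in> E \<and> q s \<in> J i) in (v s \<bullet> e i) *\<^sub>R e i)" for s
  have v'_edge: "v' s = (v s \<bullet> e i) *\<^sub>R e i" if "i \<in> E" "q s \<in> J i" "q s \<notin> Vt" for s i
  proof -
    have ex: "(SOME i. i \<in> E \<and> q s \<in> J i) \<in> E \<and> q s \<in> J (SOME i. i \<in> E \<and> q s \<in> J i)"
      by (rule someI_ex) (use that in blast)
    then have "(SOME i. i \<in> E \<and> q s \<in> J i) = i" using edge_unique[of _ i "q s"] that by blast
    then show ?thesis using that(3) by (simp add: v'_def)
  qed
  have tan: "tangential a b q v'"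
    unfolding tangential_def
  proof (intro ballI conjI impI)
    show "v' s = 0" if "q s \<in> Vt" for s using that by (simp add: v'_def)
    show "v' s = (v' s \<bullet> e i) *\<^sub>R e i" if "i \<in> E" "q s \<in> J i" "q s \<notin> Vt" for s i
      using v'_edge[OF that] dir_inner[OF that(1)] by simp
  qed
  obtain N where N: "negligible N"
    "\<And>s. a \<le> s \<Longrightarrow> s < b \<Longrightarrow> s \<notin> N \<Longrightarrow> ((\<lambda>h. (q (s + h) - q s) /\<^sub>R h) \<longlongrightarrow> v s) (at_right 0)"
    by (rule primitive_on_right_deriv[OF trajD(1)[OF tr]]) (rule that, assumption+)
  \<comment> \<open>The end point \<open>b\<close> is included because no right difference quotient
    is available there.\<close>
  define N' where "N' = N \<union> (\<Union>c\<in>Vt. {s \<in> {a..b}. q s = c \<and> v s \<noteq> 0}) \<union> {b}"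
  have negN': "negligible N'"
    unfolding N'_def
    by (intro negligible_Un N negligible_Union negligible_sing finite_imageI finite_vertices)
       (use primitive_on_zero_ae_level_set[OF trajD(1)[OF tr]] in auto)
  have eq: "v' s = v s" if s: "s \<in> {a..b} - N'" for s
  proof (cases "q s \<in> Vt")
    case True
    then have "v s = 0" using s unfolding N'_def by blast
    then show ?thesis using True by (simp add: v'_def)
  next
    case False
    have s': "a \<le> s" "s < b" "s \<notin> N" using s unfolding N'_def by auto
    have "q s \<in> network_set G" using trajD(3)[OF tr] s' by simp
    then obtain i where i: "i \<in> E" "q s \<in> J i" using network_edge False by blast
    let ?d = "\<lambda>h. (q (s + h) - q s) /\<^sub>R h"
    have lim: "(?d \<longlongrightarrow> v s) (at_right 0)" by (rule N(2)[OF s'])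
    have "((\<lambda>h. (?d h \<bullet> e i) *\<^sub>R e i) \<longlongrightarrow> (v s \<bullet> e i) *\<^sub>R e i) (at_right 0)"
      by (intro tendsto_intros lim)
    moreover have "eventually (\<lambda>h. (?d h \<bullet> e i) *\<^sub>R e i = ?d h) (at_right 0)"
    proof (rule eventually_mono[OF stays_in_edge[OF trajD(4)[OF tr] _ s'(1,2) i False]])
      show "q ` {a..b} \<subseteq> network_set G" using trajD(3)[OF tr] by auto
      fix h assume "q (s + h) \<in> J i"
      then have "q (s + h) = pt i (co i (q (s + h)))" using edge_setD[OF i(1)] by blast
      moreover have "q s = pt i (co i (q s))" using edge_setD[OF i] by blast
      ultimately have "q (s + h) - q s = pt i (co i (q (s + h))) - pt i (co i (q s))" by metis
      then have "q (s + h) - q s = (co i (q (s + h)) - co i (q s)) *\<^sub>R e i"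
        unfolding pt_def by (simp add: scaleR_diff_left)
      then show "(?d h \<bullet> e i) *\<^sub>R e i = ?d h" using dir_inner[OF i(1)] by simp
    qed
    ultimately have "(?d \<longlongrightarrow> (v s \<bullet> e i) *\<^sub>R e i) (at_right 0)"
      by (rule Lim_transform_eventually)
    then have "(v s \<bullet> e i) *\<^sub>R e i = v s"
      by (rule tendsto_unique[OF trivial_limit_at_right_real _ lim])
    then show ?thesis using v'_edge[OF i False] by (rule trans[rotated])
  qed
  show thesis
  proof (rule that[OF _ tan])
    show "traj a b q v'" by (rule traj_spike[OF tr negN' eq])
    show "negligible {s \<in> {a..b}. v' s \<noteq> v s}"
      by (rule negligible_subset[OF negN']) (use eq in blast)
  qed
qed

definition optimal :: "real \<Rightarrow> (real \<Rightarrow> 'a) \<Rightarrow> (real \<Rightarrow> 'a) \<Rightarrow> bool" where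
  "optimal t y v \<longleftrightarrow> traj t T y v \<and> tangential t T y v \<and>
     (\<forall>q w. traj t T q w \<longrightarrow> q t = y t \<longrightarrow> cost t T y v + g (y T) \<le> cost t T q w + g (q T))"

lemma optimal_trajectory_imp_optimal:
  assumes y: "y \<in> optimal_trajectories G D p T t x" and t: "0 \<le> t" "t \<le> T"
  obtains v where "optimal t y v" "negligible {s \<in> {t..T}. v s \<noteq> weak_deriv t T y s}" "y t = x"
proof -
  have yt: "y \<in> trajectories G p T t x"
    and inf: "total_cost G D T t y = (INF z\<in>trajectories G p T t x. total_cost G D T t z)"
    using y unfolding optimal_trajectories_def by auto
  obtain v0 where v0: "traj t T y v0" and yx: "y t = x"
    using trajectory_imp_traj[OF yt] by blast
  obtain v where v: "traj t T y v" "tangential t T y v"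
    by (rule tangential_representative[OF v0]) (rule that, assumption+)
  obtain B where B: "\<And>y. y \<in> network_set G \<Longrightarrow> \<bar>g y\<bar> \<le> B"
    by (rule final_cost_bounded) (rule that, assumption+)
  \<comment> \<open>A real infimum is a lower bound only for sets bounded below; H1 and the bounded
    final cost provide this.\<close>
  have bdd: "bdd_below (total_cost G D T t ` trajectories G p T t x)"
  proof (rule bdd_belowI2)
    fix z assume z: "z \<in> trajectories G p T t x"
    obtain w where w: "traj t T z w" using trajectory_imp_traj[OF z] by blast
    have "- B \<le> g (z T)" using B[OF trajD(3)[OF w t(2)]] by simp
    then show "- C0 * (T - t) - B \<le> total_cost G D T t z"
      using traj_weak_deriv(4)[OF w t] cost_ge[OF w t(1) _ t(2)] by simp
  qed
  have "cost t T y v + g (y T) \<le> cost t T q w + g (q T)" if q: "traj t T q w" "q t = y t" for q w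
  proof -
    have "q \<in> trajectories G p T t x" using traj_weak_deriv(3)[OF q(1) t] q(2) yx by simp
    then have "total_cost G D T t y \<le> total_cost G D T t q" unfolding inf by (rule cINF_lower[OF bdd])
    then show ?thesis using traj_weak_deriv(4)[OF q(1) t] traj_weak_deriv(4)[OF v(1) t] by simp
  qed
  then have "optimal t y v" unfolding optimal_def using v by blast
  then show thesis by (rule that[OF _ traj_weak_deriv(1)[OF v(1) t] yx])
qed

lemma optimalD:
  assumes "optimal t y v"
  shows "traj t T y v" "tangential t T y v"
    "\<And>q w. traj t T q w \<Longrightarrow> q t = y t \<Longrightarrow> cost t T y v + g (y T) \<le> cost t T q w + g (q T)"
  using assms unfolding optimal_def by blast+

text \<open>Dynamic programming: the competitor is appended to the unchanged initial part, whose
  cost cancels.\<close>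

lemma optimal_final:
  assumes opt: "optimal t y v" and a: "0 \<le> t" "t \<le> a" "a \<le> T"
    and q: "traj a T q w" "q a = y a"
  shows "cost a T y v + g (y T) \<le> cost a T q w + g (q T)"
proof (cases "a = T")
  case True
  then show ?thesis using q by (simp add: cost_def)
next
  case False
  have 1: "traj t a y v" by (rule traj_subinterval[OF optimalD(1)[OF opt]]) (use a in auto)
  note c = traj_concat[OF 1 q(1) q(2)[symmetric] a(2,3) a(1) order_refl]
  show ?thesis
    using optimalD(3)[OF opt c(1)] c(2) cost_combine[OF optimalD(1)[OF opt] a(1) order_refl a(2,3)] a False
    by simp
qed

lemma optimal_segment:
  assumes opt: "optimal t y v" and a: "0 \<le> t" "t \<le> a" "a < b" "b \<le> T"
    and q: "traj a b q w" "q a = y a" "q b = y b"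
  shows "cost a b y v \<le> cost a b q w"
proof -
  have 2: "traj b T y v" by (rule traj_subinterval[OF optimalD(1)[OF opt]]) (use a in auto)
  have 0: "0 \<le> a" "a \<le> b" using a by auto
  note c = traj_concat[OF q(1) 2 q(3) 0(2) a(4) 0(1) order_refl]
  have "cost a T y v + g (y T) \<le> cost a b q w + cost b T y v + g (if T \<le> b then q T else y T)"
    using optimal_final[OF opt a(1,2) _ c(1)] c(2) q(2) a by simp
  \<comment> \<open>The first branch occurs only for b = T, where the prescribed end point gives the
    same value.\<close>
  moreover have "(if T \<le> b then q T else y T) = y T" using q(3) a by auto
  moreover have "cost a T y v = cost a b y v + cost b T y v"
    by (rule cost_combine) (use a traj_subinterval[OF optimalD(1)[OF opt], of a T] in auto)
  ultimately show ?thesis by simp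
qed

end

section \<open>Energy estimates and cost increments under a change of speed\<close>

section \<open>Energy bounds\<close>

lemma integral_le_off_negligible:
  fixes f h :: "real \<Rightarrow> real"
  assumes f: "f integrable_on S" and h: "h integrable_on S" and N: "negligible N"
    and le: "\<And>s. s \<in> S - N \<Longrightarrow> f s \<le> h s"
  shows "integral S f \<le> integral S h"
proof -
  let ?f = "\<lambda>s. if s \<in> N then h s else f s"
  have "?f integrable_on S" by (rule integrable_spike[OF f N]) auto
  then have "integral S ?f \<le> integral S h" by (rule integral_le[OF _ h]) (use le in auto)
  moreover have "integral S f = integral S ?f" by (rule integral_spike[OF N]) auto
  ultimately show ?thesis by simp
qed

text \<open>The open interval is a countable union of closed ones, and one of them must carry a
  non-null part. This moves the estimates away from the end points, which may be vertices.\<close>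

lemma nonnegligible_compact_subinterval:
  fixes a b :: real
  assumes "\<not> negligible {s \<in> {a<..<b}. P s}"
  obtains c d where "a < c" "c < d" "d < b" "\<not> negligible {s \<in> {c..d}. P s}"
proof -
  let ?c = "\<lambda>n::nat. a + inverse (real (Suc n))" and ?d = "\<lambda>n::nat. b - inverse (real (Suc n))"
  have "{s \<in> {a<..<b}. P s} \<subseteq> (\<Union>n. {s \<in> {?c n..?d n}. P s})"
  proof
    fix s assume s: "s \<in> {s \<in> {a<..<b}. P s}"
    then have "0 < min (s - a) (b - s)" by auto
    then obtain n where "inverse (real (Suc n)) < min (s - a) (b - s)" using reals_Archimedean by blast
    then have "s \<in> {?c n..?d n}" by auto
    with s show "s \<in> (\<Union>n. {s \<in> {?c n..?d n}. P s})" by blast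
  qed
  then have "\<not> negligible (\<Union>n. {s \<in> {?c n..?d n}. P s})"
    using assms negligible_subset by blast
  then obtain n where n: "\<not> negligible {s \<in> {?c n..?d n}. P s}"
    using negligible_countable_Union[of "range (\<lambda>n. {s \<in> {?c n..?d n}. P s})"] by fastforce
  have "?c n < ?d n"
  proof (rule ccontr)
    assume "\<not> ?c n < ?d n"
    then have "{s \<in> {?c n..?d n}. P s} \<subseteq> {?c n}" by auto
    then show False using n negligible_subset negligible_sing by blast
  qed
  then show thesis using that[of "?c n" "?d n"] n by simp
qed

lemma closed_interval_image_closed:
  fixes q :: "real \<Rightarrow> 'a::euclidean_space"
  assumes "continuous_on {a..b} q" "a < b" "q ` {a<..<b} \<subseteq> S" "closed S"
  shows "q ` {a..b} \<subseteq> S"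
  using image_closure_subset[of "{a<..<b}" q S] assms by (simp add: closure_greaterThanLessThan)

context control_problem
begin

lemma interior_path_edge:
  assumes tr: "traj a b q w" and ab: "a < b" and nv: "\<forall>s\<in>{a<..<b}. q s \<notin> Vt"
  obtains i where "i \<in> E" "\<And>s. a \<le> s \<Longrightarrow> s \<le> b \<Longrightarrow> q s \<in> J i"
proof -
  have "q ` {a<..<b} \<subseteq> network_set G" using trajD(3)[OF tr] by auto
  moreover have "continuous_on {a<..<b} q" by (rule continuous_on_subset[OF trajD(4)[OF tr]]) auto
  moreover have "connected {a<..<b}" "{a<..<b} \<noteq> {}" using ab by auto
  ultimately obtain i where i: "i \<in> E" "q ` {a<..<b} \<subseteq> J i"
    using path_in_edge[of "{a<..<b}" q] nv by metis
  have "q ` {a..b} \<subseteq> J i"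
    by (rule closed_interval_image_closed[OF trajD(4)[OF tr] ab i(2) edge_closed[OF i(1)]])
  then have "q s \<in> J i" if "a \<le> s" "s \<le> b" for s using that by auto
  then show thesis by (rule that[OF i(1)])
qed

lemma tangential_vertex:
  assumes "tangential a b q w" "s \<in> {a..b}" "q s \<in> Vt"
  shows "w s = 0"
  using assms unfolding tangential_def by blast

lemma tangential_norm:
  assumes "tangential a b q w" "s \<in> {a..b}" "i \<in> E" "q s \<in> J i" "q s \<notin> Vt"
  shows "\<bar>w s \<bullet> e i\<bar> = norm (w s)"
proof -
  have "w s = (w s \<bullet> e i) *\<^sub>R e i" using assms unfolding tangential_def by blast
  then have "norm (w s) = norm ((w s \<bullet> e i) *\<^sub>R e i)" by (rule arg_cong)
  then show ?thesis using norm_dir[OF assms(3)] by simp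
qed

text \<open>At a vertex the running cost does not see the velocity; coercivity persists because a
  tangential derivative is 0 there.\<close>

lemma running_cost_coercive:
  assumes tr: "traj a b q w" and tan: "tangential a b q w" and s: "s \<in> {a..b}" and sT: "s \<in> {0..T}"
  shows "C0 * (norm (w s) powr p - 1) \<le> L (q s) (w s) s"
proof (cases "q s \<in> Vt")
  case True
  then have "w s = 0" by (rule tangential_vertex[OF tan s])
  moreover have "- C0 \<le> L (q s) (w s) s" using trajD(3)[OF tr] s sT by (intro running_cost_ge) auto
  ultimately show ?thesis by simp
next
  case False
  have "q s \<in> network_set G" using trajD(3)[OF tr] s by simp
  then obtain i where i: "i \<in> E" "q s \<in> J i" using network_edge False by blast
  have "C0 * (\<bar>w s \<bullet> e i\<bar> powr p - 1) \<le> L (q s) (w s) s"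
    using running_cost_edge[OF i False] edge_cost_ge[OF i(1) _ sT] edge_setD[OF i] by simp
  then show ?thesis using tangential_norm[OF tan s i False] by simp
qed

lemma cost_coercive:
  assumes tr: "traj a b q w" and tan: "tangential a b q w" and ab: "0 \<le> a" "a \<le> b" "b \<le> T"
  shows "C0 * (integral {a..b} (\<lambda>s. norm (w s) powr p) - (b - a)) \<le> cost a b q w"
proof -
  have i: "(\<lambda>s. norm (w s) powr p - 1) integrable_on {a..b}"
    by (intro integrable_diff trajD(2)[OF tr] integrable_const_ivl)
  have "integral {a..b} (\<lambda>s. C0 * (norm (w s) powr p - 1)) \<le> cost a b q w"
    unfolding cost_def
    by (rule integral_le[OF integrable_on_mult_right[OF i] traj_cost_integrable_on[OF tr ab(1,3)]])
       (use running_cost_coercive[OF tr tan] ab in auto)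
  moreover have "integral {a..b} (\<lambda>s. norm (w s) powr p - 1) = integral {a..b} (\<lambda>s. norm (w s) powr p) - (b - a)"
    using Henstock_Kurzweil_Integration.integral_diff[OF trajD(2)[OF tr] integrable_const_ivl[of 1]] ab by simp
  ultimately show ?thesis by simp
qed

lemma tangential_subinterval:
  "tangential a b q w \<Longrightarrow> a \<le> c \<Longrightarrow> d \<le> b \<Longrightarrow> tangential c d q w"
  unfolding tangential_def by auto

lemma traj_speed_integrable:
  assumes "traj a b q w"
  shows "(\<lambda>s. norm (w s)) integrable_on {a..b}"
  using absolutely_integrable_norm[OF primitive_onD(1)[OF trajD(1)[OF assms]]]
  by (auto simp: absolutely_integrable_on_def)

lemma displacement_le:
  assumes tr: "traj a b q w" and ab: "a \<le> b"
  shows "dist (q a) (q b) \<le> integral {a..b} (\<lambda>s. norm (w s))"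
proof -
  have h: "(w has_integral (q b - q a)) {a..b}" by (rule primitive_onD(3)[OF trajD(1)[OF tr] ab order_refl])
  have "norm (integral {a..b} w) \<le> integral {a..b} (\<lambda>s. norm (w s))"
    by (rule integral_norm_bound_integral[OF _ traj_speed_integrable[OF tr]]) (use h in auto)
  then show ?thesis using integral_unique[OF h] by (simp add: dist_norm norm_minus_commute)
qed

text \<open>Where the speed exceeds M \<ge> 1, 1 + speed is at most twice the speed, and M^(p-1) is
  at most speed^(p-1). Keeping both duration and displacement on the left lets one inequality serve
  all the comparisons.\<close>

lemma fast_energy:
  assumes tr: "traj a b q w" and ab: "a \<le> b" and M: "1 \<le> M"
    and fast: "negligible {s \<in> {a<..<b}. norm (w s) \<le> M}"
  shows "M powr (p - 1) * ((b - a) + dist (q a) (q b)) \<le> 2 * integral {a..b} (\<lambda>s. norm (w s) powr p)"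
proof -
  let ?K = "M powr (p - 1)"
  let ?N = "{s \<in> {a<..<b}. norm (w s) \<le> M} \<union> {a, b}"
  have i: "(\<lambda>s. 1 + norm (w s)) integrable_on {a..b}"
    by (intro integrable_add traj_speed_integrable[OF tr] integrable_const_ivl)
  have "?K * ((b - a) + dist (q a) (q b)) \<le> ?K * ((b - a) + integral {a..b} (\<lambda>s. norm (w s)))"
    using displacement_le[OF tr ab] by (intro mult_left_mono add_left_mono) auto
  also have "(b - a) + integral {a..b} (\<lambda>s. norm (w s)) = integral {a..b} (\<lambda>s. 1 + norm (w s))"
    using Henstock_Kurzweil_Integration.integral_add[OF integrable_const_ivl[of 1] traj_speed_integrable[OF tr]] ab by simp
  also have "?K * \<dots> = integral {a..b} (\<lambda>s. ?K * (1 + norm (w s)))" by simp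
  also have "\<dots> \<le> integral {a..b} (\<lambda>s. 2 * norm (w s) powr p)"
  proof (rule integral_le_off_negligible[OF integrable_on_mult_right[OF i] integrable_on_mult_right[OF trajD(2)[OF tr]]])
    show "negligible ?N" using fast by (intro negligible_Un) auto
    fix s assume "s \<in> {a..b} - ?N"
    then have n: "M < norm (w s)" by force
    have "?K * (1 + norm (w s)) \<le> norm (w s) powr (p - 1) * (2 * norm (w s))"
      using n M p_gt_1 by (intro mult_mono powr_mono2) auto
    also have "\<dots> = 2 * norm (w s) powr p" using powr_mult_self[of "norm (w s)"] by (simp add: mult_ac)
    finally show "?K * (1 + norm (w s)) \<le> 2 * norm (w s) powr p" .
  qed
  finally show ?thesis by simp
qed

text \<open>Collects what the later estimates need to know about the initial point: a coordinate
  bound and an energy bound.\<close>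

definition bounded_optimal :: "real \<Rightarrow> real \<Rightarrow> real \<Rightarrow> (real \<Rightarrow> 'a) \<Rightarrow> (real \<Rightarrow> 'a) \<Rightarrow> bool" where
  "bounded_optimal t r E0 y v \<longleftrightarrow> optimal t y v \<and>
     (\<forall>s\<in>{t..T}. \<forall>i\<in>E. y s \<in> J i \<longrightarrow> co i (y s) \<le> r) \<and>
     integral {t..T} (\<lambda>s. norm (v s) powr p) \<le> E0"

lemma bounded_optimalD:
  assumes "bounded_optimal t r E0 y v"
  shows "optimal t y v" "traj t T y v" "tangential t T y v"
    "\<And>s i. t \<le> s \<Longrightarrow> s \<le> T \<Longrightarrow> i \<in> E \<Longrightarrow> y s \<in> J i \<Longrightarrow> co i (y s) \<le> r"
    "integral {t..T} (\<lambda>s. norm (v s) powr p) \<le> E0"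
  using assms optimalD unfolding bounded_optimal_def by auto

lemma bounded_optimal_energy:
  assumes bo: "bounded_optimal t r E0 y v" and ab: "t \<le> a" "a \<le> b" "b \<le> T"
  shows "integral {a..b} (\<lambda>s. norm (v s) powr p) \<le> E0"
proof -
  have "integral {a..b} (\<lambda>s. norm (v s) powr p) \<le> integral {t..T} (\<lambda>s. norm (v s) powr p)"
    using trajD(2)[OF bounded_optimalD(2)[OF bo]] trajD(2)[OF traj_subinterval[OF bounded_optimalD(2)[OF bo] ab]] ab
    by (intro integral_subset_le) auto
  then show ?thesis using bounded_optimalD(5)[OF bo] by linarith
qed

lemma optimal_bounded:
  obtains r E0 where "\<And>t y v. 0 \<le> t \<Longrightarrow> t \<le> T \<Longrightarrow> optimal t y v \<Longrightarrow> norm (y t) \<le> R \<Longrightarrow> bounded_optimal t r E0 y v"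
proof -
  obtain B where B: "0 \<le> B" "\<And>i y. i \<in> E \<Longrightarrow> co i y \<le> norm y + B"
    by (rule coord_bound) (rule that, assumption+)
  obtain Bg where Bg: "0 \<le> Bg" "\<And>y. y \<in> network_set G \<Longrightarrow> \<bar>g y\<bar> \<le> Bg"
    by (rule final_cost_bounded) (rule that, assumption+)
  obtain C where C: "0 \<le> C" "\<And>y \<alpha> s. y \<in> network_set G \<Longrightarrow> s \<in> {0..T} \<Longrightarrow>
       (\<forall>i\<in>E. y \<in> J i \<longrightarrow> y \<notin> Vt \<longrightarrow> co i y \<le> R + B \<and> \<bar>\<alpha> \<bullet> e i\<bar> \<le> 0) \<Longrightarrow> L y \<alpha> s \<le> C"
    by (rule running_cost_bounded[of "R + B" 0]) (rule that, assumption+)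
  \<comment> \<open>\<open>C * T\<close> bounds the cost of standing still, \<open>2 * Bg\<close>
    the difference of the final costs, and the last \<open>T\<close> comes from the -1 in
    H1.\<close>
  define E0 where "E0 = (C * T + 2 * Bg) / C0 + T"
  \<comment> \<open>The distance travelled is at most \<open>E0 + T\<close>, since the speed is at
    most its p-th power plus 1; \<open>B\<close> converts norms into coordinates.\<close>
  define r where "r = R + (E0 + T) + B"
  have "bounded_optimal t r E0 y v" if t: "0 \<le> t" "t \<le> T" and opt: "optimal t y v" and R: "norm (y t) \<le> R"
    for t y v
  proof -
    note tr = optimalD(1)[OF opt]
    have net: "y t \<in> network_set G" "y T \<in> network_set G" using trajD(3)[OF tr] t by auto
    have "L (y t) 0 s \<le> C" if "t \<le> s" "s \<le> T" for s
    proof (rule C(2)[OF net(1)])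
      show "\<forall>i\<in>E. y t \<in> J i \<longrightarrow> y t \<notin> Vt \<longrightarrow> co i (y t) \<le> R + B \<and> \<bar>0 \<bullet> e i\<bar> \<le> 0"
        using B(2)[of _ "y t"] R by (simp add: order_trans[OF _ add_right_mono[OF R]])
    qed (use that t in auto)
    then have "cost t T (\<lambda>_. y t) (\<lambda>_. 0) \<le> C * (T - t)"
      by (intro cost_le[OF const_traj[OF net(1)] t(1) order_refl t(2)])
    also have "\<dots> \<le> C * T" using C(1) t by (intro mult_left_mono) auto
    finally have "cost t T (\<lambda>_. y t) (\<lambda>_. 0) \<le> C * T" .
    then have "cost t T y v \<le> C * T + 2 * Bg"
      using optimalD(3)[OF opt const_traj[OF net(1)]] Bg(2)[OF net(1)] Bg(2)[OF net(2)] by fastforce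
    then have "C0 * (integral {t..T} (\<lambda>s. norm (v s) powr p) - (T - t)) \<le> C * T + 2 * Bg"
      using cost_coercive[OF tr optimalD(2)[OF opt] t order_refl] by linarith
    then have "integral {t..T} (\<lambda>s. norm (v s) powr p) - (T - t) \<le> (C * T + 2 * Bg) / C0"
      using C0_pos by (simp add: pos_le_divide_eq mult.commute)
    then have en: "integral {t..T} (\<lambda>s. norm (v s) powr p) \<le> E0" using t unfolding E0_def by linarith
    have "co i (y s) \<le> r" if s: "t \<le> s" "s \<le> T" and i: "i \<in> E" for s i
    proof -
      have tr': "traj t s y v" by (rule traj_subinterval[OF tr]) (use s in auto)
      have "dist (y t) (y s) \<le> integral {t..s} (\<lambda>u. norm (v u))" by (rule displacement_le[OF tr' s(1)])
      also have "\<dots> \<le> integral {t..T} (\<lambda>u. norm (v u))"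
        using traj_speed_integrable[OF tr] traj_speed_integrable[OF tr'] s by (intro integral_subset_le) auto
      also have "\<dots> \<le> integral {t..T} (\<lambda>u. norm (v u) powr p + 1)"
        by (intro integral_le traj_speed_integrable[OF tr] integrable_add trajD(2)[OF tr] integrable_const_ivl
             le_powr_plus_1) simp
      also have "\<dots> = integral {t..T} (\<lambda>u. norm (v u) powr p) + (T - t)"
        using Henstock_Kurzweil_Integration.integral_add[OF trajD(2)[OF tr] integrable_const_ivl[of 1]] t by simp
      also have "\<dots> \<le> E0 + T" using en t by linarith
      finally have "norm (y s) \<le> R + (E0 + T)" using R norm_triangle_ineq2[of "y s" "y t"]
        by (simp add: dist_norm norm_minus_commute)
      then show ?thesis using B(2)[OF i, of "y s"] unfolding r_def by linarith
    qed
    then show ?thesis unfolding bounded_optimal_def using opt en by auto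
  qed
  then show thesis by (rule that)
qed

text \<open>By convexity, the increment over a step h \<le> 1 is at most h times the increment over
  a unit step in the same direction.\<close>

lemma slope_up:
  obtains C where "0 \<le> C" "\<And>i b a s h \<sigma>. i \<in> E \<Longrightarrow> b \<in> I i \<Longrightarrow> b \<le> r \<Longrightarrow> s \<in> {0..T} \<Longrightarrow> \<bar>a\<bar> \<le> M \<Longrightarrow>
     0 \<le> h \<Longrightarrow> h \<le> 1 \<Longrightarrow> \<bar>\<sigma>\<bar> = 1 \<Longrightarrow> lc i b (a + \<sigma> * h) s - lc i b a s \<le> h * C"
proof -
  obtain U where U: "0 \<le> U"
    "\<And>i b a s. i \<in> E \<Longrightarrow> b \<in> I i \<Longrightarrow> b \<le> r \<Longrightarrow> \<bar>a\<bar> \<le> M + 1 \<Longrightarrow> s \<in> {0..T} \<Longrightarrow> \<bar>lc i b a s\<bar> \<le> U"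
    by (rule edge_cost_bounded[of r "M + 1"]) (rule that, assumption+)
  show thesis
  proof (rule that[of "2 * U"])
    fix i and b a s h \<sigma> :: real
    assume i: "i \<in> E" and b: "b \<in> I i" "b \<le> r" and s: "s \<in> {0..T}" and a: "\<bar>a\<bar> \<le> M"
      and h: "0 \<le> h" "h \<le> 1" and \<sigma>: "\<bar>\<sigma>\<bar> = (1::real)"
    have "a + \<sigma> * h = (1 - h) * a + h * (a + \<sigma>)" by (simp add: algebra_simps)
    then have "lc i b (a + \<sigma> * h) s \<le> (1 - h) * lc i b a s + h * lc i b (a + \<sigma>) s"
      using edge_cost_convex[OF i b(1) s h] by metis
    then have 1: "lc i b (a + \<sigma> * h) s - lc i b a s \<le> h * (lc i b (a + \<sigma>) s - lc i b a s)"
      by (simp add: algebra_simps)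
    have "\<bar>a\<bar> \<le> M + 1" "\<bar>a + \<sigma>\<bar> \<le> M + 1" using a \<sigma> by linarith+
    from U(2)[OF i b this(1) s] U(2)[OF i b this(2) s]
    have "lc i b (a + \<sigma>) s - lc i b a s \<le> 2 * U" by linarith
    then have "h * (lc i b (a + \<sigma>) s - lc i b a s) \<le> h * (2 * U)" using h by (intro mult_left_mono)
    then show "lc i b (a + \<sigma> * h) s - lc i b a s \<le> h * (2 * U)" using 1 by linarith
  qed (use U in simp)
qed

text \<open>Convexity compares a small reduction of speed with the chord down to velocity 0, whose
  slope is at least of order A^(p-1) by coercivity.\<close>

lemma slope_down:
  obtains U where "0 \<le> U" "\<And>i b a s h \<sigma> A. i \<in> E \<Longrightarrow> b \<in> I i \<Longrightarrow> b \<le> r \<Longrightarrow> s \<in> {0..T} \<Longrightarrow> 1 \<le> A \<Longrightarrow>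
     A < \<sigma> * a \<Longrightarrow> 0 \<le> h \<Longrightarrow> h \<le> 1 \<Longrightarrow> \<bar>\<sigma>\<bar> = 1 \<Longrightarrow>
     lc i b (a - \<sigma> * h) s - lc i b a s \<le> - h * (C0 * A powr (p - 1) - U)"
proof -
  obtain U where U: "0 \<le> U"
    "\<And>i b a s. i \<in> E \<Longrightarrow> b \<in> I i \<Longrightarrow> b \<le> r \<Longrightarrow> \<bar>a\<bar> \<le> 0 \<Longrightarrow> s \<in> {0..T} \<Longrightarrow> \<bar>lc i b a s\<bar> \<le> U"
    by (rule edge_cost_bounded[of r 0]) (rule that, assumption+)
  show thesis
  proof (rule that[of "C0 + U"])
    show "0 \<le> C0 + U" using U C0_pos by simp
    fix i and b a s h \<sigma> A :: real
    assume i: "i \<in> E" and b: "b \<in> I i" "b \<le> r" and s: "s \<in> {0..T}" and A: "1 \<le> A" "A < \<sigma> * a"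
      and h: "0 \<le> h" "h \<le> 1" and \<sigma>: "\<bar>\<sigma>\<bar> = (1::real)"
    have \<sigma>a: "\<sigma> * a = \<bar>a\<bar>" "\<sigma> * \<bar>a\<bar> = a" using \<sigma> A by (auto simp: abs_if split: if_splits)
    then have a: "A < \<bar>a\<bar>" "0 < \<bar>a\<bar>" using A by auto
    \<comment> \<open>The fraction of the way from \<open>a\<close> to 0 covered by the reduction; u
      \<le> h because the speed exceeds 1.\<close>
    define u where "u = h / \<bar>a\<bar>"
    have u: "0 \<le> u" "u \<le> 1" using h a A by (auto simp: u_def)
    have ua: "u * \<bar>a\<bar> = h" using a by (simp add: u_def)
    have "u * a = \<sigma> * h" using ua \<sigma>a(2) by (metis mult.left_commute)
    then have "a - \<sigma> * h = (1 - u) * a + u * 0" by (simp add: algebra_simps)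
    then have "lc i b (a - \<sigma> * h) s \<le> (1 - u) * lc i b a s + u * lc i b 0 s"
      using edge_cost_convex[OF i b(1) s u] by metis
    then have 1: "lc i b (a - \<sigma> * h) s - lc i b a s \<le> - (u * (lc i b a s - lc i b 0 s))"
      by (simp add: algebra_simps)
    have "lc i b a s - lc i b 0 s \<ge> C0 * (\<bar>a\<bar> powr p - 1) - U"
      using edge_cost_ge[OF i b(1) s, of a] U(2)[OF i b, of 0 s] s by simp
    then have "u * (lc i b a s - lc i b 0 s) \<ge> u * (C0 * (\<bar>a\<bar> powr p - 1) - U)"
      using u by (intro mult_left_mono)
    also have "u * (C0 * (\<bar>a\<bar> powr p - 1) - U) = C0 * (u * \<bar>a\<bar> powr p) - u * (C0 + U)"
      by (simp add: algebra_simps)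
    also have "u * \<bar>a\<bar> powr p = h * \<bar>a\<bar> powr (p - 1)"
      using ua powr_mult_self[of "\<bar>a\<bar>"] by (metis abs_ge_zero mult.assoc)
    finally have 2: "C0 * (h * \<bar>a\<bar> powr (p - 1)) - u * (C0 + U) \<le> u * (lc i b a s - lc i b 0 s)" .
    have 3: "C0 * (h * A powr (p - 1)) \<le> C0 * (h * \<bar>a\<bar> powr (p - 1))"
      using C0_pos h a A p_gt_1 by (intro mult_left_mono powr_mono2) auto
    have "u \<le> h" using ua a A h mult_left_mono[of 1 "\<bar>a\<bar>" u] u by auto
    then have 4: "u * (C0 + U) \<le> h * (C0 + U)" using U C0_pos by (intro mult_right_mono) auto
    have "C0 * (h * A powr (p - 1)) - h * (C0 + U) \<le> u * (lc i b a s - lc i b 0 s)"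
      using 2 3 4 by linarith
    then show "lc i b (a - \<sigma> * h) s - lc i b a s \<le> - h * (C0 * A powr (p - 1) - (C0 + U))"
      using 1 by (simp add: algebra_simps)
  qed
qed

end

section \<open>Transfer of speed from a fast set to a slow set\<close>

section \<open>Exchanging speed inside an edge\<close>

lemma powr_add_one_le:
  assumes "0 \<le> (x::real)" "0 \<le> p"
  shows "(x + 1) powr p \<le> 2 powr p * (x powr p + 1)"
proof -
  have "(x + 1) powr p \<le> (2 * max x 1) powr p" using assms by (intro powr_mono2) auto
  also have "\<dots> = 2 powr p * max x 1 powr p" using assms by (simp add: powr_mult)
  also have "max x 1 powr p \<le> x powr p + 1" by (simp add: max_def)
  finally show ?thesis by (simp add: mult_left_mono)
qed

text \<open>The normalized distribution function of F. The difference of two such functions vanishes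
  at both ends and is bounded by 1 however small the sets are, which makes it a suitable
  perturbation of a curve with fixed end points.\<close>

lemma normalized_indicator_primitive:
  assumes "F \<in> lmeasurable" "F \<subseteq> {a..b::real}" "0 < measure lebesgue F"
  defines "m \<equiv> measure lebesgue F"
  defines "\<phi> \<equiv> \<lambda>s. measure lebesgue ({a..s} \<inter> F) / m"
  shows "primitive_on a b \<phi> (\<lambda>s. indicator F s / m)" "\<And>s. 0 \<le> \<phi> s" "\<And>s. \<phi> s \<le> 1" "\<phi> b = 1"
    "\<phi> a = 0"
proof -
  have sl: "F \<in> sets lebesgue" using assms(1) by (simp add: fmeasurable_def)
  have meas: "({a..s} \<inter> F) \<in> lmeasurable" for s
    by (rule fmeasurable_Int_fmeasurable) (use sl in auto)
  have int: "((indicator F :: real \<Rightarrow> real) has_integral measure lebesgue ({a..s} \<inter> F)) {a..s}" for s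
    using integral_indicator[of F "{a..s}"] integrable_on_indicator[of F "{a..s}"] meas[of s]
    by (simp add: has_integral_iff Int_commute)
  have "negligible ({a..a} \<inter> F)" by (rule negligible_subset[OF negligible_sing[of a]]) auto
  then show a0: "\<phi> a = 0" unfolding \<phi>_def by (simp only: negligible_imp_measure0 div_0)
  show "primitive_on a b \<phi> (\<lambda>s. indicator F s / m)"
  proof (rule primitive_onI)
    show "(\<lambda>s. indicator F s / m) absolutely_integrable_on {a..b}"
    proof (rule nonnegative_absolutely_integrable_1)
      show "(\<lambda>s. indicator F s / m) integrable_on {a..b}"
        using has_integral_divide[OF int[of b], of m] by blast
    qed (simp add: m_def)
    show "((\<lambda>s. indicator F s / m) has_integral (\<phi> s - \<phi> a)) {a..s}" for s
      unfolding a0 using has_integral_divide[OF int[of s], of m] by (simp add: \<phi>_def)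
  qed
  show "0 \<le> \<phi> s" for s by (simp add: \<phi>_def m_def)
  have "measure lebesgue ({a..s} \<inter> F) \<le> m" for s
    unfolding m_def by (rule measure_mono_fmeasurable[OF _ _ assms(1)]) (use meas in \<open>auto simp: fmeasurable_def\<close>)
  then show "\<phi> s \<le> 1" for s using assms(3) by (simp add: \<phi>_def m_def)
  have "{a..b} \<inter> F = F" using assms(2) by auto
  then show "\<phi> b = 1" using assms(3) by (simp add: \<phi>_def m_def)
qed

context control_problem
begin

text \<open>The competitor \<open>y + \<epsilon> \<phi>\<close> with
  \<open>\<phi>' = \<sigma> (indicator E1 / measure E1 - indicator E2 / measure E2)\<close> moves speed from the fast set
  \<open>E2\<close> to the slow set \<open>E1\<close>. Convexity in the velocity bounds the two resulting increments, so no
  differentiation under the integral is needed.\<close>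

lemma speed_exchange:
  assumes bo: "bounded_optimal t r E0 y v" and t: "0 \<le> t" "t \<le> a" "a < b" "b \<le> T"
    and i: "i \<in> E" and yi: "\<And>s. a \<le> s \<Longrightarrow> s \<le> b \<Longrightarrow> y s \<in> J i \<and> y s \<notin> Vt"
    and E1: "E1 \<in> lmeasurable" "E1 \<subseteq> {a..b}" "0 < measure lebesgue E1"
    and E2: "E2 \<in> lmeasurable" "E2 \<subseteq> {a..b}" "0 < measure lebesgue E2"
    and slow: "\<And>s. s \<in> E1 \<Longrightarrow> norm (v s) \<le> M" and fast: "\<And>s. s \<in> E2 \<Longrightarrow> A < \<sigma> * (v s \<bullet> e i)"
    and A: "1 \<le> A" "M \<le> A" and \<sigma>: "\<bar>\<sigma>\<bar> = 1"
    and CY: "0 \<le> CY" "\<And>b b' a s. b \<in> I i \<Longrightarrow> b \<le> r + 1 \<Longrightarrow> b' \<in> I i \<Longrightarrow> b' \<le> r + 1 \<Longrightarrow> s \<in> {0..T} \<Longrightarrow>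
       \<bar>lc i b a s - lc i b' a s\<bar> \<le> CY * (\<bar>a\<bar> powr p + 1) * \<bar>b - b'\<bar>"
    and CM: "\<And>b a s h \<sigma>. b \<in> I i \<Longrightarrow> b \<le> r \<Longrightarrow> s \<in> {0..T} \<Longrightarrow> \<bar>a\<bar> \<le> M \<Longrightarrow>
     0 \<le> h \<Longrightarrow> h \<le> 1 \<Longrightarrow> \<bar>\<sigma>\<bar> = 1 \<Longrightarrow> lc i b (a + \<sigma> * h) s - lc i b a s \<le> h * CM"
    and \<Lambda>: "\<And>b a s h \<sigma>. b \<in> I i \<Longrightarrow> b \<le> r \<Longrightarrow> s \<in> {0..T} \<Longrightarrow> A < \<sigma> * a \<Longrightarrow> 0 \<le> h \<Longrightarrow> h \<le> 1 \<Longrightarrow> \<bar>\<sigma>\<bar> = 1 \<Longrightarrow>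
     lc i b (a - \<sigma> * h) s - lc i b a s \<le> - h * \<Lambda>"
  shows "\<Lambda> \<le> CY * (2 powr p * (E0 + T) + T) + CM"
proof -
  define m1 where "m1 = measure lebesgue E1"
  define m2 where "m2 = measure lebesgue E2"
  have m: "0 < m1" "0 < m2" using E1 E2 by (auto simp: m1_def m2_def)
  define \<phi>1 where "\<phi>1 s = measure lebesgue ({a..s} \<inter> E1) / m1" for s
  define \<phi>2 where "\<phi>2 s = measure lebesgue ({a..s} \<inter> E2) / m2" for s
  note p1 = normalized_indicator_primitive[OF E1, folded m1_def, folded \<phi>1_def]
  note p2 = normalized_indicator_primitive[OF E2, folded m2_def, folded \<phi>2_def]
  define \<phi> where "\<phi> s = \<sigma> * (\<phi>1 s - \<phi>2 s)" for s
  define \<psi> where "\<psi> s = \<sigma> * (indicator E1 s / m1 - indicator E2 s / m2)" for s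
  have \<phi>_le: "\<bar>\<phi> s\<bar> \<le> 1" for s
  proof -
    have "\<bar>\<phi> s\<bar> = \<bar>\<phi>1 s - \<phi>2 s\<bar>" using \<sigma> by (simp add: \<phi>_def abs_mult)
    then show ?thesis using p1(2,3)[of s] p2(2,3)[of s] by linarith
  qed
  have \<phi>_ends: "\<phi> a = 0" "\<phi> b = 0" using p1(4,5) p2(4,5) by (auto simp: \<phi>_def)
  \<comment> \<open>Slow and fast sets are separated by M \<le> A; without overlap only one of the
    two normalized indicators acts at a time.\<close>
  have disj: "s \<notin> E2" if "s \<in> E1" for s
  proof
    assume "s \<in> E2"
    have "s \<in> {a..b}" using that E1 by auto
    then have "s \<in> {t..T}" using t by auto
    then have "\<bar>v s \<bullet> e i\<bar> = norm (v s)"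
      using tangential_norm[OF bounded_optimalD(3)[OF bo] _ i] yi \<open>s \<in> {a..b}\<close> by auto
    moreover have "\<sigma> * (v s \<bullet> e i) \<le> \<bar>v s \<bullet> e i\<bar>" using \<sigma> by (metis abs_ge_self abs_mult mult_1)
    ultimately show False using slow[OF that] fast[OF \<open>s \<in> E2\<close>] A by linarith
  qed
  note tr = traj_subinterval[OF bounded_optimalD(2)[OF bo] t(2) less_imp_le[OF t(3)] t(4)]
  have tan: "tangential a b y v" by (rule tangential_subinterval[OF bounded_optimalD(3)[OF bo] t(2,4)])
  have "compact (y ` {a..b})" by (intro compact_continuous_image trajD(4)[OF tr]) simp
  moreover have "y ` {a..b} \<inter> Vt = {}" using yi by auto
  ultimately obtain \<eta> where \<eta>: "0 < \<eta>" "\<And>x v. x \<in> y ` {a..b} \<Longrightarrow> v \<in> Vt \<Longrightarrow> \<eta> \<le> dist x v"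
    using separate_compact_closed[OF _ finite_imp_closed[OF finite_vertices]] by metis
  \<comment> \<open>Being below \<open>\<eta>\<close> keeps the competitor off the vertices and in
    the same edge; at most 1 keeps its coordinates below \<open>r + 1\<close>; at most
    \<open>m1\<close> and \<open>m2\<close> keeps the change of velocity within the range of the
    slope bounds.\<close>
  define \<epsilon> where "\<epsilon> = min (min (\<eta> / 2) 1) (min m1 m2)"
  have \<epsilon>: "0 < \<epsilon>" "\<epsilon> < \<eta>" "\<epsilon> \<le> 1" "\<epsilon> \<le> m1" "\<epsilon> \<le> m2" using \<eta>(1) m by (auto simp: \<epsilon>_def)
  then have \<epsilon>m: "\<epsilon> / m1 \<le> 1" "\<epsilon> / m2 \<le> 1" "0 \<le> \<epsilon> / m1" "0 \<le> \<epsilon> / m2" using m by auto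
  define q where "q s = y s + (\<epsilon> * \<phi> s) *\<^sub>R e i" for s
  define w where "w s = v s + (\<epsilon> * \<psi> s) *\<^sub>R e i" for s
  have shift: "\<bar>\<epsilon> * \<phi> s\<bar> \<le> \<epsilon>" for s
    using \<phi>_le[of s] \<epsilon>(1) mult_left_mono[of "\<bar>\<phi> s\<bar>" 1 \<epsilon>] by (simp add: abs_mult)
  have \<psi>_le: "\<bar>\<epsilon> * \<psi> s\<bar> \<le> 1" for s
    using disj[of s] \<epsilon>m \<sigma> \<epsilon>(1) m by (auto simp: \<psi>_def indicator_def abs_mult)
  have q_edge: "co i (y s) \<in> I i \<and> q s = pt i (co i (y s) + \<epsilon> * \<phi> s) \<and> co i (y s) + \<epsilon> * \<phi> s \<in> I i \<and> q s \<notin> Vt"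
    if s: "a \<le> s" "s \<le> b" for s
  proof -
    have u: "co i (y s) \<in> I i" "y s = pt i (co i (y s))" using edge_setD[OF i] yi[OF s] by auto
    have eq: "q s = pt i (co i (y s) + \<epsilon> * \<phi> s)"
      unfolding q_def by (subst u(2)) (simp add: pt_def algebra_simps)
    have sep: "\<eta> \<le> dist (y s) z" if "z \<in> Vt" for z using \<eta>(2)[OF _ that] s by auto
    have "co i (y s) + \<epsilon> * \<phi> s \<in> I i"
    proof (rule ccontr)
      assume "co i (y s) + \<epsilon> * \<phi> s \<notin> I i"
      from domain_exit[OF i u(1) this] obtain z where "z \<in> Vt" "dist (y s) z \<le> \<bar>\<epsilon> * \<phi> s\<bar>"
        using u(2) by auto
      then show False using sep[of z] shift[of s] \<epsilon>(2) by linarith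
    qed
    moreover have "dist (y s) (q s) \<le> \<epsilon>" using shift[of s] norm_dir[OF i] by (simp add: q_def dist_norm)
    then have "q s \<notin> Vt" using sep[of "q s"] \<epsilon>(2) by force
    ultimately show ?thesis using u(1) eq by blast
  qed
  have prim_\<phi>: "primitive_on a b \<phi> \<psi>"
    unfolding \<phi>_def[abs_def] \<psi>_def[abs_def]
  proof (rule primitive_onI)
    show "(\<lambda>s. \<sigma> * (indicator E1 s / m1 - indicator E2 s / m2)) absolutely_integrable_on {a..b}"
      using set_integral_diff(1)[OF primitive_onD(1)[OF p1(1)] primitive_onD(1)[OF p2(1)]]
      by (intro set_integrable_mult_right) auto
    fix s assume s: "a \<le> s" "s \<le> b"
    have "((\<lambda>s. \<sigma> * (indicator E1 s / m1 - indicator E2 s / m2)) has_integral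
        \<sigma> * ((\<phi>1 s - \<phi>1 a) - (\<phi>2 s - \<phi>2 a))) {a..s}"
      by (intro has_integral_mult_right has_integral_diff primitive_onD(3)[OF p1(1) s] primitive_onD(3)[OF p2(1) s])
    then show "((\<lambda>s. \<sigma> * (indicator E1 s / m1 - indicator E2 s / m2)) has_integral
        (\<sigma> * (\<phi>1 s - \<phi>2 s) - \<sigma> * (\<phi>1 a - \<phi>2 a))) {a..s}"
      by (simp add: algebra_simps)
  qed
  have prim: "primitive_on a b q w"
  proof (rule primitive_onI)
    have "(\<lambda>s. \<epsilon> * \<psi> s) absolutely_integrable_on {a..b}"
      using primitive_onD(1)[OF prim_\<phi>] by (intro set_integrable_mult_right) auto
    then have "(\<lambda>s. (\<epsilon> * \<psi> s) *\<^sub>R e i) absolutely_integrable_on {a..b}"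
      by (rule absolutely_integrable_scaleR_right)
    then show "w absolutely_integrable_on {a..b}"
      unfolding w_def[abs_def] by (intro set_integral_add(1) primitive_onD(1)[OF trajD(1)[OF tr]])
    fix s assume s: "a \<le> s" "s \<le> b"
    have "(w has_integral ((y s - y a) + (\<epsilon> * (\<phi> s - \<phi> a)) *\<^sub>R e i)) {a..s}"
      unfolding w_def[abs_def]
      by (intro has_integral_add has_integral_scaleR_left has_integral_mult_right
            primitive_onD(3)[OF trajD(1)[OF tr] s] primitive_onD(3)[OF prim_\<phi> s])
    then show "(w has_integral (q s - q a)) {a..s}" by (simp add: q_def algebra_simps)
  qed
  have w_norm: "norm (w s) \<le> norm (v s) + 1" for s
    using norm_triangle_ineq[of "v s" "(\<epsilon> * \<psi> s) *\<^sub>R e i"] \<psi>_le[of s] norm_dir[OF i] by (simp add: w_def)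
  have w_powr: "norm (w s) powr p \<le> 2 powr p * (norm (v s) powr p + 1)" for s
  proof -
    have "norm (w s) powr p \<le> (norm (v s) + 1) powr p" using w_norm[of s] p_gt_1 by (intro powr_mono2) auto
    also have "\<dots> \<le> 2 powr p * (norm (v s) powr p + 1)" using p_gt_1 by (intro powr_add_one_le) auto
    finally show ?thesis .
  qed
  have vp1: "(\<lambda>s. 2 powr p * (norm (v s) powr p + 1)) integrable_on {a..b}"
    by (intro integrable_on_mult_right integrable_add trajD(2)[OF tr] integrable_const_ivl)
  have trq: "traj a b q w"
    unfolding traj_def
  proof (intro conjI prim)
    have "(\<lambda>s. norm (w s) powr p) \<in> borel_measurable (lebesgue_on {a..b})"
      using primitive_on_measurable(1)[OF prim] by measurable
    then show "(\<lambda>s. norm (w s) powr p) integrable_on {a..b}"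
      by (rule measurable_bounded_by_integrable_imp_integrable_real[OF _ vp1]) (use w_powr in auto)
    show "q ` {a..b} \<subseteq> network_set G"
      using q_edge pt_in_edge[OF i] edge_subset_network[OF i] by fastforce
  qed
  \<comment> \<open>Three contributions: the shift in position, the loss on the slow set, the gain
    on the fast set. The normalized indicators integrate to 1, so the integral is proportional to
    \<open>\<epsilon>\<close>, and optimality makes it nonnegative.\<close>
  define H where "H s = \<epsilon> * CY * (2 powr p * (norm (v s) powr p + 1) + 1)
      + \<epsilon> * CM * (indicator E1 s / m1) - \<epsilon> * \<Lambda> * (indicator E2 s / m2)" for s
  have pointwise: "L (q s) (w s) s - L (y s) (v s) s \<le> H s" if s: "s \<in> {a..b}" for s
  proof -
    let ?u = "co i (y s)" and ?a = "v s \<bullet> e i"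
    have qe: "?u \<in> I i" "q s = pt i (?u + \<epsilon> * \<phi> s)" "?u + \<epsilon> * \<phi> s \<in> I i" "q s \<notin> Vt"
      using q_edge[of s] s unfolding atLeastAtMost_iff by blast+
    have sT: "s \<in> {0..T}" using s t by auto
    have ye: "y s \<in> J i" "y s \<notin> Vt" using yi s by auto
    have ur: "?u \<le> r" using bounded_optimalD(4)[OF bo _ _ i ye(1)] s t by auto
    have qJ: "q s \<in> J i" using qe pt_in_edge[OF i] by simp
    have Ly: "L (y s) (v s) s = lc i ?u ?a s" by (rule running_cost_edge[OF i ye])
    have "w s \<bullet> e i = ?a + \<epsilon> * \<psi> s" by (simp add: w_def inner_add_left dir_inner[OF i])
    then have Lq: "L (q s) (w s) s = lc i (?u + \<epsilon> * \<phi> s) (?a + \<epsilon> * \<psi> s) s"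
      using running_cost_edge[OF i qJ qe(4), of D "w s" s] qe(2) i by simp
    have av: "\<bar>?a\<bar> = norm (v s)" by (rule tangential_norm[OF tan s i ye])
    have "\<bar>?a + \<epsilon> * \<psi> s\<bar> \<le> norm (v s) + 1" using av \<psi>_le[of s] by linarith
    then have "\<bar>?a + \<epsilon> * \<psi> s\<bar> powr p \<le> (norm (v s) + 1) powr p" using p_gt_1 by (intro powr_mono2) auto
    also have "\<dots> \<le> 2 powr p * (norm (v s) powr p + 1)" using p_gt_1 by (intro powr_add_one_le) auto
    finally have ap: "\<bar>?a + \<epsilon> * \<psi> s\<bar> powr p \<le> 2 powr p * (norm (v s) powr p + 1)" .
    have "\<epsilon> * \<phi> s \<le> 1" using shift[of s] \<epsilon>(3) by linarith
    then have "\<bar>lc i (?u + \<epsilon> * \<phi> s) (?a + \<epsilon> * \<psi> s) s - lc i ?u (?a + \<epsilon> * \<psi> s) s\<bar>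
        \<le> CY * (\<bar>?a + \<epsilon> * \<psi> s\<bar> powr p + 1) * \<bar>\<epsilon> * \<phi> s\<bar>"
      using CY(2)[OF qe(3) _ qe(1) _ sT] ur by simp
    also have "\<dots> \<le> CY * (2 powr p * (norm (v s) powr p + 1) + 1) * \<epsilon>"
      using CY(1) ap shift[of s] by (intro mult_mono mult_left_mono add_right_mono) auto
    finally have d1: "lc i (?u + \<epsilon> * \<phi> s) (?a + \<epsilon> * \<psi> s) s - lc i ?u (?a + \<epsilon> * \<psi> s) s
        \<le> \<epsilon> * CY * (2 powr p * (norm (v s) powr p + 1) + 1)" by (simp add: mult_ac)
    have d2: "lc i ?u (?a + \<epsilon> * \<psi> s) s - lc i ?u ?a s
        \<le> \<epsilon> * CM * (indicator E1 s / m1) - \<epsilon> * \<Lambda> * (indicator E2 s / m2)"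
    proof (cases "s \<in> E1")
      case True
      then have "\<epsilon> * \<psi> s = \<sigma> * (\<epsilon> / m1)" using disj by (simp add: \<psi>_def)
      then have "lc i ?u (?a + \<epsilon> * \<psi> s) s - lc i ?u ?a s \<le> (\<epsilon> / m1) * CM"
        using CM[OF qe(1) ur sT _ \<epsilon>m(3,1) \<sigma>, of ?a] slow[OF True] av by simp
      then show ?thesis using True disj by simp
    next
      case False
      show ?thesis
      proof (cases "s \<in> E2")
        case True
        then have "?a + \<epsilon> * \<psi> s = ?a - \<sigma> * (\<epsilon> / m2)" using False by (simp add: \<psi>_def)
        then have "lc i ?u (?a + \<epsilon> * \<psi> s) s - lc i ?u ?a s \<le> - (\<epsilon> / m2) * \<Lambda>"
          using \<Lambda>[OF qe(1) ur sT fast[OF True] \<epsilon>m(4,2) \<sigma>] by simp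
        then show ?thesis using True False by simp
      next
        case False2: False
        then show ?thesis using False by (simp add: \<psi>_def)
      qed
    qed
    show ?thesis unfolding Ly Lq H_def using d1 d2 by linarith
  qed
  have i1: "((\<lambda>s. indicator E1 s / m1) has_integral 1) {a..b}"
    using primitive_onD(3)[OF p1(1) less_imp_le[OF t(3)] order_refl] p1(4,5) by simp
  have i2: "((\<lambda>s. indicator E2 s / m2) has_integral 1) {a..b}"
    using primitive_onD(3)[OF p2(1) less_imp_le[OF t(3)] order_refl] p2(4,5) by simp
  let ?e = "integral {a..b} (\<lambda>s. norm (v s) powr p)"
  have "(H has_integral (\<epsilon> * CY * (2 powr p * (?e + (b - a)) + (b - a)) + \<epsilon> * CM * 1 - \<epsilon> * \<Lambda> * 1)) {a..b}"
    unfolding H_def[abs_def]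
    by (intro has_integral_diff has_integral_add has_integral_mult_right i1 i2 integrable_integral trajD(2)[OF tr])
       (use t(3) has_integral_const_real[of "1::real" a b] in auto)
  note H = this
  have "0 \<le> cost a b q w - cost a b y v"
    using optimal_segment[OF bounded_optimalD(1)[OF bo] t trq] \<phi>_ends by (simp add: q_def)
  also have "\<dots> = integral {a..b} (\<lambda>s. L (q s) (w s) s - L (y s) (v s) s)"
    unfolding cost_def
    by (rule Henstock_Kurzweil_Integration.integral_diff[symmetric];
        rule traj_cost_integrable_on[OF _ order_trans[OF t(1,2)] t(4)]; rule trq tr)
  also have "\<dots> \<le> integral {a..b} H"
    by (rule integral_le) (use H pointwise traj_cost_integrable_on[OF trq order_trans[OF t(1,2)] t(4)]
       traj_cost_integrable_on[OF tr order_trans[OF t(1,2)] t(4)] in \<open>auto intro: integrable_diff\<close>)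
  also have "\<dots> = \<epsilon> * (CY * (2 powr p * (?e + (b - a)) + (b - a)) + CM - \<Lambda>)"
    using integral_unique[OF H] by (simp add: algebra_simps)
  finally have "\<Lambda> \<le> CY * (2 powr p * (?e + (b - a)) + (b - a)) + CM"
    using \<epsilon>(1) by (simp add: zero_le_mult_iff)
  also have "\<dots> \<le> CY * (2 powr p * (E0 + T) + T) + CM"
  proof -
    have "?e \<le> E0" by (rule bounded_optimal_energy[OF bo t(2) less_imp_le[OF t(3)] t(4)])
    then show ?thesis using t CY(1)
      by (intro add_right_mono mult_left_mono add_mono) auto
  qed
  finally show ?thesis .
qed

lemma powr_level:
  obtains A where "1 \<le> A" "B \<le> A" "K \<le> A powr (p - 1)"
proof -
  define x where "x = max K 1"
  have x: "x \<ge> 1" "K \<le> x" by (auto simp: x_def)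
  have "(x powr (1 / (p - 1))) powr (p - 1) = x" using x p_gt_1 by (simp add: powr_powr)
  then have "K \<le> (max (max 1 B) (x powr (1 / (p - 1)))) powr (p - 1)"
    using x p_gt_1 powr_mono2[of "p - 1" "x powr (1 / (p - 1))" "max (max 1 B) (x powr (1 / (p - 1)))"] by simp
  then show thesis by (intro that[of "max (max 1 B) (x powr (1 / (p - 1)))"]) auto
qed

lemma speed_sets_measurable:
  assumes tr: "traj a b y v" and cd: "a \<le> c" "d \<le> b" and i: "P = (\<lambda>z. norm z \<le> M) \<or> P = (\<lambda>z. A < \<sigma> * (z \<bullet> e i))"
    and nn: "\<not> negligible {s \<in> {c..d}. P (v s)}"
  shows "{s \<in> {c..d}. P (v s)} \<in> lmeasurable" "0 < measure lebesgue {s \<in> {c..d}. P (v s)}"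
proof -
  let ?S = "{s \<in> {c..d}. P (v s)}"
  have cd': "c \<le> d" using nn by (metis (no_types, lifting) Collect_empty_eq atLeastAtMost_iff negligible_empty order_trans)
  have vm: "v \<in> borel_measurable (lebesgue_on {c..d})"
    by (rule primitive_on_measurable[OF trajD(1)[OF traj_subinterval[OF tr cd(1) cd' cd(2)]]])
  have "{s \<in> space (lebesgue_on {c..d}). P (v s)} \<in> sets (lebesgue_on {c..d})"
    using i
  proof
    assume P: "P = (\<lambda>z. norm z \<le> M)"
    have "(\<lambda>s. norm (v s)) \<in> borel_measurable (lebesgue_on {c..d})" using vm by measurable
    then show ?thesis unfolding P by (intro borel_measurable_le) auto
  next
    assume P: "P = (\<lambda>z. A < \<sigma> * (z \<bullet> e i))"
    have "(\<lambda>s. \<sigma> * (v s \<bullet> e i)) \<in> borel_measurable (lebesgue_on {c..d})"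
      using vm by measurable
    then show ?thesis unfolding P by (intro borel_measurable_less) auto
  qed
  then have "?S \<in> sets lebesgue" by (simp add: sets_restrict_space_iff)
  then show l: "?S \<in> lmeasurable" by (rule bounded_set_imp_lmeasurable[rotated]) (auto intro: bounded_subset[of "{c..d}"])
  show "0 < measure lebesgue ?S"
    using negligible_iff_measure0[OF l] nn measure_nonneg[of lebesgue ?S] by linarith
qed

lemma fast_negligible:
  obtains A where "0 < A" "\<And>t y v a b. bounded_optimal t r E0 y v \<Longrightarrow> 0 \<le> t \<Longrightarrow> t \<le> a \<Longrightarrow> a < b \<Longrightarrow> b \<le> T \<Longrightarrow>
     (\<forall>s\<in>{a<..<b}. y s \<notin> Vt) \<Longrightarrow> \<not> negligible {s \<in> {a<..<b}. norm (v s) \<le> M} \<Longrightarrow>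
     negligible {s \<in> {a<..<b}. A < norm (v s)}"
proof -
  obtain CY where CY: "0 \<le> CY"
    "\<And>i b b' a s. i \<in> E \<Longrightarrow> b \<in> I i \<Longrightarrow> b \<le> r + 1 \<Longrightarrow> b' \<in> I i \<Longrightarrow> b' \<le> r + 1 \<Longrightarrow> s \<in> {0..T} \<Longrightarrow>
       \<bar>lc i b a s - lc i b' a s\<bar> \<le> CY * (\<bar>a\<bar> powr p + 1) * \<bar>b - b'\<bar>"
    by (rule edge_cost_lipschitz_y[of "r + 1"]) (rule that, assumption+)
  obtain CM where CM: "0 \<le> CM" "\<And>i b a s h \<sigma>. i \<in> E \<Longrightarrow> b \<in> I i \<Longrightarrow> b \<le> r \<Longrightarrow> s \<in> {0..T} \<Longrightarrow> \<bar>a\<bar> \<le> M \<Longrightarrow>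
     0 \<le> h \<Longrightarrow> h \<le> 1 \<Longrightarrow> \<bar>\<sigma>\<bar> = 1 \<Longrightarrow> lc i b (a + \<sigma> * h) s - lc i b a s \<le> h * CM"
    by (rule slope_up[of r M]) (rule that, assumption+)
  obtain U where U: "0 \<le> U" "\<And>i b a s h \<sigma> A. i \<in> E \<Longrightarrow> b \<in> I i \<Longrightarrow> b \<le> r \<Longrightarrow> s \<in> {0..T} \<Longrightarrow> 1 \<le> A \<Longrightarrow>
     A < \<sigma> * a \<Longrightarrow> 0 \<le> h \<Longrightarrow> h \<le> 1 \<Longrightarrow> \<bar>\<sigma>\<bar> = 1 \<Longrightarrow>
     lc i b (a - \<sigma> * h) s - lc i b a s \<le> - h * (C0 * A powr (p - 1) - U)"
    by (rule slope_down[of r]) (rule that, assumption+)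
  \<comment> \<open>The right-hand side of \<open>speed_exchange\<close>. \<open>A\<close> is then
    chosen so large that the slope on the fast set exceeds it.\<close>
  define B where "B = CY * (2 powr p * (E0 + T) + T) + CM"
  obtain A where A: "1 \<le> A" "M \<le> A" "(B + U + 1) / C0 \<le> A powr (p - 1)"
    by (rule powr_level)
  have large: "B < C0 * A powr (p - 1) - U"
    using A(3) C0_pos by (simp add: pos_divide_le_eq mult.commute)
  show thesis
  proof (rule that[of A], rule_tac [2] ccontr)
    show "0 < A" using A by simp
    fix t y v a b
    assume bo: "bounded_optimal t r E0 y v" and t: "0 \<le> t" "t \<le> a" "a < b" "b \<le> T"
      and nv: "\<forall>s\<in>{a<..<b}. y s \<notin> Vt" and slow: "\<not> negligible {s \<in> {a<..<b}. norm (v s) \<le> M}"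
      and fast: "\<not> negligible {s \<in> {a<..<b}. A < norm (v s)}"
    note tr = bounded_optimalD(2)[OF bo]
    obtain i where i: "i \<in> E" "\<And>s. a \<le> s \<Longrightarrow> s \<le> b \<Longrightarrow> y s \<in> J i"
      by (rule interior_path_edge[OF traj_subinterval[OF tr t(2) less_imp_le[OF t(3)] t(4)] t(3) nv])
         (rule that, assumption+)
    \<comment> \<open>The exchange needs fast motion in a single direction along the edge; one of
      the two signs occurs on a non-null set.\<close>
    have "\<exists>\<sigma>. \<bar>\<sigma>\<bar> = 1 \<and> \<not> negligible {s \<in> {a<..<b}. A < \<sigma> * (v s \<bullet> e i)}"
    proof (rule ccontr)
      assume "\<not> ?thesis"
      then have "negligible {s \<in> {a<..<b}. A < 1 * (v s \<bullet> e i)}" "negligible {s \<in> {a<..<b}. A < -1 * (v s \<bullet> e i)}"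
        by (metis abs_one, metis abs_minus_cancel abs_one)
      then have "negligible ({s \<in> {a<..<b}. A < 1 * (v s \<bullet> e i)} \<union> {s \<in> {a<..<b}. A < -1 * (v s \<bullet> e i)})"
        by (rule negligible_Un)
      moreover have "{s \<in> {a<..<b}. A < norm (v s)}
        \<subseteq> {s \<in> {a<..<b}. A < 1 * (v s \<bullet> e i)} \<union> {s \<in> {a<..<b}. A < -1 * (v s \<bullet> e i)}"
      proof
        fix s assume s: "s \<in> {s \<in> {a<..<b}. A < norm (v s)}"
        then have "y s \<in> J i" "y s \<notin> Vt" "s \<in> {t..T}" using i(2) nv t by auto
        then have "\<bar>v s \<bullet> e i\<bar> = norm (v s)"
          using tangential_norm[OF bounded_optimalD(3)[OF bo] _ i(1)] by blast
        then show "s \<in> {s \<in> {a<..<b}. A < 1 * (v s \<bullet> e i)} \<union> {s \<in> {a<..<b}. A < -1 * (v s \<bullet> e i)}"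
          using s by auto
      qed
      ultimately show False using fast negligible_subset by blast
    qed
    then obtain \<sigma> where \<sigma>: "\<bar>\<sigma>\<bar> = 1" "\<not> negligible {s \<in> {a<..<b}. A < \<sigma> * (v s \<bullet> e i)}" by blast
    obtain c1 d1 where 1: "a < c1" "c1 < d1" "d1 < b" "\<not> negligible {s \<in> {c1..d1}. norm (v s) \<le> M}"
      by (rule nonnegligible_compact_subinterval[OF slow])
    obtain c2 d2 where 2: "a < c2" "c2 < d2" "d2 < b" "\<not> negligible {s \<in> {c2..d2}. A < \<sigma> * (v s \<bullet> e i)}"
      by (rule nonnegligible_compact_subinterval[OF \<sigma>(2)])
    \<comment> \<open>The hull of the two compact intervals is still compact in the open interval,
      so the curve has positive distance from the vertices on it.\<close>
    let ?c = "min c1 c2" and ?d = "max d1 d2"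
    have "t \<le> c1" "d1 \<le> T" "t \<le> c2" "d2 \<le> T" using 1 2 t by auto
    note m1 = speed_sets_measurable[OF tr this(1,2), of "\<lambda>z. norm z \<le> M", OF _ 1(4), simplified]
      and m2 = speed_sets_measurable[OF tr this(3,4), of "\<lambda>z. A < \<sigma> * (z \<bullet> e i)", OF disjI2[OF refl] 2(4)]
    have "C0 * A powr (p - 1) - U \<le> CY * (2 powr p * (E0 + T) + T) + CM"
    proof (rule speed_exchange[OF bo t(1) _ _ _ i(1) _ m1(1) _ m1(2) m2(1) _ m2(2) _ _ A(1,2) \<sigma>(1)
          CY(1) CY(2)[OF i(1)] CM(2)[OF i(1)] U(2)[OF i(1) _ _ _ A(1)]])
      show "t \<le> ?c" "?c < ?d" "?d \<le> T" using 1 2 t by auto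
      show "y s \<in> J i \<and> y s \<notin> Vt" if "?c \<le> s" "s \<le> ?d" for s
      proof -
        have "a < s" "s < b" using that 1 2 by auto
        then show ?thesis using i(2)[of s] nv by simp
      qed
    qed auto
    then show False using large unfolding B_def by linarith
  qed
qed

end

section \<open>Existence of slow sets and assembly of the speed bound\<close>

section \<open>Slow sets and the speed bound\<close>

context control_problem
begin

lemma vertex_path_cost:
  obtains C where "0 \<le> C" "\<And>a b z. z \<in> Vt \<Longrightarrow> 0 \<le> a \<Longrightarrow> a \<le> b \<Longrightarrow> b \<le> T \<Longrightarrow>
    cost a b (\<lambda>_. z) (\<lambda>_. 0) \<le> C * (b - a)"
proof -
  \<comment> \<open>Both parameters can be 0, since the constraint is void at a vertex.\<close>
  obtain C where C: "0 \<le> C" "\<And>y \<alpha> s. y \<in> network_set G \<Longrightarrow> s \<in> {0..T} \<Longrightarrow>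
       (\<forall>i\<in>E. y \<in> J i \<longrightarrow> y \<notin> Vt \<longrightarrow> co i y \<le> 0 \<and> \<bar>\<alpha> \<bullet> e i\<bar> \<le> 0) \<Longrightarrow> L y \<alpha> s \<le> C"
    by (rule running_cost_bounded[of 0 0]) (rule that, assumption+)
  show thesis
  proof (rule that[OF C(1)])
    fix a b z assume z: "z \<in> Vt" and ab: "0 \<le> a" "a \<le> b" "b \<le> T"
    have net: "z \<in> network_set G" using z vertices_subset_network by blast
    show "cost a b (\<lambda>_. z) (\<lambda>_. 0) \<le> C * (b - a)"
      by (rule cost_le[OF const_traj[OF net] ab(1,3,2)]) (use C(2)[OF net] z ab in auto)
  qed
qed

text \<open>For a stretch returning to its starting vertex, waiting there costs a multiple of the
  duration. If the stretch ends at T inside an edge, waiting also changes the final cost, by at most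
  a multiple of the displacement. \<open>fast_energy\<close> dominates both terms once the threshold
  is large.\<close>

lemma slow_from_vertex:
  assumes t: "0 \<le> t" "t < T"
  obtains M where "\<And>y v a b. bounded_optimal t r E0 y v \<Longrightarrow> t \<le> a \<Longrightarrow> a < b \<Longrightarrow> b \<le> T \<Longrightarrow>
     (\<forall>s\<in>{a<..<b}. y s \<notin> Vt) \<Longrightarrow> (y a \<in> Vt \<and> (b = T \<or> y b \<in> Vt)) \<or> (a = t \<and> b = T) \<Longrightarrow>
     \<not> negligible {s \<in> {a<..<b}. norm (v s) \<le> M}"
proof -
  obtain \<rho> where \<rho>: "0 < \<rho>" "\<And>u v. u \<in> Vt \<Longrightarrow> v \<in> Vt \<Longrightarrow> u \<noteq> v \<Longrightarrow> \<rho> \<le> dist u v"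
    by (rule vertex_separation) (rule that, assumption+)
  obtain Cv where Cv: "0 \<le> Cv" "\<And>a b z. z \<in> Vt \<Longrightarrow> 0 \<le> a \<Longrightarrow> a \<le> b \<Longrightarrow> b \<le> T \<Longrightarrow>
    cost a b (\<lambda>_. z) (\<lambda>_. 0) \<le> Cv * (b - a)"
    by (rule vertex_path_cost) (rule that, assumption+)
  obtain Lg where Lg: "0 \<le> Lg"
    "\<And>i v y. i \<in> E \<Longrightarrow> v \<in> Vt \<Longrightarrow> v \<in> J i \<Longrightarrow> co i v \<le> r \<Longrightarrow> y \<notin> Vt \<Longrightarrow> y \<in> J i \<Longrightarrow> co i y \<le> r \<Longrightarrow>
       g v - g y \<le> Lg * dist v y"
    by (rule final_cost_lipschitz_at_vertex[of r]) (rule that, assumption+)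
  \<comment> \<open>One threshold per obstruction, in this order: the stretch is all of [t,T]; it
    joins distinct vertices; waiting competes through its duration; ending at the vertex competes
    through the displacement.\<close>
  define K0 where "K0 = Max {2 * E0 / (T - t), 2 * E0 / \<rho>, 2 * (Cv + C0) / C0, 2 * Lg / C0} + 1"
  obtain M where M: "1 \<le> M" "K0 \<le> M powr (p - 1)" by (rule powr_level)
  define K where "K = M powr (p - 1)"
  have "x < K" if "x \<in> {2 * E0 / (T - t), 2 * E0 / \<rho>, 2 * (Cv + C0) / C0, 2 * Lg / C0}" for x
  proof -
    have "x \<le> Max {2 * E0 / (T - t), 2 * E0 / \<rho>, 2 * (Cv + C0) / C0, 2 * Lg / C0}"
      by (rule Max_ge) (use that in auto)
    then show ?thesis using M(2) unfolding K_def K0_def by linarith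
  qed
  then have "2 * E0 / (T - t) < K" "2 * E0 / \<rho> < K" "2 * (Cv + C0) / C0 < K" "2 * Lg / C0 < K" by blast+
  then have K: "2 * E0 < K * (T - t)" "2 * E0 < K * \<rho>" "2 * (Cv + C0) < K * C0" "2 * Lg < K * C0"
    using t \<rho>(1) C0_pos by (simp_all add: pos_divide_less_eq)
  have K0: "0 \<le> K" by (simp add: K_def)
  show thesis
  proof (rule that[of M], rule notI)
    fix y v a b
    assume bo: "bounded_optimal t r E0 y v" and ab: "t \<le> a" "a < b" "b \<le> T"
      and nv: "\<forall>s\<in>{a<..<b}. y s \<notin> Vt"
      and ends: "(y a \<in> Vt \<and> (b = T \<or> y b \<in> Vt)) \<or> (a = t \<and> b = T)"
      and fast: "negligible {s \<in> {a<..<b}. norm (v s) \<le> M}"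
    have 0: "0 \<le> a" "a \<le> b" using t ab by auto
    note tr = traj_subinterval[OF bounded_optimalD(2)[OF bo] ab(1) 0(2) ab(3)]
    note opt = bounded_optimalD(1)[OF bo]
    let ?e = "integral {a..b} (\<lambda>s. norm (v s) powr p)"
    define h where "h = b - a"
    define d where "d = dist (y a) (y b)"
    have hd: "0 < h" "0 \<le> d" using ab by (auto simp: h_def d_def)
    have e: "K * h + K * d \<le> 2 * ?e"
      using fast_energy[OF tr 0(2) M(1) fast] by (simp add: K_def h_def d_def algebra_simps)
    have e0: "?e \<le> E0" by (rule bounded_optimal_energy[OF bo ab(1) 0(2) ab(3)])
    have nn: "0 \<le> K * h" "0 \<le> K * d" using K0 hd by auto
    have low: "C0 * (?e - h) \<le> cost a b y v"
      unfolding h_def by (rule cost_coercive[OF tr tangential_subinterval[OF bounded_optimalD(3)[OF bo] ab(1,3)] 0 ab(3)])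
    \<comment> \<open>Twice the coercive lower bound with the energy replaced by
      \<open>fast_energy\<close>: linear in duration and displacement, with slope proportional to
      \<open>K\<close>.\<close>
    have low2: "C0 * K * h + C0 * K * d - 2 * C0 * h \<le> 2 * cost a b y v"
      using mult_left_mono[OF e less_imp_le[OF C0_pos]] low by (simp add: algebra_simps)
    have g1: "2 * (Cv + C0) * h < K * C0 * h" using K(3) hd(1) by (rule mult_strict_right_mono)
    consider "a = t" "b = T" | "y a \<in> Vt" "y b \<in> Vt" "y a \<noteq> y b" | "y a \<in> Vt" "y b = y a"
      | "y a \<in> Vt" "b = T" "y b \<notin> Vt"
      using ends by metis
    then show False
    proof cases
      case 1
      then have "K * (T - t) \<le> 2 * E0" using e e0 nn by (simp add: h_def)
      then show False using K(1) by linarith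
    next
      case 2
      then have "K * \<rho> \<le> K * d" using \<rho>(2) K0 unfolding d_def by (intro mult_left_mono) auto
      then show False using K(2) e e0 nn by linarith
    next
      case 3
      then have "cost a b y v \<le> cost a b (\<lambda>_. y a) (\<lambda>_. 0)"
        using vertices_subset_network by (intro optimal_segment[OF opt t(1) ab] const_traj) auto
      also have "\<dots> \<le> Cv * h" unfolding h_def by (rule Cv(2)[OF 3(1) 0 ab(3)])
      finally have "cost a b y v \<le> Cv * h" .
      moreover have "d = 0" using 3 by (simp add: d_def)
      ultimately have "C0 * K * h - 2 * C0 * h \<le> 2 * (Cv * h)" using low2 by simp
      then show False using g1 by (simp add: algebra_simps)
    next
      case 4
      obtain i where i: "i \<in> E" "\<And>s. a \<le> s \<Longrightarrow> s \<le> b \<Longrightarrow> y s \<in> J i"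
        by (rule interior_path_edge[OF tr ab(2) nv]) (rule that, assumption+)
      have J: "y a \<in> J i" "y b \<in> J i" using i(2) 0 by auto
      have "co i (y a) \<le> r" "co i (y b) \<le> r"
        using bounded_optimalD(4)[OF bo _ _ i(1)] J ab by auto
      then have "g (y a) - g (y b) \<le> Lg * d"
        unfolding d_def by (intro Lg(2)[OF i(1) 4(1) J(1) _ 4(3) J(2)])
      moreover have "cost a T y v + g (y T) \<le> cost a T (\<lambda>_. y a) (\<lambda>_. 0) + g (y a)"
        using vertices_subset_network 4(1) ab by (intro optimal_final[OF opt t(1) ab(1)] const_traj) auto
      moreover have "cost a b (\<lambda>_. y a) (\<lambda>_. 0) \<le> Cv * h" unfolding h_def by (rule Cv(2)[OF 4(1) 0 ab(3)])
      ultimately have "cost a b y v \<le> Cv * h + Lg * d" using 4(2) by simp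
      then have "C0 * K * h + C0 * K * d - 2 * C0 * h \<le> 2 * Cv * h + 2 * Lg * d" using low2 by linarith
      moreover have "2 * Lg * d \<le> K * C0 * d" using K(4) hd(2) by (intro mult_right_mono) auto
      ultimately show False using g1 by (simp add: algebra_simps)
    qed
  qed
qed

lemma maximal_vertex_free_interval:
  assumes cont: "continuous_on {\<theta>..T} y" and s: "\<theta> < s" "s < T" "y s \<notin> Vt"
  obtains a b where "\<theta> \<le> a" "a < s" "s < b" "b \<le> T" "\<forall>u\<in>{a<..<b}. y u \<notin> Vt"
    "a = \<theta> \<or> y a \<in> Vt" "b = T \<or> y b \<in> Vt"
proof -
  have clV: "closed Vt" by (rule finite_imp_closed[OF finite_vertices])
  \<comment> \<open>The last vertex visit before \<open>s\<close> is the supremum of this set and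
    the next one the infimum of \<open>B\<close>; adding the end points \<open>\<theta>\<close> and
    \<open>T\<close> covers the absence of a visit.\<close>
  define A where "A = {\<theta>} \<union> ({\<theta>..s} \<inter> y -` Vt)"
  define B where "B = {T} \<union> ({s..T} \<inter> y -` Vt)"
  have "closed ({\<theta>..s} \<inter> y -` Vt)" "closed ({s..T} \<inter> y -` Vt)"
    by (intro continuous_closed_preimage clV continuous_on_subset[OF cont]; use s in auto)+
  then have AB: "closed A" "closed B" unfolding A_def B_def by auto
  have bA: "bdd_above A" by (rule bdd_aboveI[of _ s]) (use s in \<open>auto simp: A_def\<close>)
  have bB: "bdd_below B" by (rule bdd_belowI[of _ s]) (use s in \<open>auto simp: B_def\<close>)
  have ne: "A \<noteq> {}" "B \<noteq> {}" by (auto simp: A_def B_def)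
  have SA: "Sup A \<in> A" "\<And>u. u \<in> A \<Longrightarrow> u \<le> Sup A"
    by (rule closed_contains_Sup[OF ne(1) bA AB(1)]) (rule cSup_upper[OF _ bA])
  have IB: "Inf B \<in> B" "\<And>u. u \<in> B \<Longrightarrow> Inf B \<le> u"
    by (rule closed_contains_Inf[OF ne(2) bB AB(2)]) (rule cInf_lower[OF _ bB])
  have "Sup A \<noteq> s" "Inf B \<noteq> s" using SA(1) IB(1) s by (auto simp: A_def B_def)
  then have o: "\<theta> \<le> Sup A" "Sup A < s" "s < Inf B" "Inf B \<le> T"
    using SA(1) IB(1) s by (auto simp: A_def B_def)
  show thesis
  proof (rule that[OF o])
    show "\<forall>u\<in>{Sup A<..<Inf B}. y u \<notin> Vt"
    proof (intro ballI notI)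
      fix u assume u: "u \<in> {Sup A<..<Inf B}" "y u \<in> Vt"
      then have "u \<in> A \<or> u \<in> B" using o unfolding A_def B_def by auto
      then show False using u(1) SA(2)[of u] IB(2)[of u] by auto
    qed
    show "Sup A = \<theta> \<or> y (Sup A) \<in> Vt" using SA(1) by (auto simp: A_def)
    show "Inf B = T \<or> y (Inf B) \<in> Vt" using IB(1) by (auto simp: B_def)
  qed
qed

text \<open>Maximal vertex-free intervals may be infinite in number, but Lindelof reduces the open
  cover to a countable one, and the exceptional null sets add up to a null set. At vertex times the
  tangential speed is 0.\<close>

lemma speed_bound_from_intervals:
  assumes bo: "bounded_optimal t r E0 y v" and \<theta>: "t \<le> \<theta>" "\<theta> \<le> T" and A: "0 < A"
    and int: "\<And>a b. \<theta> \<le> a \<Longrightarrow> a < b \<Longrightarrow> b \<le> T \<Longrightarrow> (\<forall>s\<in>{a<..<b}. y s \<notin> Vt) \<Longrightarrow>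
      a = \<theta> \<or> y a \<in> Vt \<Longrightarrow> b = T \<or> y b \<in> Vt \<Longrightarrow> negligible {s \<in> {a<..<b}. A < norm (v s)}"
  shows "negligible {s \<in> {\<theta>..T}. A < norm (v s)}"
proof -
  define F where "F = {{a<..<b} |a b. \<theta> \<le> a \<and> a < b \<and> b \<le> T \<and> (\<forall>s\<in>{a<..<b}. y s \<notin> Vt) \<and>
      (a = \<theta> \<or> y a \<in> Vt) \<and> (b = T \<or> y b \<in> Vt)}"
  have "\<And>S. S \<in> F \<Longrightarrow> open S" unfolding F_def by auto
  then obtain F' where F': "F' \<subseteq> F" "countable F'" "\<Union>F' = \<Union>F" by (rule Lindelof)
  have cont: "continuous_on {\<theta>..T} y"
    by (rule continuous_on_subset[OF trajD(4)[OF bounded_optimalD(2)[OF bo]]]) (use \<theta> in auto)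
  have "{s \<in> {\<theta>..T}. A < norm (v s)} \<subseteq> {\<theta>, T} \<union> \<Union>((\<lambda>S. {s \<in> S. A < norm (v s)}) ` F')"
  proof
    fix s assume s: "s \<in> {s \<in> {\<theta>..T}. A < norm (v s)}"
    show "s \<in> {\<theta>, T} \<union> \<Union>((\<lambda>S. {s \<in> S. A < norm (v s)}) ` F')"
    proof (cases "s = \<theta> \<or> s = T")
      case False
      then have s': "\<theta> < s" "s < T" using s by auto
      have "y s \<notin> Vt"
      proof
        assume "y s \<in> Vt"
        then have "v s = 0" using tangential_vertex[OF bounded_optimalD(3)[OF bo], of s] s \<theta> by auto
        then show False using s A by simp
      qed
      then obtain a b where ab: "\<theta> \<le> a" "a < s" "s < b" "b \<le> T" "\<forall>u\<in>{a<..<b}. y u \<notin> Vt"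
        "a = \<theta> \<or> y a \<in> Vt" "b = T \<or> y b \<in> Vt"
        by (rule maximal_vertex_free_interval[OF cont s']) (rule that, assumption+)
      then have "{a<..<b} \<in> F" unfolding F_def by (intro CollectI exI[of _ a] exI[of _ b]) auto
      moreover have "s \<in> {a<..<b}" using ab by simp
      ultimately have "s \<in> \<Union>F'" unfolding F'(3) by blast
      then show ?thesis using s by blast
    qed auto
  qed
  moreover have "negligible (\<Union>((\<lambda>S. {s \<in> S. A < norm (v s)}) ` F'))"
  proof (rule negligible_countable_Union)
    show "countable ((\<lambda>S. {s \<in> S. A < norm (v s)}) ` F')" using F'(2) by (rule countable_image)
    fix S assume "S \<in> (\<lambda>S. {s \<in> S. A < norm (v s)}) ` F'"
    then obtain S' where S': "S' \<in> F" "S = {s \<in> S'. A < norm (v s)}" using F'(1) by blast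
    then obtain a b where ab: "S' = {a<..<b}" "\<theta> \<le> a" "a < b" "b \<le> T" "\<forall>s\<in>{a<..<b}. y s \<notin> Vt"
      "a = \<theta> \<or> y a \<in> Vt" "b = T \<or> y b \<in> Vt" unfolding F_def by blast
    show "negligible S" unfolding S'(2) ab(1) by (rule int[OF ab(2-7)])
  qed
  ultimately show ?thesis
    by (meson negligible_Un negligible_insert negligible_empty negligible_subset)
qed

lemma edge_path_cost:
  assumes i: "i \<in> E" and \<beta>: "\<beta>0 \<in> I i" "\<beta>1 \<in> I i" "\<beta>0 \<le> r" "\<beta>1 \<le> r" and ab: "0 \<le> a" "a < b" "b \<le> T"
    and m: "\<bar>\<beta>1 - \<beta>0\<bar> \<le> m * (b - a)"
    and C: "\<And>y \<alpha> s. y \<in> network_set G \<Longrightarrow> s \<in> {0..T} \<Longrightarrow>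
       (\<forall>i\<in>E. y \<in> J i \<longrightarrow> y \<notin> Vt \<longrightarrow> co i y \<le> r \<and> \<bar>\<alpha> \<bullet> e i\<bar> \<le> m) \<Longrightarrow> L y \<alpha> s \<le> C"
  obtains q w where "traj a b q w" "q a = pt i \<beta>0" "q b = pt i \<beta>1" "cost a b q w \<le> C * (b - a)"
proof -
  let ?c = "\<lambda>s. \<beta>0 + (s - a) / (b - a) * (\<beta>1 - \<beta>0)"
  let ?w = "((\<beta>1 - \<beta>0) / (b - a)) *\<^sub>R e i"
  note path = edge_path_traj[OF i \<beta>(1,2) ab(2)]
  have "cost a b (\<lambda>s. pt i (?c s)) (\<lambda>_. ?w) \<le> C * (b - a)"
  proof (rule cost_le[OF path(1) ab(1,3) less_imp_le[OF ab(2)]])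
    fix s assume s: "a \<le> s" "s \<le> b"
    have c: "?c s \<in> I i" "?c s \<le> r" using path(2)[OF s] \<beta> by auto
    have J: "pt i (?c s) \<in> J i" by (rule pt_in_edge[OF i c(1)])
    show "L (pt i (?c s)) ?w s \<le> C"
    proof (rule C)
      show "pt i (?c s) \<in> network_set G" using J edge_subset_network[OF i] by blast
      show "s \<in> {0..T}" using s ab by auto
      have "\<bar>?w \<bullet> e i\<bar> \<le> m" using m ab by (simp add: dir_inner[OF i] pos_divide_le_eq)
      then have "co i (pt i (?c s)) \<le> r \<and> \<bar>?w \<bullet> e i\<bar> \<le> m" using c(2) co_pt[OF i] by simp
      moreover have "k = i" if "k \<in> E" "pt i (?c s) \<in> J k" "pt i (?c s) \<notin> Vt" for k
        by (rule edge_unique[OF that(1) i that(2) J that(3)])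
      ultimately show "\<forall>k\<in>E. pt i (?c s) \<in> J k \<longrightarrow> pt i (?c s) \<notin> Vt \<longrightarrow>
          co k (pt i (?c s)) \<le> r \<and> \<bar>?w \<bullet> e k\<bar> \<le> m" by blast
    qed
  qed
  then show thesis
    using that[OF path(1)] ab by simp
qed

text \<open>A fast initial stretch from an interior point \<open>x\<close> to a vertex \<open>z\<close> at distance \<open>d\<close>, reached at
  time \<open>b\<close>, is replaced by reaching \<open>z\<close> at time \<open>b + d\<close> and rejoining the trajectory at time
  \<open>b + 2 * d\<close>; after time \<open>b\<close> its speed is already controlled, so this detour has bounded speed.\<close>

lemma slow_initial:
  assumes t: "0 \<le> t" "t < T" and A1: "0 < A1"
  obtains M where "\<And>y v b. bounded_optimal t r E0 y v \<Longrightarrow> t < b \<Longrightarrow> b < T \<Longrightarrow>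
     (\<forall>s\<in>{t<..<b}. y s \<notin> Vt) \<Longrightarrow> y t \<notin> Vt \<Longrightarrow> y b \<in> Vt \<Longrightarrow>
     negligible {s \<in> {b..T}. A1 < norm (v s)} \<Longrightarrow>
     \<not> negligible {s \<in> {t<..<b}. norm (v s) \<le> M}"
proof -
  obtain \<rho> where \<rho>: "0 < \<rho>" "\<And>u v. u \<in> Vt \<Longrightarrow> v \<in> Vt \<Longrightarrow> u \<noteq> v \<Longrightarrow> \<rho> \<le> dist u v"
    by (rule vertex_separation) (rule that, assumption+)
  \<comment> \<open>The speeds of the two legs: the approach covers \<open>d\<close> in time
    \<open>h + d\<close>, the catching-up covers at most \<open>A1 * 2 * d\<close> in time
    \<open>d\<close>.\<close>
  define m where "m = max 1 (2 * A1)"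
  obtain C where C: "0 \<le> C" "\<And>y \<alpha> s. y \<in> network_set G \<Longrightarrow> s \<in> {0..T} \<Longrightarrow>
       (\<forall>i\<in>E. y \<in> J i \<longrightarrow> y \<notin> Vt \<longrightarrow> co i y \<le> r \<and> \<bar>\<alpha> \<bullet> e i\<bar> \<le> m) \<Longrightarrow> L y \<alpha> s \<le> C"
    by (rule running_cost_bounded[of r m]) (rule that, assumption+)
  \<comment> \<open>The first bound makes \<open>b + 2 * d\<close> smaller than \<open>T\<close>,
    the second prevents the trajectory from reaching another vertex by that time, and the third
    makes the detour strictly cheaper.\<close>
  define K0 where "K0 = Max {4 * E0 / (T - t), 4 * A1 * E0 / \<rho>, 4 * (C + C0) / C0} + 1"
  obtain M where M: "1 \<le> M" "K0 \<le> M powr (p - 1)" by (rule powr_level)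
  define K where "K = M powr (p - 1)"
  have "x < K" if "x \<in> {4 * E0 / (T - t), 4 * A1 * E0 / \<rho>, 4 * (C + C0) / C0}" for x
  proof -
    have "x \<le> Max {4 * E0 / (T - t), 4 * A1 * E0 / \<rho>, 4 * (C + C0) / C0}"
      by (rule Max_ge) (use that in auto)
    then show ?thesis using M(2) unfolding K_def K0_def by linarith
  qed
  then have "4 * E0 / (T - t) < K" "4 * A1 * E0 / \<rho> < K" "4 * (C + C0) / C0 < K" by blast+
  then have K: "4 * E0 < K * (T - t)" "4 * A1 * E0 < K * \<rho>" "4 * (C + C0) < K * C0"
    using t \<rho>(1) C0_pos by (simp_all add: pos_divide_less_eq)
  have Kpos: "0 < K" using M(1) by (simp add: K_def)
  show thesis
  proof (rule that[of M], rule notI)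
    fix y v b
    assume bo: "bounded_optimal t r E0 y v" and b: "t < b" "b < T"
      and nv: "\<forall>s\<in>{t<..<b}. y s \<notin> Vt" and yt: "y t \<notin> Vt" and yb: "y b \<in> Vt"
      and later: "negligible {s \<in> {b..T}. A1 < norm (v s)}"
      and fast: "negligible {s \<in> {t<..<b}. norm (v s) \<le> M}"
    note tr = bounded_optimalD(2)[OF bo]
    note opt = bounded_optimalD(1)[OF bo]
    have trb: "traj t b y v" by (rule traj_subinterval[OF tr]) (use b in auto)
    let ?e = "integral {t..b} (\<lambda>s. norm (v s) powr p)"
    define h where "h = b - t"
    define d where "d = dist (y t) (y b)"
    have d: "0 < d" using yt yb by (auto simp: d_def)
    have h: "0 < h" using b by (simp add: h_def)
    have e: "K * (h + d) \<le> 2 * ?e"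
      using fast_energy[OF trb less_imp_le[OF b(1)] M(1) fast] by (simp add: K_def h_def d_def)
    have "?e \<le> E0" by (rule bounded_optimal_energy[OF bo]) (use b in auto)
    then have e0: "K * (h + d) \<le> 2 * E0" using e by linarith
    have "K * (2 * (h + d)) < K * (T - t)" using e0 K(1) by linarith
    then have hd: "2 * (h + d) < T - t" using Kpos by simp
    have "2 * A1 * (K * (h + d)) \<le> 2 * A1 * (2 * E0)" using e0 A1 by (intro mult_left_mono) auto
    then have "K * (2 * A1 * (h + d)) < K * \<rho>" using K(2) by (simp add: algebra_simps)
    then have hd\<rho>: "2 * A1 * (h + d) < \<rho>" using Kpos by simp
    define c1 where "c1 = b + d"
    define c2 where "c2 = b + 2 * d"
    have c: "b < c1" "c1 < c2" "c2 < T" "t < c1" "t < c2" "b < c2"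
      using hd h d b by (auto simp: c1_def c2_def h_def)
    have near: "dist (y b) (y s) \<le> A1 * (s - b)" if s: "b \<le> s" "s \<le> T" for s
    proof -
      have trs: "traj b s y v" by (rule traj_subinterval[OF tr]) (use b s in auto)
      have "dist (y b) (y s) \<le> integral {b..s} (\<lambda>u. norm (v u))" by (rule displacement_le[OF trs s(1)])
      also have "\<dots> \<le> integral {b..s} (\<lambda>_. A1)"
        by (rule integral_le_off_negligible[OF traj_speed_integrable[OF trs] integrable_const_ivl later]) (use s in auto)
      finally show ?thesis using s by (simp add: mult.commute)
    qed
    obtain i where i: "i \<in> E" "\<And>s. t \<le> s \<Longrightarrow> s \<le> b \<Longrightarrow> y s \<in> J i"
      by (rule interior_path_edge[OF trb b(1) nv]) (rule that, assumption+)
    have J: "y t \<in> J i" "y b \<in> J i" using i(2) b by auto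
    have co_r: "co k (y s) \<le> r" if "k \<in> E" "t \<le> s" "s \<le> T" "y s \<in> J k" for k s
      using bounded_optimalD(4)[OF bo] that by blast
    have dA: "A1 * (2 * d) < \<rho>"
      using hd\<rho> mult_pos_pos[OF A1 h] by (simp add: algebra_simps)
    have d_eq: "d = \<bar>co i (y b) - co i (y t)\<bar>"
      unfolding d_def by (rule dist_co[OF i(1) J])
    \<comment> \<open>The second leg has to run within a single edge. Between \<open>b\<close> and
      \<open>c2\<close> the trajectory is too slow to meet a vertex other than \<open>y b\<close>,
      so its last vertex before \<open>c2\<close> is \<open>y b\<close>, and \<open>y c2\<close>
      lies on an edge through that vertex.\<close>
    have "\<exists>k\<in>E. y b \<in> J k \<and> y c2 \<in> J k"
    proof (cases "y c2 \<in> Vt")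
      case True
      have "dist (y b) (y c2) \<le> A1 * (2 * d)" using near[of c2] c by (simp add: c2_def)
      also have "\<dots> < \<rho>" by (rule dA)
      finally have "y b = y c2" using \<rho>(2)[OF yb True] by force
      then show ?thesis using i(1) J(2) by metis
    next
      case False
      have cont: "continuous_on {b..T} y" by (rule continuous_on_subset[OF trajD(4)[OF tr]]) (use b in auto)
      obtain a' b' where ab': "b \<le> a'" "a' < c2" "c2 < b'" "b' \<le> T" "\<forall>u\<in>{a'<..<b'}. y u \<notin> Vt"
        "a' = b \<or> y a' \<in> Vt"
        by (rule maximal_vertex_free_interval[OF cont c(6,3) False]) (rule that, assumption+)
      have "traj a' b' y v" "a' < b'" by (rule traj_subinterval[OF tr]) (use b ab' in auto)
      then obtain k where k: "k \<in> E" "\<And>s. a' \<le> s \<Longrightarrow> s \<le> b' \<Longrightarrow> y s \<in> J k"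
        by (rule interior_path_edge[OF _ _ ab'(5)]) (rule that, assumption+)
      have "y a' \<in> Vt" using ab'(6) yb by auto
      have "dist (y b) (y a') \<le> A1 * (a' - b)" using near[of a'] ab' by simp
      also have "\<dots> \<le> A1 * (2 * d)" using A1 ab'(2) by (simp add: c2_def)
      also have "\<dots> < \<rho>" by (rule dA)
      finally have "y b = y a'" using \<rho>(2)[OF yb \<open>y a' \<in> Vt\<close>] by force
      then show ?thesis using k ab' by (intro bexI[OF _ k(1)]) auto
    qed
    then obtain k where k: "k \<in> E" "y b \<in> J k" "y c2 \<in> J k" by blast
    have m: "1 \<le> m" "2 * A1 \<le> m" by (auto simp: m_def)
    obtain q1 w1 where 1: "traj t c1 q1 w1" "q1 t = pt i (co i (y t))" "q1 c1 = pt i (co i (y b))"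
      "cost t c1 q1 w1 \<le> C * (c1 - t)"
    proof (rule edge_path_cost[OF i(1) _ _ _ _ t(1) c(4) _ _ C(2)])
      show "co i (y t) \<in> I i" "co i (y b) \<in> I i" using edge_setD[OF i(1)] J by auto
      show "co i (y t) \<le> r" "co i (y b) \<le> r" using co_r[OF i(1)] J b by auto
      have "d \<le> 1 * (c1 - t)" using b by (simp add: c1_def)
      also have "\<dots> \<le> m * (c1 - t)" using m c by (intro mult_right_mono) auto
      finally show "\<bar>co i (y b) - co i (y t)\<bar> \<le> m * (c1 - t)" using d_eq by simp
    qed (use c in auto)
    obtain q2 w2 where 2: "traj c1 c2 q2 w2" "q2 c1 = pt k (co k (y b))" "q2 c2 = pt k (co k (y c2))"
      "cost c1 c2 q2 w2 \<le> C * (c2 - c1)"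
    proof (rule edge_path_cost[OF k(1) _ _ _ _ _ c(2) _ _ C(2)])
      show "co k (y b) \<in> I k" "co k (y c2) \<in> I k" using edge_setD[OF k(1)] k by auto
      show "co k (y b) \<le> r" "co k (y c2) \<le> r" using co_r[OF k(1)] k b c by auto
      have "\<bar>co k (y c2) - co k (y b)\<bar> = dist (y b) (y c2)"
        by (rule dist_co[OF k, symmetric])
      also have "\<dots> \<le> 2 * A1 * (c2 - c1)" using near[of c2] c by (simp add: c2_def c1_def)
      also have "\<dots> \<le> m * (c2 - c1)" using m c by (intro mult_right_mono) auto
      finally show "\<bar>co k (y c2) - co k (y b)\<bar> \<le> m * (c2 - c1)" .
    qed (use c t in auto)
    have q: "q1 t = y t" "q1 c1 = y b" "q2 c1 = y b" "q2 c2 = y c2"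
      using 1(2,3) 2(2,3) pt_co[OF i(1)] pt_co[OF k(1)] J k by simp_all
    have "q1 c1 = q2 c1" using q by simp
    note cc = traj_concat[OF 1(1) 2(1) this less_imp_le[OF c(4)] less_imp_le[OF c(2)] t(1) less_imp_le[OF c(3)]]
    have "cost t c2 y v \<le> cost t c1 q1 w1 + cost c1 c2 q2 w2"
      using optimal_segment[OF opt t(1) order_refl c(5) less_imp_le[OF c(3)] cc(1)] cc(2) q c by simp
    also have "\<dots> \<le> C * (h + 2 * d)"
      using 1(4) 2(4) by (simp add: c1_def c2_def h_def algebra_simps)
    also have "\<dots> \<le> C * (2 * (h + d))" using C(1) h by (intro mult_left_mono) auto
    finally have up: "cost t c2 y v \<le> 2 * C * (h + d)" by (simp add: algebra_simps)
    \<comment> \<open>The energy is counted only up to \<open>b\<close>; on [b,c2] the trivial lower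
      bound \<open>- C0\<close> is enough.\<close>
    have "C0 * (?e - h) + - C0 * (2 * d) \<le> cost t b y v + cost b c2 y v"
    proof (rule add_mono)
      show "C0 * (?e - h) \<le> cost t b y v"
        unfolding h_def by (rule cost_coercive[OF trb tangential_subinterval[OF bounded_optimalD(3)[OF bo]]]) (use t b in auto)
      have "traj b c2 y v" by (rule traj_subinterval[OF tr]) (use b c in auto)
      from cost_ge[OF this] show "- C0 * (2 * d) \<le> cost b c2 y v" using t b c by (simp add: c2_def)
    qed
    also have "\<dots> = cost t c2 y v"
      by (rule cost_combine[symmetric]) (use traj_subinterval[OF tr, of t c2] t b c in auto)
    finally have "C0 * ?e \<le> 2 * C * (h + d) + C0 * (h + 2 * d)" using up by (simp add: algebra_simps)
    also have "\<dots> \<le> 2 * C * (h + d) + C0 * (2 * (h + d))" using C0_pos h by (intro add_left_mono mult_left_mono) auto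
    finally have "2 * (C0 * ?e) \<le> 4 * (C + C0) * (h + d)" by (simp add: algebra_simps)
    moreover have "K * C0 * (h + d) \<le> 2 * (C0 * ?e)"
      using mult_left_mono[OF e less_imp_le[OF C0_pos]] by (simp add: mult_ac)
    ultimately have "K * C0 * (h + d) \<le> 4 * (C + C0) * (h + d)" by linarith
    then show False using K(3) h d by simp
  qed
qed

text \<open>Only a stretch from an interior starting point to a vertex lacks a slow set
  independently of the rest. The bound \<open>A1\<close> is first proved from any vertex time on,
  and then used for the detour, which gives the threshold \<open>M2\<close> and the second bound
  \<open>A2\<close>.\<close>

lemma speed_bound:
  assumes t: "0 \<le> t" "t < T"
  obtains V where "0 < V" "\<And>y v. optimal t y v \<Longrightarrow> norm (y t) \<le> R \<Longrightarrow> negligible {s \<in> {t..T}. V < norm (v s)}"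
proof -
  obtain r E0 where bnd: "\<And>t y v. 0 \<le> t \<Longrightarrow> t \<le> T \<Longrightarrow> optimal t y v \<Longrightarrow> norm (y t) \<le> R \<Longrightarrow> bounded_optimal t r E0 y v"
    by (rule optimal_bounded[of R]) (rule that, assumption+)
  obtain M1 where M1: "\<And>y v a b. bounded_optimal t r E0 y v \<Longrightarrow> t \<le> a \<Longrightarrow> a < b \<Longrightarrow> b \<le> T \<Longrightarrow>
     (\<forall>s\<in>{a<..<b}. y s \<notin> Vt) \<Longrightarrow> (y a \<in> Vt \<and> (b = T \<or> y b \<in> Vt)) \<or> (a = t \<and> b = T) \<Longrightarrow>
     \<not> negligible {s \<in> {a<..<b}. norm (v s) \<le> M1}"
    by (rule slow_from_vertex[OF t, of r E0]) (rule that, assumption+)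
  obtain A1 where A1: "0 < A1" "\<And>t y v a b. bounded_optimal t r E0 y v \<Longrightarrow> 0 \<le> t \<Longrightarrow> t \<le> a \<Longrightarrow> a < b \<Longrightarrow> b \<le> T \<Longrightarrow>
     (\<forall>s\<in>{a<..<b}. y s \<notin> Vt) \<Longrightarrow> \<not> negligible {s \<in> {a<..<b}. norm (v s) \<le> M1} \<Longrightarrow>
     negligible {s \<in> {a<..<b}. A1 < norm (v s)}"
    by (rule fast_negligible[of r E0 M1]) (rule that, assumption+)
  \<comment> \<open>Restarting at a vertex time makes every later maximal interval begin at a
    vertex, so the initial stretch does not occur.\<close>
  have later: "negligible {s \<in> {b..T}. A1 < norm (v s)}"
    if bo: "bounded_optimal t r E0 y v" and b: "t \<le> b" "b \<le> T" "y b \<in> Vt" for y v b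
  proof (rule speed_bound_from_intervals[OF bo b(1,2) A1(1)])
    fix a c assume ac: "b \<le> a" "a < c" "c \<le> T" "\<forall>s\<in>{a<..<c}. y s \<notin> Vt" "a = b \<or> y a \<in> Vt" "c = T \<or> y c \<in> Vt"
    then have "t \<le> a" "(y a \<in> Vt \<and> (c = T \<or> y c \<in> Vt)) \<or> (a = t \<and> c = T)" using b by auto
    then show "negligible {s \<in> {a<..<c}. A1 < norm (v s)}"
      by (intro A1(2)[OF bo t(1) _ ac(2-4)] M1[OF bo _ ac(2-4)])
  qed
  obtain M2 where M2: "\<And>y v b. bounded_optimal t r E0 y v \<Longrightarrow> t < b \<Longrightarrow> b < T \<Longrightarrow>
     (\<forall>s\<in>{t<..<b}. y s \<notin> Vt) \<Longrightarrow> y t \<notin> Vt \<Longrightarrow> y b \<in> Vt \<Longrightarrow>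
     negligible {s \<in> {b..T}. A1 < norm (v s)} \<Longrightarrow> \<not> negligible {s \<in> {t<..<b}. norm (v s) \<le> M2}"
    by (rule slow_initial[OF t A1(1), of r E0]) (rule that, assumption+)
  obtain A2 where A2: "0 < A2" "\<And>t y v a b. bounded_optimal t r E0 y v \<Longrightarrow> 0 \<le> t \<Longrightarrow> t \<le> a \<Longrightarrow> a < b \<Longrightarrow> b \<le> T \<Longrightarrow>
     (\<forall>s\<in>{a<..<b}. y s \<notin> Vt) \<Longrightarrow> \<not> negligible {s \<in> {a<..<b}. norm (v s) \<le> M2} \<Longrightarrow>
     negligible {s \<in> {a<..<b}. A2 < norm (v s)}"
    by (rule fast_negligible[of r E0 M2]) (rule that, assumption+)
  show thesis
  proof (rule that[of "max A1 A2"])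
    fix y v assume "optimal t y v" "norm (y t) \<le> R"
    then have bo: "bounded_optimal t r E0 y v" using bnd t by simp
    show "negligible {s \<in> {t..T}. max A1 A2 < norm (v s)}"
    proof (rule speed_bound_from_intervals[OF bo order_refl less_imp_le[OF t(2)]])
      fix a b assume ab: "t \<le> a" "a < b" "b \<le> T" "\<forall>s\<in>{a<..<b}. y s \<notin> Vt" "a = t \<or> y a \<in> Vt" "b = T \<or> y b \<in> Vt"
      show "negligible {s \<in> {a<..<b}. max A1 A2 < norm (v s)}"
      proof (cases "y a \<in> Vt \<or> b = T")
        case True
        then have "(y a \<in> Vt \<and> (b = T \<or> y b \<in> Vt)) \<or> (a = t \<and> b = T)" using ab by auto
        then have "negligible {s \<in> {a<..<b}. A1 < norm (v s)}"
          by (intro A1(2)[OF bo t(1) ab(1-4)] M1[OF bo ab(1-4)])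
        then show ?thesis by (rule negligible_subset) auto
      next
        \<comment> \<open>What remains is the stretch from an interior starting point to a first
          vertex before T.\<close>
        case False
        then have f: "a = t" "y t \<notin> Vt" "y b \<in> Vt" "t < b" "b < T" using ab by auto
        have "\<not> negligible {s \<in> {t<..<b}. norm (v s) \<le> M2}"
          using ab(4) f by (intro M2[OF bo] later[OF bo]) auto
        then have "negligible {s \<in> {a<..<b}. A2 < norm (v s)}"
          using f by (intro A2(2)[OF bo t(1) ab(1-4)]) auto
        then show ?thesis by (rule negligible_subset) auto
      qed
    qed (use A1 in simp)
  qed (use A1 in simp)
qed

lemma optimal_trajectory_Linf:
  assumes t: "t \<in> {0..T}"
  obtains V where "0 < V" "\<And>x y. norm x \<le> R \<Longrightarrow> y \<in> optimal_trajectories G D p T t x \<Longrightarrow>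
    Linf_on t T (weak_deriv t T y) \<and> Linf_norm t T (weak_deriv t T y) \<le> ereal V"
proof -
  have "\<exists>V>0. \<forall>y v. optimal t y v \<longrightarrow> norm (y t) \<le> R \<longrightarrow> negligible {s \<in> {t..T}. V < norm (v s)}"
  proof (cases "t = T")
    \<comment> \<open>The interval is a single point, so every positive constant is an essential
      bound.\<close>
    case True
    have "negligible {s \<in> {t..T}. 1 < norm (v s)}" for v :: "real \<Rightarrow> 'a"
      by (rule negligible_subset[OF negligible_sing[of T]]) (use True in auto)
    then show ?thesis by (intro exI[of _ 1]) auto
  next
    case False
    then have "0 \<le> t" "t < T" using t by auto
    then obtain V where "0 < V" "\<And>y v. optimal t y v \<Longrightarrow> norm (y t) \<le> R \<Longrightarrow> negligible {s \<in> {t..T}. V < norm (v s)}"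
      by (rule speed_bound[of t R]) (rule that, assumption+)
    then show ?thesis by blast
  qed
  then obtain V where V: "0 < V"
    "\<And>y v. optimal t y v \<Longrightarrow> norm (y t) \<le> R \<Longrightarrow> negligible {s \<in> {t..T}. V < norm (v s)}" by blast
  show thesis
  proof (rule that[OF V(1)])
    fix x y assume x: "norm x \<le> R" and y: "y \<in> optimal_trajectories G D p T t x"
    have t': "0 \<le> t" "t \<le> T" using t by auto
    obtain v where v: "optimal t y v" "negligible {s \<in> {t..T}. v s \<noteq> weak_deriv t T y s}" "y t = x"
      by (rule optimal_trajectory_imp_optimal[OF y t']) (rule that, assumption+)
    have n: "negligible {s \<in> {t..T}. V < norm (v s)}" using V(2)[OF v(1)] v(3) x by simp
    have "negligible {s \<in> {t..T}. \<not> norm (weak_deriv t T y s) \<le> V}"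
      by (rule negligible_subset[OF negligible_Un[OF n v(2)]]) auto
    then have "AE s in lebesgue_on {t..T}. norm (weak_deriv t T y s) \<le> V"
      by (rule AE_lebesgue_on_interval)
    then have ae: "AE s in lebesgue_on {t..T}. ereal (norm (weak_deriv t T y s)) \<le> ereal V" by simp
    have m: "weak_deriv t T y \<in> borel_measurable (lebesgue_on {t..T})"
      by (rule primitive_on_measurable[OF trajD(1)[OF traj_weak_deriv(2)[OF optimalD(1)[OF v(1)] t']]])
    then have "(\<lambda>s. ereal (norm (weak_deriv t T y s))) \<in> borel_measurable (lebesgue_on {t..T})" by measurable
    then have "Linf_norm t T (weak_deriv t T y) \<le> ereal V"
      unfolding Linf_norm_def using ae by (rule esssup_I)
    then show "Linf_on t T (weak_deriv t T y) \<and> Linf_norm t T (weak_deriv t T y) \<le> ereal V"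
      unfolding Linf_on_def using m by (auto intro: le_less_trans)
  qed
qed

end

theorem mainTheorem11:
  fixes G :: "('a::euclidean_space) network" and D :: cost_data and p T :: real
  assumes "is_network G"
    and "0 < T" and "1 < p"
    and "standing_assumptions G D p T"
    and "\<forall>i\<in>{1..num_edges G}. C1_on (edge_domain G i) (edge_final D i)"
  shows "(\<forall>x\<in>network_set G. \<forall>t\<in>{0..T}. \<forall>y\<in>optimal_trajectories G D p T t x.
            Linf_on t T (weak_deriv t T y)) \<and>
         (\<exists>V :: real \<Rightarrow> real \<Rightarrow> real. (\<forall>r \<tau>. 0 < V r \<tau>) \<and>
            (\<forall>x\<in>network_set G. \<forall>t\<in>{0..T}. \<forall>y\<in>optimal_trajectories G D p T t x.
               Linf_norm t T (weak_deriv t T y) \<le> ereal (V (norm x) (T - t))))"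
proof -
  interpret control_problem G D p T
    by unfold_locales (use assms in auto)
  \<comment> \<open>The constant has to be a function of |x| and T-t alone, so it is chosen for each
    pair of numbers, with t recovered as \<open>T - \<tau>\<close>; for times outside [0,T] only
    positivity is demanded.\<close>
  define P where "P R \<tau> V \<longleftrightarrow> V > 0 \<and> (T - \<tau> \<in> {0..T} \<longrightarrow>
      (\<forall>x y. norm x \<le> R \<longrightarrow> y \<in> optimal_trajectories G D p T (T - \<tau>) x \<longrightarrow>
        Linf_on (T - \<tau>) T (weak_deriv (T - \<tau>) T y) \<and>
        Linf_norm (T - \<tau>) T (weak_deriv (T - \<tau>) T y) \<le> ereal V))" for R \<tau> V
  have "\<exists>V. P R \<tau> V" for R \<tau>
  proof (cases "T - \<tau> \<in> {0..T}")
    case True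
    show ?thesis unfolding P_def by (rule optimal_trajectory_Linf[OF True, of R]) blast
  qed (use zero_less_one in \<open>unfold P_def, blast\<close>)
  then obtain V where V: "\<And>R \<tau>. P R \<tau> (V R \<tau>)" by metis
  have main: "Linf_on t T (weak_deriv t T y)" "Linf_norm t T (weak_deriv t T y) \<le> ereal (V (norm x) (T - t))"
    if "t \<in> {0..T}" "y \<in> optimal_trajectories G D p T t x" for x t y
    using V[of "norm x" "T - t"] that unfolding P_def by auto
  moreover have "\<forall>r \<tau>. 0 < V r \<tau>" using V unfolding P_def by blast
  ultimately show ?thesis by blast
qed

end
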